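(* A function $f:\mathbb R^{n+1}\to\mathbb R_n$ belongs to $\mathcal M_0$ if and only if it has an expansion $$f(x)=\sum_{j,k\in\mathbb N_0}X^{(j)}_k(x)P_{k,j}(\underline x)$$ for some $k$-homogeneous monogenic polynomials $P_{k,j}:\mathbb R^n\to\mathbb R_n$ satisfying $$\limsup_{j+k\to\infty}\sqrt[j+k]{\|P_{k,j}\|}=0,$$ where $\|\cdot\|$ is either $\|\cdot\|_{L_2}$ or $\|\cdot\|_\infty$ on $S^{n-1}$; such an expansion is unique.
   Context: $\mathbb R_n$ is the real Clifford algebra generated by $e_1,\dots,e_n$ with $e_ie_j+e_je_i=-2\delta_{ij}$; $|\cdot|$ its Euclidean norm. Identify $\underline x\in\mathbb R^n$ with $\sum_jx_je_j$ and $x=(x_0,\underline x)$ with $x_0+\underline x$. A function is monogenic if $(\partial_{x_0}+\sum_je_j\partial_{x_j})f=0$; $\mathcal M_0$ is the right $\mathbb R_n$-module of monogenic functions on $\mathbb R^{n+1}$. A $k$-homogeneous monogenic polynomial (spherical monogenic) is a homogeneous polynomial $P:\mathbb R^n\to\mathbb R_n$ of degree $k$ with $\sum_je_j\partial_{x_j}P=0$. Norms on $S^{n-1}$: $\|g\|^2_{L_2}=\frac1{A_n}\int_{S^{n-1}}|g(\underline\omega)|^2d\underline\omega$ ($A_n$ the area of $S^{n-1}$) and $\|g\|_\infty=\sup_{S^{n-1}}|g|$. Gegenbauer polynomials $C^\nu_j(z)=\sum_{i=0}^{[j/2]}\frac{(-1)^i(\nu)_{j-i}}{i!(j-2i)!}(2z)^{j-2i}$,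 $(\nu)_j=\nu(\nu+1)\cdots(\nu+j-1)$. $X^{(0)}_k=1$ and, for $j\ge1$, $X^{(j)}_k(x)=\mu^j_k|x|^j\big(C^{(n-1)/2+k}_j(\frac{x_0}{|x|})+\frac{n+2k-1}{n+2k+j-1}C^{(n+1)/2+k}_{j-1}(\frac{x_0}{|x|})\frac{\underline x}{|x|}\big)$ with $\mu^{2l}_k=(-1)^l(C^{(n-1)/2+k}_{2l}(0))^{-1}$, $\mu^{2l+1}_k=(-1)^l\frac{n+2k+2l}{n+2k-1}(C^{(n+1)/2+k}_{2l}(0))^{-1}$. *)

theory Defs
  imports "HOL-Analysis.Analysis"
begin

text \<open>Real Clifford algebra R_n with generators e_i indexed by a finite linearly
ordered type 'n (n = CARD('n)). An element is a real vector indexed by the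
subsets A of 'n (coefficient of e_A = e_a1 ... e_ar, a1 < ... < ar).
The norm of real ^ ('n set) is the Euclidean norm of the coefficients.\<close>

type_synonym 'n cliff = "real ^ ('n set)"

definition csign :: "'n::{finite,linorder} set \<Rightarrow> 'n set \<Rightarrow> real" where
  "csign A B = (-1) ^ (card {(a, b). a \<in> A \<and> b \<in> B \<and> b < a} + card (A \<inter> B))"

text \<open>e_A e_B = csign A B e_(A sym-diff B), from e_i e_j = - e_j e_i (i /= j), e_i^2 = -1.\<close>
definition cmul :: "'n::{finite,linorder} cliff \<Rightarrow> 'n cliff \<Rightarrow> 'n cliff" where
  "cmul a b = (\<chi> C. \<Sum>A\<in>UNIV. \<Sum>B\<in>UNIV.
      if (A - B) \<union> (B - A) = C then csign A B * (a $ A) * (b $ B) else 0)"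

definition cone :: "'n::{finite,linorder} cliff" where
  "cone = (\<chi> A. if A = {} then 1 else 0)"

definition cgen :: "'n::{finite,linorder} \<Rightarrow> 'n cliff" where
  "cgen j = (\<chi> A. if A = {j} then 1 else 0)"

definition cvec :: "real ^ 'n::{finite,linorder} \<Rightarrow> 'n cliff" where
  "cvec v = (\<Sum>j\<in>UNIV. (v $ j) *\<^sub>R cgen j)"

definition monogenic :: "(real \<times> (real ^ 'n::{finite,linorder}) \<Rightarrow> 'n cliff) \<Rightarrow> bool" where
  "monogenic f \<longleftrightarrow> (\<exists>f'. (\<forall>x. (f has_derivative f' x) (at x))
     \<and> (\<forall>v. continuous_on UNIV (\<lambda>x. f' x v))
     \<and> (\<forall>x. f' x (1, 0) + (\<Sum>j\<in>UNIV. cmul (cgen j) (f' x (0, axis j 1))) = 0))"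

definition hom_poly :: "nat \<Rightarrow> (real ^ 'n::{finite,linorder} \<Rightarrow> 'n cliff) \<Rightarrow> bool" where
  "hom_poly k P \<longleftrightarrow> (\<exists>c :: ('n \<Rightarrow> nat) \<Rightarrow> 'n cliff.
     P = (\<lambda>x. \<Sum>\<alpha>\<in>{\<alpha>. sum \<alpha> UNIV = k}. (\<Prod>i\<in>UNIV. (x $ i) ^ (\<alpha> i)) *\<^sub>R c \<alpha>))"

definition spherical_monogenic :: "nat \<Rightarrow> (real ^ 'n::{finite,linorder} \<Rightarrow> 'n cliff) \<Rightarrow> bool" where
  "spherical_monogenic k P \<longleftrightarrow> hom_poly k P \<and>
     (\<exists>P'. (\<forall>x. (P has_derivative P' x) (at x))
        \<and> (\<forall>x. (\<Sum>j\<in>UNIV. cmul (cgen j) (P' x (axis j 1))) = 0))"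

text \<open>Norms on S^(n-1). The normalised surface measure (1/A_n) d omega on S^(n-1)
is the image of normalised Lebesgue measure on the unit ball under x |-> x/|x|.\<close>
definition L2_sphere :: "(real ^ 'n::{finite,linorder} \<Rightarrow> 'n cliff) \<Rightarrow> real" where
  "L2_sphere g = sqrt (integral (ball 0 1) (\<lambda>x. (norm (g (x /\<^sub>R norm x)))\<^sup>2)
                       / Henstock_Kurzweil_Integration.content (ball (0 :: real ^ 'n::{finite,linorder}) 1))"

definition sup_sphere :: "(real ^ 'n::{finite,linorder} \<Rightarrow> 'n cliff) \<Rightarrow> real" where
  "sup_sphere g = Sup ((\<lambda>w. norm (g w)) ` sphere 0 1)"

definition gegen :: "real \<Rightarrow> nat \<Rightarrow> real \<Rightarrow> real" where
  "gegen \<nu> j z = (\<Sum>i = 0..j div 2. (-1) ^ i * pochhammer \<nu> (j - i)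
                    / (fact i * fact (j - 2 * i)) * (2 * z) ^ (j - 2 * i))"

definition mu :: "nat \<Rightarrow> nat \<Rightarrow> nat \<Rightarrow> real" where
  "mu n k j = (let l = j div 2 in
     if even j then (-1) ^ l / gegen ((real n - 1) / 2 + real k) (2 * l) 0
     else (-1) ^ l * (real n + 2 * real k + 2 * real l) / (real n + 2 * real k - 1)
            / gegen ((real n + 1) / 2 + real k) (2 * l) 0)"

definition Xpoly :: "nat \<Rightarrow> nat \<Rightarrow> real \<times> (real ^ 'n::{finite,linorder}) \<Rightarrow> 'n cliff" where
  "Xpoly k j x = (if j = 0 then cone else
     (let n = CARD('n); r = norm x; x0 = fst x in
      (mu n k j * r ^ j) *\<^sub>R
        (gegen ((real n - 1) / 2 + real k) j (x0 / r) *\<^sub>R cone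
         + ((real n + 2 * real k - 1) / (real n + 2 * real k + real j - 1)
            * gegen ((real n + 1) / 2 + real k) (j - 1) (x0 / r) / r) *\<^sub>R cvec (snd x))))"

definition expansion :: "((real ^ 'n::{finite,linorder} \<Rightarrow> 'n cliff) \<Rightarrow> real) \<Rightarrow>
    (real \<times> (real ^ 'n::{finite,linorder}) \<Rightarrow> 'n cliff) \<Rightarrow>
    (nat \<Rightarrow> nat \<Rightarrow> real ^ 'n::{finite,linorder} \<Rightarrow> 'n cliff) \<Rightarrow> bool" where
  "expansion nrm f P \<longleftrightarrow>
     (\<forall>k j. spherical_monogenic k (P k j))
     \<and> Limsup (filtercomap (\<lambda>(j :: nat, k :: nat). j + k) at_top)
          (\<lambda>(j, k). ereal (root (j + k) (nrm (P k j)))) = 0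
     \<and> (\<forall>x. ((\<lambda>(j, k). cmul (Xpoly k j x) (P k j (snd x))) has_sum f x) UNIV)"

end

theory Submission
  imports Defs
begin

text \<open>
  Clifford analysis enters only through left multiplication by vectors. A \<open>C\<^sup>1\<close> null solution \<open>f\<close>
  of a Dirac operator is weakly harmonic, hence equal to its own averages against a radial bump
  function, by integration by parts; no Stokes formula is needed. Differentiating the
  averages moves derivatives onto the kernel. This yields smoothness, Cauchy estimates of the form
  \<open>|D\<^sup>m f(0)| \<le> m! (C/R)\<^sup>m sup |f|\<close> for every radius \<open>R\<close>, convergent Taylor expansions, and
  stability under locally uniform limits.

  For the existence of the expansion, let \<open>H(s, d)\<close> be the degree \<open>d\<close> Taylor part of
  \<open>(-\<partial>\<^sub>0)\<^sup>s f\<close> on \<open>x\<^sub>0 = 0\<close>. The Dirac operator sends \<open>H(s, d)\<close> to \<open>H(s + 1, d - 1)\<close>, so the relation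
  \<open>D (x\<^sup>i S) = \<plusminus> x\<^sup>i D S - c x\<^sup>i\<^sup>-\<^sup>1 S\<close> gives an explicit Fischer decomposition \<open>H(0, m) = \<Sum> x\<^sup>j P(m - j, j)\<close>
  in which every \<open>P(k, j)\<close> is a combination of the \<open>x\<^sup>i H(i + j, k - i)\<close>; the Cauchy estimates bound it by
  \<open>(C/R)\<^sup>j\<^sup>+\<^sup>k\<close>. The resulting series converges to a monogenic function which agrees with \<open>f\<close> on
  \<open>x\<^sub>0 = 0\<close>, and hence everywhere by the Cauchy-Kovalevskaya uniqueness principle. Uniqueness of the
  coefficients follows by applying \<open>D\<close> to each homogeneous component on \<open>x\<^sub>0 = 0\<close>.
\<close>


section \<open>A polynomial bump function and integration by parts\<close>

text \<open>The normalisation \<open>mu\<close> links the two sides: it makes the factor of index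
  (k, j) act on x_0 = 0 as left multiplication by x^j. Each term of the expansion is thus the
  Cauchy-Kovalevskaya extension of one Fischer summand x^j P(k, j), and both existence and
  uniqueness are decided on x_0 = 0. The shape of P(k, j) is forced. One has D^j H(0, j + k) = H(j,
  k). On x^j S with D S = 0 the operator D^j is a nonzero scalar, it kills lower powers of x, and it
  leaves a positive power of x in front of the higher ones. So P(k, j) is, up to that scalar, the
  null-solution part of H(j, k), and the terms x^i H(i + j, k - i) are the correction that extracts
  it. Solutions are entire, so the radius R in the Cauchy estimates is free, and the limsup
  condition absorbs every factor C^(j + k). Hence all bounds (Gegenbauer values, \<open>mu\<close>,
  Taylor parts, comparison of the two norms) are pursued only up to a geometric rate; factorials, in
  contrast, have to cancel exactly. The condition n >= 2 keeps the Gegenbauer indices at least 1/2,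
  which bounds the denominators of \<open>mu\<close> away from 0 well enough.\<close>

definition bump :: "nat \<Rightarrow> 'a::euclidean_space \<Rightarrow> real" where
  "bump m y = (max 0 (1 - y \<bullet> y)) ^ m"

lemma pos_part_power_DERIV:
  "((\<lambda>s::real. (max 0 s) ^ (m + 2)) has_field_derivative (real (m + 2) * (max 0 s) ^ (m + 1))) (at s)"
proof -
  consider "s > 0" | "s < 0" | "s = 0" by linarith
  then show ?thesis
  proof cases
    case 1
    have "((\<lambda>s::real. s ^ (m + 2)) has_field_derivative (real (m + 2) * (max 0 s) ^ (m + 1))) (at s)"
      using DERIV_pow[of "m + 2" s] 1 by (simp add: max_def)
    then show ?thesis
      by (rule has_field_derivative_transform_within_open[of _ _ _ "{0<..}"]) (use 1 in auto)
  next
    case 2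
    have "((\<lambda>s::real. 0) has_field_derivative (real (m + 2) * (max 0 s) ^ (m + 1))) (at s)"
      using 2 by (auto intro!: derivative_eq_intros)
    then show ?thesis
      by (rule has_field_derivative_transform_within_open[of _ _ _ "{..<0}"]) (use 2 in auto)
  next
    case 3
    have "((\<lambda>h::real. (max 0 h) ^ (m + 2) / h) \<longlongrightarrow> 0) (at 0)"
    proof (rule Lim_null_comparison)
      show "\<forall>\<^sub>F h in at 0. norm ((max 0 h) ^ (m + 2) / h) \<le> \<bar>h\<bar> ^ (m + 1)"
      proof (rule always_eventually, intro allI)
        fix h :: real
        show "norm ((max 0 h) ^ (m + 2) / h) \<le> \<bar>h\<bar> ^ (m + 1)"
        proof (cases "h > 0")
          case False
          then have "max 0 h = 0" by simp
          then have "norm ((max 0 h) ^ (m + 2) / h) = 0" by (simp only:) simp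
          also have "0 \<le> \<bar>h\<bar> ^ (m + 1)" by (rule zero_le_power) simp
          finally show ?thesis .
        qed auto
      qed
      have "((\<lambda>h::real. \<bar>h\<bar> ^ (m + 1)) \<longlongrightarrow> \<bar>0\<bar> ^ (m + 1)) (at 0)"
        by (intro tendsto_intros)
      then show "((\<lambda>h::real. \<bar>h\<bar> ^ (m + 1)) \<longlongrightarrow> 0) (at 0)" by simp
    qed
    then show ?thesis using 3 by (simp add: DERIV_def)
  qed
qed

lemma bump_has_derivative:
  "(bump (m + 2) has_derivative (\<lambda>v. - 2 * real (m + 2) * (y \<bullet> v) * bump (m + 1) y)) (at y)"
proof -
  have 1: "((\<lambda>y::'a. 1 - y \<bullet> y) has_derivative (\<lambda>v. - 2 * (y \<bullet> v))) (at y)"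
    by (auto intro!: derivative_eq_intros simp: inner_commute)
  have "((\<lambda>y::'a. (max 0 (1 - y \<bullet> y)) ^ (m + 2)) has_derivative
       (\<lambda>v. (real (m + 2) * (max 0 (1 - y \<bullet> y)) ^ (m + 1)) * (- 2 * (y \<bullet> v)))) (at y)"
    by (rule has_derivative_compose[OF 1 pos_part_power_DERIV[unfolded has_field_derivative_def]])
  moreover have "(\<lambda>v. (real (m + 2) * (max 0 (1 - y \<bullet> y)) ^ (m + 1)) * (- 2 * (y \<bullet> v)))
      = (\<lambda>v. - 2 * real (m + 2) * (y \<bullet> v) * bump (m + 1) y)"
    unfolding bump_def by (intro ext) (simp only: mult_ac)
  ultimately show ?thesis unfolding bump_def by simp
qed

lemma bump3_has_derivative:
  "(bump 3 has_derivative (\<lambda>v. - 6 * (y \<bullet> v) * bump 2 y)) (at y)"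
proof -
  have "1 + 2 = (3::nat)" "1 + 1 = (2::nat)" "- 2 * real 3 = - 6" by simp_all
  then show ?thesis using bump_has_derivative[of 1 y] by (simp only:)
qed

lemma continuous_on_bump [continuous_intros]:
  "continuous_on S f \<Longrightarrow> continuous_on S (\<lambda>x. bump m (f x))"
  unfolding bump_def by (intro continuous_intros)

lemma bump_nonneg [simp]: "0 \<le> bump m y"
  by (simp add: bump_def)

lemma bump_le_1: "bump m y \<le> 1"
  unfolding bump_def by (intro power_le_one) auto

lemma bump_eq_0: "norm y \<ge> 1 \<Longrightarrow> m > 0 \<Longrightarrow> bump m y = 0"
  using power_mono[of 1 "norm y" 2] by (simp add: bump_def power2_norm_eq_inner)

definition ubox :: "'a::euclidean_space set" where "ubox = cbox (- One) One"

lemma notin_cube_norm: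
  assumes "y \<notin> cbox (- (k *\<^sub>R One)) (k *\<^sub>R (One::'a::euclidean_space))"
  shows "norm y > k"
proof -
  obtain b :: 'a where "b \<in> Basis" "\<bar>y \<bullet> b\<bar> > k"
    using assms by (fastforce simp: mem_box inner_sum_left inner_Basis if_distrib sum.delta cong: if_cong)
  then show ?thesis using Basis_le_norm[of b y] by linarith
qed

lemma notin_ubox_norm: "y \<notin> ubox \<Longrightarrow> norm y > 1"
  using notin_cube_norm[of y 1] by (simp add: ubox_def)

lemma integral_eq_UNIV:
  fixes f :: "'a::euclidean_space \<Rightarrow> 'b::banach"
  assumes "\<And>x. x \<notin> S \<Longrightarrow> f x = 0"
  shows "integral S f = integral UNIV f"
proof -
  have "integral S f = integral UNIV (\<lambda>x. if x \<in> S then f x else 0)"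
    by (simp only: integral_restrict_UNIV)
  also have "\<dots> = integral UNIV f" by (rule integral_cong) (use assms in auto)
  finally show ?thesis .
qed

lemma integral_UNIV_translation:
  fixes \<psi> :: "'a::euclidean_space \<Rightarrow> 'b::euclidean_space"
  assumes int: "\<psi> integrable_on cbox a b" and z: "\<And>x. x \<notin> cbox a b \<Longrightarrow> \<psi> x = 0"
  shows "integral UNIV (\<lambda>x. \<psi> (x + c)) = integral UNIV \<psi>"
proof -
  have "(\<psi> has_integral integral (cbox a b) \<psi>) (cbox a b)" using int by blast
  from has_integral_affinity[OF this, of 1 c]
  have "((\<lambda>x. \<psi> (x + c)) has_integral integral (cbox a b) \<psi>) ((\<lambda>x. x - c) ` cbox a b)" by simp
  then have "((\<lambda>x. \<psi> (x + c)) has_integral integral (cbox a b) \<psi>) UNIV"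
    by (rule has_integral_on_superset) (use z in \<open>force simp: image_iff\<close>)+
  then show ?thesis using integral_eq_UNIV[of "cbox a b" \<psi>] z by (metis integral_unique)
qed

text \<open>Translation invariance: the integral of \<open>\<psi> (y + t v)\<close> over a large
  cube does not depend on t; differentiating under the integral sign at t = 0 gives the claim. This
  stands in for the divergence theorem.\<close>

lemma integral_derivative_eq_0:
  fixes \<psi> :: "'a::euclidean_space \<Rightarrow> 'b::euclidean_space"
  assumes d: "\<And>x. (\<psi> has_derivative \<psi>' x) (at x)"
    and c: "continuous_on UNIV (\<lambda>x. \<psi>' x v)"
    and z: "\<And>x. norm x \<ge> 1 \<Longrightarrow> \<psi> x = 0"
  shows "integral ubox (\<lambda>x. \<psi>' x v) = 0"
proof -
  have contpsi: "continuous_on UNIV \<psi>"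
    by (meson continuous_at_imp_continuous_on d has_derivative_continuous)
  have z': "\<psi>' x v = 0" if "norm x > 1" for x
  proof -
    have "((\<lambda>x. 0) has_derivative \<psi>' x) (at x)"
      by (rule has_derivative_transform_within_open[OF d, of "- cball 0 1"])
         (use that z in \<open>auto simp: less_imp_le\<close>)
    moreover have "((\<lambda>x. 0::'b) has_derivative (\<lambda>x. 0)) (at x)" by simp
    ultimately show ?thesis by (metis has_derivative_unique)
  qed
  \<comment> \<open>The support of \<open>\<psi>\<close>, shifted by t v with |t| <= 1, stays inside
    the cube of this size, so the domain of integration is fixed before differentiating in
    t.\<close>
  define k where "k = 1 + norm v"
  define C where "C = cbox (- (k *\<^sub>R One)) (k *\<^sub>R (One::'a))"
  define I where "I t = integral C (\<lambda>y. \<psi> (y + t *\<^sub>R v))" for t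
  have I: "I t = integral UNIV \<psi>" if "t \<in> {-1..1}" for t
  proof -
    have "norm (y + t *\<^sub>R v) \<ge> 1" if "y \<notin> C" for y
    proof -
      have "norm y > k" using that unfolding C_def by (rule notin_cube_norm)
      moreover have "norm (t *\<^sub>R v) \<le> 1 * norm v" 
        unfolding norm_scaleR using \<open>t \<in> {-1..1}\<close> by (intro mult_right_mono) auto
      ultimately show ?thesis using norm_triangle_ineq4[of "y + t *\<^sub>R v" "t *\<^sub>R v"] by (simp add: k_def)
    qed
    then have "I t = integral UNIV (\<lambda>y. \<psi> (y + t *\<^sub>R v))"
      unfolding I_def by (intro integral_eq_UNIV z)
    also have "\<dots> = integral UNIV \<psi>"
    proof (rule integral_UNIV_translation[of _ "- One" One])
      show "\<psi> integrable_on cbox (- One) One"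
        by (intro integrable_continuous continuous_on_subset[OF contpsi]) auto
      show "\<psi> x = 0" if "x \<notin> cbox (- One) One" for x
        using notin_ubox_norm[of x] that by (intro z) (simp add: ubox_def)
    qed
    finally show ?thesis .
  qed
  have "(I has_vector_derivative integral C (\<lambda>y. \<psi>' (y + 0 *\<^sub>R v) v)) (at 0 within {-1..1})"
    unfolding I_def C_def
  proof (rule leibniz_rule_vector_derivative)
    fix t :: real and y :: 'a
    have "((\<lambda>t. \<psi> (y + t *\<^sub>R v)) has_derivative (\<lambda>s. \<psi>' (y + t *\<^sub>R v) (s *\<^sub>R v))) (at t within {-1..1})"
      by (rule has_derivative_compose[OF _ d]) (auto intro!: derivative_eq_intros)
    then show "((\<lambda>t. \<psi> (y + t *\<^sub>R v)) has_vector_derivative \<psi>' (y + t *\<^sub>R v) v) (at t within {-1..1})"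
      unfolding has_vector_derivative_def
      using linear_scale[OF has_derivative_linear[OF d]] by simp
  next
    fix t :: real
    show "(\<lambda>y. \<psi> (y + t *\<^sub>R v)) integrable_on cbox (- (k *\<^sub>R One)) (k *\<^sub>R One)"
      by (intro integrable_continuous continuous_on_compose2[OF contpsi] continuous_intros) auto
  next
    show "continuous_on ({- 1..1} \<times> cbox (- (k *\<^sub>R One)) (k *\<^sub>R One)) (\<lambda>(x, y). \<psi>' (y + x *\<^sub>R v) v)"
      unfolding split_beta by (intro continuous_on_compose2[OF c] continuous_intros) auto
  qed auto
  moreover have "(I has_vector_derivative 0) (at 0 within {-1..1})"
    by (rule has_vector_derivative_transform[of _ _ _ "\<lambda>_. integral UNIV \<psi>"]) (use I in auto)
  ultimately have "integral C (\<lambda>y. \<psi>' y v) = 0"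
    using vector_derivative_unique_within[of 0 "{-1..1::real}" I "integral C (\<lambda>y. \<psi>' (y + 0 *\<^sub>R v) v)" 0]
    by (simp add: at_within_Icc_at)
  moreover have "integral C (\<lambda>y. \<psi>' y v) = integral UNIV (\<lambda>y. \<psi>' y v)"
    by (rule integral_eq_UNIV) (use notin_cube_norm[of _ k] z' in \<open>smt (verit) C_def k_def norm_ge_zero\<close>)
  moreover have "integral ubox (\<lambda>y. \<psi>' y v) = integral UNIV (\<lambda>y. \<psi>' y v)"
    by (rule integral_eq_UNIV) (use notin_ubox_norm z' in auto)
  ultimately show ?thesis by simp
qed

section \<open>Directional derivatives\<close>

text \<open>The direction comes first, so that iterated derivatives are simply
  \<open>(dirder v ^^ m) f\<close> and \<open>foldr dirder vs f\<close>.\<close>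

definition dirder :: "'a::euclidean_space \<Rightarrow> ('a \<Rightarrow> 'b::euclidean_space) \<Rightarrow> 'a \<Rightarrow> 'b" where
  "dirder v f x = frechet_derivative f (at x) v"

definition C1 :: "('a::euclidean_space \<Rightarrow> 'b::euclidean_space) \<Rightarrow> bool" where
  "C1 f \<longleftrightarrow> (\<forall>x. f differentiable (at x)) \<and> (\<forall>v. continuous_on UNIV (dirder v f))"

lemma dirder_eq: "(f has_derivative f') (at x) \<Longrightarrow> dirder v f x = f' v"
  unfolding dirder_def using frechet_derivative_at by metis

lemma C1I:
  assumes "\<And>x. (f has_derivative f' x) (at x)" "\<And>v. continuous_on UNIV (\<lambda>x. f' x v)"
  shows "C1 f"
proof -
  have "dirder v f = (\<lambda>x. f' x v)" for v using dirder_eq[OF assms(1)] by auto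
  then show ?thesis unfolding C1_def using assms by (auto simp: differentiable_def)
qed

lemma C1_has_derivative: "C1 f \<Longrightarrow> (f has_derivative (\<lambda>v. dirder v f x)) (at x)"
  unfolding C1_def dirder_def using frechet_derivative_works[of f "at x"] by simp

lemma C1_continuous: "C1 f \<Longrightarrow> continuous_on S g \<Longrightarrow> continuous_on S (\<lambda>x. f (g x))"
  by (rule continuous_on_compose2[of UNIV f])
     (auto intro!: has_derivative_continuous_on[where f' = "\<lambda>x v. dirder v f x"] C1_has_derivative)

lemma C1_dirder_continuous: "C1 f \<Longrightarrow> continuous_on S g \<Longrightarrow> continuous_on S (\<lambda>x. dirder v f (g x))"
  unfolding C1_def by (rule continuous_on_compose2[of UNIV "dirder v f"]) auto

lemma C1_linear: "C1 f \<Longrightarrow> linear (\<lambda>v. dirder v f x)"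
  using C1_has_derivative has_derivative_linear by blast

lemma dirder_basis:
  assumes "C1 f" shows "dirder v f x = (\<Sum>b\<in>Basis. (v \<bullet> b) *\<^sub>R dirder b f x)"
proof -
  have "dirder v f x = dirder (\<Sum>b\<in>Basis. (v \<bullet> b) *\<^sub>R b) f x" by (simp add: euclidean_representation)
  also have "\<dots> = (\<Sum>b\<in>Basis. (v \<bullet> b) *\<^sub>R dirder b f x)"
    by (simp only: linear_sum[OF C1_linear[OF assms, of x]] linear_scale[OF C1_linear[OF assms, of x]])
  finally show ?thesis .
qed

lemma C1_dirder_continuous2:
  assumes "C1 f" "continuous_on S g" "continuous_on S h"
  shows "continuous_on S (\<lambda>x. dirder (h x) f (g x))"
  unfolding dirder_basis[OF assms(1), of "h _"]
  by (intro continuous_intros C1_dirder_continuous assms)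

lemma dirder_affine:
  assumes "C1 f" shows "C1 (\<lambda>y. f (x + r *\<^sub>R y))" "dirder v (\<lambda>y. f (x + r *\<^sub>R y)) y = r *\<^sub>R dirder v f (x + r *\<^sub>R y)"
proof -
  have *: "((\<lambda>y. f (x + r *\<^sub>R y)) has_derivative (\<lambda>v. dirder (r *\<^sub>R v) f (x + r *\<^sub>R y))) (at y)" for y
    by (rule has_derivative_compose[OF _ C1_has_derivative[OF assms]]) (auto intro!: derivative_eq_intros)
  then show "dirder v (\<lambda>y. f (x + r *\<^sub>R y)) y = r *\<^sub>R dirder v f (x + r *\<^sub>R y)"
    using dirder_eq[OF *] by (simp add: linear_scale[OF C1_linear[OF assms]])
  show "C1 (\<lambda>y. f (x + r *\<^sub>R y))"
    by (rule C1I[OF *]) (intro C1_dirder_continuous assms continuous_intros)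
qed

lemma ubox_integrable: 
  fixes f :: "'a::euclidean_space \<Rightarrow> 'b::euclidean_space"
  shows "continuous_on ubox f \<Longrightarrow> f integrable_on ubox"
  unfolding ubox_def by (rule integrable_continuous)

lemma ubox_bound:
  fixes f :: "'a::euclidean_space \<Rightarrow> 'b::euclidean_space"
  assumes "continuous_on ubox f" "0 \<le> B" "\<And>x. x \<in> ubox \<Longrightarrow> norm (f x) \<le> B"
  shows "norm (integral ubox f) \<le> B * Henstock_Kurzweil_Integration.content (ubox :: 'a set)"
  using has_integral_bound[OF assms(2), of f "integral ubox f" "- One" One] assms ubox_integrable[OF assms(1)]
  by (simp add: ubox_def has_integral_integral)

definition bump_mass :: "'a::euclidean_space itself \<Rightarrow> real" where
  "bump_mass _ = integral (ubox :: 'a set) (bump 3)"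

lemma bump_mass_pos: "bump_mass TYPE('a::euclidean_space) > 0"
proof -
  have c: "continuous_on (cbox (- One) (One::'a)) (bump 3)"
    using continuous_on_bump[OF continuous_on_id] by simp
  have "integral (cbox (- One) (One::'a)) (bump 3) \<ge> 0"
    by (rule integral_nonneg) (auto intro!: integrable_continuous c)
  moreover have "integral (cbox (- One) (One::'a)) (bump 3) \<noteq> 0"
  proof
    assume "integral (cbox (- One) (One::'a)) (bump 3) = 0"
    moreover have "box (- One) (One::'a) \<noteq> {}" by (simp add: box_ne_empty)
    ultimately have "bump 3 (0::'a) = 0"
      using integral_cbox_eq_0_iff[OF c] by (auto simp: mem_box)
    then show False by (simp add: bump_def)
  qed
  ultimately show ?thesis by (simp add: bump_mass_def ubox_def)
qed

lemma integral_by_parts: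
  fixes g :: "'a::euclidean_space \<Rightarrow> 'b::euclidean_space"
  assumes g: "C1 g" and w: "\<And>y. (w has_derivative w' y) (at y)" "continuous_on UNIV (\<lambda>y. w' y v)"
    and z: "\<And>y. norm y \<ge> 1 \<Longrightarrow> w y = 0"
  shows "integral ubox (\<lambda>y. w y *\<^sub>R dirder v g y) = - integral ubox (\<lambda>y. w' y v *\<^sub>R g y)"
proof -
  have cw: "continuous_on UNIV w" using w(1) by (auto intro!: has_derivative_continuous_on)
  have "((\<lambda>y. w y *\<^sub>R g y) has_derivative (\<lambda>u. w y *\<^sub>R dirder u g y + w' y u *\<^sub>R g y)) (at y)" for y
    by (rule has_derivative_scaleR[OF w(1) C1_has_derivative[OF g]])
  then have "integral ubox (\<lambda>y. w y *\<^sub>R dirder v g y + w' y v *\<^sub>R g y) = 0"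
    by (rule integral_derivative_eq_0)
       (use z in \<open>auto intro!: continuous_intros cw w C1_continuous[OF g] C1_dirder_continuous[OF g]\<close>)
  moreover have "integral ubox (\<lambda>y. w y *\<^sub>R dirder v g y + w' y v *\<^sub>R g y) =
      integral ubox (\<lambda>y. w y *\<^sub>R dirder v g y) + integral ubox (\<lambda>y. w' y v *\<^sub>R g y)"
    by (rule integral_add; rule ubox_integrable; rule continuous_on_subset[of UNIV])
       (auto intro!: continuous_intros cw w C1_continuous[OF g] C1_dirder_continuous[OF g])
  ultimately show ?thesis by (simp add: eq_neg_iff_add_eq_0)
qed

lemma convolution_has_derivative:
  fixes f :: "'a::euclidean_space \<Rightarrow> 'b::euclidean_space"
  assumes f: "C1 f" and w: "continuous_on UNIV w"
  shows "((\<lambda>x. integral ubox (\<lambda>y. w y *\<^sub>R f (x + r *\<^sub>R y))) has_derivative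
     (\<lambda>v. integral ubox (\<lambda>y. w y *\<^sub>R dirder v f (x + r *\<^sub>R y)))) (at x)"
proof -
  \<comment> \<open>The Leibniz rule asks for the derivative as a bounded linear map depending
    continuously on both variables; continuity is then checked componentwise.\<close>
  define F where "F x y = Blinfun (\<lambda>v. w y *\<^sub>R dirder v f (x + r *\<^sub>R y))" for x y
  have bl: "bounded_linear (\<lambda>v. w y *\<^sub>R dirder v f x)" for x y
    using C1_linear[OF f, of x] by (intro bounded_linear_const_scaleR) (simp add: linear_conv_bounded_linear)
  have F: "blinfun_apply (F x y) v = w y *\<^sub>R dirder v f (x + r *\<^sub>R y)" for x y v
    unfolding F_def using bl by (simp add: bounded_linear_Blinfun_apply)
  have cF: "continuous_on S (\<lambda>z. F (p z) (q z))" if "continuous_on S p" "continuous_on S q" 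
    for S and p q :: "'c::t2_space \<Rightarrow> 'a"
    by (rule continuous_on_blinfun_componentwise)
       (auto simp: F intro!: continuous_intros that C1_dirder_continuous[OF f] continuous_on_compose2[OF w])
  have "((\<lambda>x. integral ubox (\<lambda>y. w y *\<^sub>R f (x + r *\<^sub>R y))) has_derivative
     blinfun_apply (integral ubox (F x))) (at x within UNIV)"
    unfolding ubox_def
  proof (rule leibniz_rule)
    fix x y :: 'a
    have "((\<lambda>x. f (x + r *\<^sub>R y)) has_derivative (\<lambda>v. dirder v f (x + r *\<^sub>R y))) (at x)"
      by (rule has_derivative_compose[OF _ C1_has_derivative[OF f]]) (auto intro!: derivative_eq_intros)
    then show "((\<lambda>x. w y *\<^sub>R f (x + r *\<^sub>R y)) has_derivative blinfun_apply (F x y)) (at x)"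
      unfolding F by (rule has_derivative_scaleR_right)
  next
    show "continuous_on (UNIV \<times> cbox (- One) One) (\<lambda>(x, y). F x y)"
      unfolding split_beta by (intro cF continuous_intros)
  qed (auto intro!: integrable_continuous continuous_intros C1_continuous[OF f] continuous_on_compose2[OF w])
  moreover have "blinfun_apply (integral ubox (F x)) = (\<lambda>v. integral ubox (\<lambda>y. w y *\<^sub>R dirder v f (x + r *\<^sub>R y)))"
    unfolding F[symmetric]
    by (intro ext blinfun_apply_integral, unfold ubox_def) (intro integrable_continuous cF continuous_intros)
  ultimately show ?thesis by simp
qed

lemma convolution_continuous:
  fixes g :: "'a::euclidean_space \<Rightarrow> 'b::euclidean_space"
  assumes "continuous_on UNIV g" "continuous_on UNIV w"
  shows "continuous_on UNIV (\<lambda>x. integral ubox (\<lambda>y. w y *\<^sub>R g (x + r *\<^sub>R y)))"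
  unfolding ubox_def
  by (rule integral_continuous_on_param)
     (auto simp: split_beta intro!: continuous_intros continuous_on_compose2[OF assms(1)] continuous_on_compose2[OF assms(2)])

lemma C1_convolution:
  fixes f :: "'a::euclidean_space \<Rightarrow> 'b::euclidean_space"
  assumes f: "C1 f" and w: "continuous_on UNIV w"
  shows "C1 (\<lambda>x. integral ubox (\<lambda>y. w y *\<^sub>R f (x + r *\<^sub>R y)))"
  by (rule C1I[OF convolution_has_derivative[OF f w]])
     (intro convolution_continuous w C1_dirder_continuous[OF f] continuous_on_id)

lemma C1_const: "C1 (\<lambda>x. a)"
  by (rule C1I[of _ "\<lambda>x v. 0"]) auto

lemma dirder_const: "dirder v (\<lambda>x. a) x = 0"
  by (rule dirder_eq) auto

lemma C1_add:
  assumes f: "C1 f" and g: "C1 g" shows "C1 (\<lambda>x. f x + g x)"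
  by (rule C1I[OF has_derivative_add[OF C1_has_derivative[OF f] C1_has_derivative[OF g]]])
     (intro continuous_on_add C1_dirder_continuous f g continuous_on_id)

lemma dirder_add: "C1 f \<Longrightarrow> C1 g \<Longrightarrow> dirder v (\<lambda>x. f x + g x) x = dirder v f x + dirder v g x"
  by (rule dirder_eq[OF has_derivative_add[OF C1_has_derivative C1_has_derivative]])

lemma C1_sum: "(\<And>i. i \<in> I \<Longrightarrow> C1 (f i)) \<Longrightarrow> C1 (\<lambda>x. \<Sum>i\<in>I. f i x)"
  by (induction I rule: infinite_finite_induct) (auto intro: C1_const C1_add)

lemma dirder_sum: "(\<And>i. i \<in> I \<Longrightarrow> C1 (f i)) \<Longrightarrow> dirder v (\<lambda>x. \<Sum>i\<in>I. f i x) x = (\<Sum>i\<in>I. dirder v (f i) x)"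
  by (induction I rule: infinite_finite_induct) (auto simp: dirder_const dirder_add C1_sum)

lemma C1_bounded_linear:
  assumes A: "bounded_linear A" and f: "C1 f" shows "C1 (\<lambda>x. A (f x))"
  by (rule C1I[OF bounded_linear.has_derivative[OF A C1_has_derivative[OF f]]])
     (intro linear_continuous_on_compose[OF _ bounded_linear.linear[OF A]] C1_dirder_continuous f continuous_on_id)

lemma dirder_bounded_linear:
  assumes A: "bounded_linear A" and f: "C1 f" shows "dirder v (\<lambda>x. A (f x)) x = A (dirder v f x)"
  by (rule dirder_eq[OF bounded_linear.has_derivative[OF A C1_has_derivative[OF f]]])

lemma C1_scaleR_right: "C1 f \<Longrightarrow> C1 (\<lambda>x. r *\<^sub>R f x)"
  by (rule C1_bounded_linear[OF bounded_linear_scaleR_right])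

lemma dirder_scaleR_right: "C1 f \<Longrightarrow> dirder v (\<lambda>x. r *\<^sub>R f x) x = r *\<^sub>R dirder v f x"
  by (rule dirder_bounded_linear[OF bounded_linear_scaleR_right])

lemma
  assumes B: "bounded_bilinear B" and f: "C1 f" and g: "C1 g"
  shows C1_bilinear: "C1 (\<lambda>x. B (f x) (g x))"
    and dirder_bilinear: "dirder v (\<lambda>x. B (f x) (g x)) x = B (f x) (dirder v g x) + B (dirder v f x) (g x)"
proof -
  note d = bounded_bilinear.FDERIV[OF B C1_has_derivative[OF f] C1_has_derivative[OF g]]
  show "C1 (\<lambda>x. B (f x) (g x))"
    by (rule C1I[OF d])
       (intro continuous_on_add bounded_bilinear.continuous_on[OF B] C1_dirder_continuous[OF f] C1_dirder_continuous[OF g]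
         C1_continuous[OF f] C1_continuous[OF g] continuous_on_id)
  show "dirder v (\<lambda>x. B (f x) (g x)) x = B (f x) (dirder v g x) + B (dirder v f x) (g x)"
    by (rule dirder_eq[OF d])
qed

lemma
  assumes A: "bounded_linear (A :: 'a::euclidean_space \<Rightarrow> 'b::euclidean_space)"
  shows C1_linear_map: "C1 A" and dirder_linear_map: "dirder v A x = A v"
proof -
  note d = bounded_linear.has_derivative[OF A has_derivative_ident]
  show "C1 A" by (rule C1I[OF d]) auto
  show "dirder v A x = A v" by (rule dirder_eq[OF d])
qed

lemma C1_ident: "C1 (\<lambda>x. x)" and dirder_ident: "dirder v (\<lambda>x. x) x = v"
  using C1_linear_map[OF bounded_linear_ident] dirder_linear_map[OF bounded_linear_ident] by auto

text \<open>One term of the exponential series at m is at most the whole sum. It turns the m^m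
  produced by m nested Cauchy estimates into a factorial.\<close>

lemma power_self_le_fact: "real m ^ m \<le> exp 1 ^ m * fact m"
proof -
  have "(\<lambda>n. inverse (fact n) *\<^sub>R real m ^ n) sums exp (real m)" by (rule exp_converges)
  then have "(\<Sum>n\<in>{m}. inverse (fact n) *\<^sub>R real m ^ n) \<le> exp (real m)"
    using sum_le_suminf[of "\<lambda>n. inverse (fact n) *\<^sub>R real m ^ n" "{m}"] 
    by (simp add: sums_iff)
  then have "real m ^ m \<le> exp (real m) * fact m" by (simp add: field_simps)
  then show ?thesis by (simp flip: exp_of_nat_mult)
qed

lemma foldr_replicate: "foldr g (replicate m v) f = (g v ^^ m) f"
  by (induction m) auto

section \<open>Mean value property and Cauchy estimates for Dirac-type systems\<close>

text \<open>\<open>E\<close> is the symbol of a first-order system with constant coefficients,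
  \<open>Eb\<close> that of a conjugate system, and \<open>EbE\<close> says that together they
  factorise the Laplacian. Two instances occur: the Cauchy-Riemann operator on R x V for the
  functions to be expanded, and the Dirac operator on V for the spherical monogenics.\<close>

locale dirac =
  fixes E Eb :: "'a::euclidean_space \<Rightarrow> 'b::euclidean_space \<Rightarrow> 'b"
  assumes E: "bounded_bilinear E" and Eb: "bounded_bilinear Eb"
    and EbE: "Eb x (E x a) = (x \<bullet> x) *\<^sub>R a"
begin

lemma EbE_polar: "Eb x (E y a) + Eb y (E x a) = (2 * (x \<bullet> y)) *\<^sub>R a"
proof -
  interpret E: bounded_bilinear E by (rule E)
  interpret Eb: bounded_bilinear Eb by (rule Eb)
  have "Eb (x + y) (E (x + y) a) = ((x + y) \<bullet> (x + y)) *\<^sub>R a" by (rule EbE)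
  then show ?thesis 
    by (simp add: E.add_left Eb.add_left Eb.add_right EbE inner_add inner_commute[of y x] algebra_simps)
qed

definition nullsol :: "('a \<Rightarrow> 'b) \<Rightarrow> bool" where
  "nullsol f \<longleftrightarrow> C1 f \<and> (\<forall>x. (\<Sum>b\<in>Basis. E b (dirder b f x)) = 0)"

lemma nullsol_C1: "nullsol f \<Longrightarrow> C1 f" by (simp add: nullsol_def)

lemma nullsol_affine: "nullsol f \<Longrightarrow> nullsol (\<lambda>y. f (x + r *\<^sub>R y))"
  unfolding nullsol_def
  by (simp add: dirder_affine bounded_bilinear.scaleR_right[OF E] scaleR_sum_right[symmetric])

text \<open>The moments \<open>T a b\<close> below form a symmetric matrix. Applying
  \<open>Eb\<close> to the equation and symmetrising, polarisation leaves only the trace of this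
  matrix, and the trace is the radial derivative of \<open>g\<close> tested against
  \<open>bump 3\<close>. Second derivatives of \<open>g\<close> never occur.\<close>

lemma weakly_harmonic:
  assumes g: "nullsol g"
  shows "integral ubox (\<lambda>y. bump 3 y *\<^sub>R dirder y g y) = 0"
proof -
  interpret E: bounded_bilinear E by (rule E)
  interpret Eb: bounded_bilinear Eb by (rule Eb)
  note g1 = nullsol_C1[OF g]
  note ci = continuous_intros C1_continuous[OF g1] C1_dirder_continuous[OF g1]
  define T where "T a b = integral ubox (\<lambda>y. ((y \<bullet> a) * bump 3 y) *\<^sub>R dirder b g y)" for a b
  have int: "(\<lambda>y. ((y \<bullet> a) * bump 3 y) *\<^sub>R dirder b g y) integrable_on ubox" for a b
    by (intro ubox_integrable ci)
  \<comment> \<open>The weight \<open>(y \<bullet> a) * bump 3 y\<close> is -1/8 times the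
    derivative of \<open>bump 4\<close> along a, so after integration by parts the weight is a
    Hessian entry, symmetric in a and b.\<close>
  have T: "T a b = - integral ubox (\<lambda>y. ((a \<bullet> b) * bump 3 y - 6 * (y \<bullet> a) * (y \<bullet> b) * bump 2 y) *\<^sub>R g y)" for a b
  proof -
    have "((\<lambda>y. (y \<bullet> a) * bump 3 y) has_derivative
        (\<lambda>v. (y \<bullet> a) * (- 6 * (y \<bullet> v) * bump 2 y) + (v \<bullet> a) * bump 3 y)) (at y)" for y
      by (rule has_derivative_mult[OF _ bump3_has_derivative]) (auto intro!: derivative_eq_intros)
    then have "T a b = - integral ubox (\<lambda>y. ((y \<bullet> a) * (- 6 * (y \<bullet> b) * bump 2 y) + (b \<bullet> a) * bump 3 y) *\<^sub>R g y)"
      unfolding T_def by (rule integral_by_parts[OF g1]) (auto simp: bump_eq_0 intro!: continuous_intros)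
    then show ?thesis by (simp add: inner_commute[of b a] algebra_simps)
  qed
  have sym: "T a b = T b a" for a b unfolding T by (simp add: inner_commute mult_ac)
  have pull: "F (integral ubox (\<lambda>y. ((y \<bullet> a) * bump 3 y) *\<^sub>R dirder b g y)) = 
      integral ubox (\<lambda>y. ((y \<bullet> a) * bump 3 y) *\<^sub>R F (dirder b g y))" if "bounded_linear F" for F :: "'b \<Rightarrow> 'b" and a b
    using integral_linear[OF int that] linear_scale[OF bounded_linear.linear[OF that]] by (simp add: o_def)
  have "(\<Sum>b\<in>Basis. E b (T a b)) = 0" for a
  proof -
    have "(\<Sum>b\<in>Basis. E b (T a b)) = (\<Sum>b\<in>Basis. integral ubox (\<lambda>y. ((y \<bullet> a) * bump 3 y) *\<^sub>R E b (dirder b g y)))"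
      unfolding T_def by (simp add: pull[OF E.bounded_linear_right])
    also have "\<dots> = integral ubox (\<lambda>y. \<Sum>b\<in>Basis. ((y \<bullet> a) * bump 3 y) *\<^sub>R E b (dirder b g y))"
      by (rule integral_sum[symmetric])
         (auto intro!: ubox_integrable ci E.continuous_on)
    also have "\<dots> = 0" using g by (simp add: nullsol_def scaleR_sum_right[symmetric])
    finally show ?thesis .
  qed
  then have z: "(\<Sum>a\<in>Basis. \<Sum>b\<in>Basis. Eb a (E b (T a b))) = 0"
    by (simp add: Eb.sum_right[symmetric] Eb.zero_right)
  then have "(\<Sum>a\<in>Basis. \<Sum>b\<in>Basis. Eb b (E a (T b a))) = 0" by (subst sum.swap) 
  with z have "(\<Sum>a\<in>Basis. \<Sum>b\<in>Basis. Eb a (E b (T a b)) + Eb b (E a (T a b))) = 0"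
    by (simp add: sum.distrib sym)
  then have "(\<Sum>a\<in>Basis. \<Sum>b\<in>Basis. (2 * (a \<bullet> b)) *\<^sub>R T a b) = 0" by (simp add: EbE_polar)
  moreover have "(\<Sum>b\<in>Basis. (2 * (a \<bullet> b)) *\<^sub>R T a b) = 2 *\<^sub>R T a a" if "a \<in> Basis" for a
    using that by (simp add: inner_Basis if_distrib if_distribR cong: if_cong)
  ultimately have "(\<Sum>a\<in>Basis. T a a) = 0" by (simp add: scaleR_sum_right[symmetric])
  moreover have "(\<Sum>a\<in>Basis. T a a) = integral ubox (\<lambda>y. \<Sum>a\<in>Basis. ((y \<bullet> a) * bump 3 y) *\<^sub>R dirder a g y)"
    unfolding T_def by (rule integral_sum[symmetric]) (auto intro: int)
  moreover have "(\<Sum>a\<in>Basis. ((y \<bullet> a) * bump 3 y) *\<^sub>R dirder a g y) = bump 3 y *\<^sub>R dirder y g y" for y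
    by (simp add: dirder_basis[OF g1, of y] scaleR_sum_right mult.commute)
  ultimately show ?thesis by simp
qed

text \<open>The average over the ball of radius r is constant in r, since its r-derivative is the
  radial derivative handled by \<open>weakly_harmonic\<close>; at r = 0 it is the value at the
  centre.\<close>

lemma mean_value:
  assumes f: "nullsol f"
  shows "integral ubox (\<lambda>y. bump 3 y *\<^sub>R f (x + r *\<^sub>R y)) = bump_mass TYPE('a) *\<^sub>R f x"
proof -
  note f1 = nullsol_C1[OF f]
  note ci = continuous_intros C1_continuous[OF f1] C1_dirder_continuous2[OF f1]
  define M where "M r = integral ubox (\<lambda>y. bump 3 y *\<^sub>R f (x + r *\<^sub>R y))" for r
  have M': "(M has_vector_derivative integral ubox (\<lambda>y. bump 3 y *\<^sub>R dirder y f (x + r *\<^sub>R y))) (at r within UNIV)" for r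
    unfolding M_def ubox_def
  proof (rule leibniz_rule_vector_derivative)
    fix r :: real and y :: 'a
    have "((\<lambda>r. f (x + r *\<^sub>R y)) has_derivative (\<lambda>s. dirder (s *\<^sub>R y) f (x + r *\<^sub>R y))) (at r)"
      by (rule has_derivative_compose[OF _ C1_has_derivative[OF f1]]) (auto intro!: derivative_eq_intros)
    then have "((\<lambda>r. f (x + r *\<^sub>R y)) has_vector_derivative dirder y f (x + r *\<^sub>R y)) (at r)"
      by (simp add: has_vector_derivative_def linear_scale[OF C1_linear[OF f1]])
    then show "((\<lambda>r. bump 3 y *\<^sub>R f (x + r *\<^sub>R y)) has_vector_derivative bump 3 y *\<^sub>R dirder y f (x + r *\<^sub>R y)) (at r)"
      by (auto intro!: derivative_eq_intros)
  qed (auto simp: split_beta intro!: integrable_continuous ci)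
  \<comment> \<open>Rescaling brings a factor r that has to be cancelled, so nothing is obtained at
    r = 0; this is why constancy is derived with the exceptional set {0}.\<close>
  have 0: "integral ubox (\<lambda>y. bump 3 y *\<^sub>R dirder y f (x + r *\<^sub>R y)) = 0" if "r \<noteq> 0" for r
  proof -
    have "r *\<^sub>R integral ubox (\<lambda>y. bump 3 y *\<^sub>R dirder y f (x + r *\<^sub>R y)) = 0"
      using weakly_harmonic[OF nullsol_affine[OF f, of x r]]
      by (simp add: dirder_affine[OF f1] mult.commute flip: integral_cmul)
    then show ?thesis using that by simp
  qed
  define a where "a = - \<bar>r\<bar> - 1"
  define b where "b = \<bar>r\<bar> + 1"
  have const: "M s = M a" if "s \<in> {a..b}" for s
  proof (rule has_derivative_zero_unique_strong_interval[of "{0}" a b M _ s])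
    show "continuous_on {a..b} M"
      using M' by (meson continuous_at_imp_continuous_on has_vector_derivative_continuous)
    show "(M has_derivative (\<lambda>h. 0)) (at u within {a..b})" if "u \<in> {a..b} - {0}" for u
      using M'[of u] 0[of u] that by (auto simp: has_vector_derivative_def intro: has_derivative_at_withinI)
  qed (use that in auto)
  have "r \<in> {a..b}" "0 \<in> {a..b}" by (auto simp: a_def b_def)
  then have "M r = M 0" using const[of r] const[of 0] by simp
  also have "M 0 = integral ubox (bump 3 :: 'a \<Rightarrow> real) *\<^sub>R f x"
    unfolding M_def using integral_linear[of "bump 3 :: 'a \<Rightarrow> real" ubox "\<lambda>c. c *\<^sub>R f x"]
    by (auto simp: o_def bounded_linear_scaleR_left ubox_integrable continuous_on_bump[OF continuous_on_id])
  finally show ?thesis by (simp add: M_def bump_mass_def)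
qed

text \<open>Differentiating the mean value identity in x puts the derivative on \<open>f\<close>,
  and integration by parts in y moves it to the bump. The factor r comes from the chain rule for y
  |-> x + r y and becomes the 1/r of the Cauchy estimate.\<close>

lemma gradient_formula:
  assumes f: "nullsol f"
  shows "(bump_mass TYPE('a) * r) *\<^sub>R dirder v f x = 
     integral ubox (\<lambda>y. (6 * (y \<bullet> v) * bump 2 y) *\<^sub>R f (x + r *\<^sub>R y))"
proof -
  note f1 = nullsol_C1[OF f]
  have d1: "((\<lambda>x. bump_mass TYPE('a) *\<^sub>R f x) has_derivative (\<lambda>v. integral ubox (\<lambda>y. bump 3 y *\<^sub>R dirder v f (x + r *\<^sub>R y)))) (at x)"
    using convolution_has_derivative[OF f1 continuous_on_bump[OF continuous_on_id], of 3 r x]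
    by (simp add: mean_value[OF f])
  have d2: "((\<lambda>x. bump_mass TYPE('a) *\<^sub>R f x) has_derivative (\<lambda>v. bump_mass TYPE('a) *\<^sub>R dirder v f x)) (at x)"
    by (rule has_derivative_scaleR_right[OF C1_has_derivative[OF f1]])
  have "bump_mass TYPE('a) *\<^sub>R dirder v f x = integral ubox (\<lambda>y. bump 3 y *\<^sub>R dirder v f (x + r *\<^sub>R y))"
    by (rule fun_cong[OF has_derivative_unique[OF d2 d1]])
  then have "(bump_mass TYPE('a) * r) *\<^sub>R dirder v f x = r *\<^sub>R integral ubox (\<lambda>y. bump 3 y *\<^sub>R dirder v f (x + r *\<^sub>R y))"
    by (metis mult.commute scaleR_scaleR)
  also have "\<dots> = integral ubox (\<lambda>y. bump 3 y *\<^sub>R dirder v (\<lambda>y. f (x + r *\<^sub>R y)) y)"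
    by (simp add: dirder_affine[OF f1] mult.commute flip: integral_cmul)
  also have "\<dots> = - integral ubox (\<lambda>y. (- 6 * (y \<bullet> v) * bump 2 y) *\<^sub>R f (x + r *\<^sub>R y))"
    by (rule integral_by_parts[OF dirder_affine(1)[OF f1] bump3_has_derivative])
       (auto simp: bump_eq_0 intro!: continuous_intros)
  also have "\<dots> = integral ubox (\<lambda>y. (6 * (y \<bullet> v) * bump 2 y) *\<^sub>R f (x + r *\<^sub>R y))"
    by (simp flip: integral_neg)
  finally show ?thesis .
qed

text \<open>Minus the derivative of \<open>bump 3\<close> along v, divided by the mass of the bump:
  the kernel that represents differentiation of null solutions.\<close>

definition gkernel :: "'a \<Rightarrow> 'a \<Rightarrow> real" where
  "gkernel v y = 6 / bump_mass TYPE('a) * (y \<bullet> v) * bump 2 y"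

lemma continuous_on_gkernel [continuous_intros]: "continuous_on S f \<Longrightarrow> continuous_on S (\<lambda>x. gkernel v (f x))"
  unfolding gkernel_def by (intro continuous_intros)

lemma dirder_convolution:
  assumes "nullsol f"
  shows "r *\<^sub>R dirder v f x = integral ubox (\<lambda>y. gkernel v y *\<^sub>R f (x + r *\<^sub>R y))"
proof -
  have "r *\<^sub>R dirder v f x = (1 / bump_mass TYPE('a)) *\<^sub>R ((bump_mass TYPE('a) * r) *\<^sub>R dirder v f x)"
    using bump_mass_pos[where 'a = 'a] by simp
  then show ?thesis unfolding gradient_formula[OF assms] by (simp add: gkernel_def flip: integral_cmul)
qed

lemma nullsol_dirder_eq: 
  assumes "nullsol f" shows "dirder v f = (\<lambda>x. integral ubox (\<lambda>y. gkernel v y *\<^sub>R f (x + 1 *\<^sub>R y)))"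
  using dirder_convolution[OF assms, of 1] by auto

lemma dirder_dirder:
  assumes "nullsol f"
  shows "dirder u (dirder v f) x = integral ubox (\<lambda>y. gkernel v y *\<^sub>R dirder u f (x + 1 *\<^sub>R y))"
  unfolding nullsol_dirder_eq[OF assms, of v]
  by (rule dirder_eq[OF convolution_has_derivative[OF nullsol_C1[OF assms]]]) (intro continuous_intros)

lemma nullsol_dirder:
  assumes f: "nullsol f" shows "nullsol (dirder v f)"
  unfolding nullsol_def
proof (intro conjI allI)
  interpret E: bounded_bilinear E by (rule E)
  note f1 = nullsol_C1[OF f]
  note ci = continuous_intros C1_continuous[OF f1] C1_dirder_continuous[OF f1]
  show "C1 (dirder v f)" unfolding nullsol_dirder_eq[OF f]
    by (intro C1_convolution nullsol_C1[OF f] continuous_intros)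
  fix x
  have "(\<Sum>b\<in>Basis. E b (dirder b (dirder v f) x)) =
     (\<Sum>b\<in>Basis. integral ubox (\<lambda>y. gkernel v y *\<^sub>R E b (dirder b f (x + 1 *\<^sub>R y))))"
  proof (rule sum.cong[OF refl])
    fix b :: 'a
    have "(\<lambda>y. gkernel v y *\<^sub>R dirder b f (x + 1 *\<^sub>R y)) integrable_on ubox" by (intro ubox_integrable ci)
    from integral_linear[OF this E.bounded_linear_right[of b]]
    show "E b (dirder b (dirder v f) x) = integral ubox (\<lambda>y. gkernel v y *\<^sub>R E b (dirder b f (x + 1 *\<^sub>R y)))"
      unfolding dirder_dirder[OF f] by (simp add: o_def E.scaleR_right)
  qed
  also have "\<dots> = integral ubox (\<lambda>y. \<Sum>b\<in>Basis. gkernel v y *\<^sub>R E b (dirder b f (x + 1 *\<^sub>R y)))"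
    by (rule integral_sum[symmetric]) (auto intro!: ubox_integrable ci E.continuous_on)
  also have "\<dots> = 0" using f by (simp add: nullsol_def scaleR_sum_right[symmetric])
  finally show "(\<Sum>b\<in>Basis. E b (dirder b (dirder v f) x)) = 0" .
qed

text \<open>Both sides are the convolution of \<open>dirder u f\<close> with the same kernel.\<close>
lemma dirder_commute:
  assumes f: "nullsol f" shows "dirder u (dirder v f) = dirder v (dirder u f)"
  using dirder_dirder[OF f] nullsol_dirder_eq[OF nullsol_dirder[OF f]] by auto

definition cauchy_const :: real where
  "cauchy_const = 6 / bump_mass TYPE('a) * Henstock_Kurzweil_Integration.content (ubox :: 'a set)"

lemma cauchy_const_nonneg: "0 \<le> cauchy_const"
  using bump_mass_pos[where 'a = 'a] by (simp add: cauchy_const_def)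

lemma norm_gkernel_convolution_le:
  fixes g :: "'a \<Rightarrow> 'b"
  assumes g: "continuous_on UNIV g" and r: "0 \<le> r" and M: "\<And>y. y \<in> cball x r \<Longrightarrow> norm (g y) \<le> M" and "0 \<le> M"
  shows "norm (integral ubox (\<lambda>y. gkernel v y *\<^sub>R g (x + r *\<^sub>R y))) \<le> cauchy_const * norm v * M"
proof -
  note bm = bump_mass_pos[where 'a = 'a]
  have "norm (integral ubox (\<lambda>y. gkernel v y *\<^sub>R g (x + r *\<^sub>R y))) \<le>
     (6 / bump_mass TYPE('a) * norm v * M) * Henstock_Kurzweil_Integration.content (ubox :: 'a set)"
  proof (rule ubox_bound)
    show "continuous_on ubox (\<lambda>y. gkernel v y *\<^sub>R g (x + r *\<^sub>R y))"
      by (intro continuous_intros continuous_on_compose2[OF g]) auto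
    show "0 \<le> 6 / bump_mass TYPE('a) * norm v * M" using bm \<open>0 \<le> M\<close> by simp
    show "norm (gkernel v y *\<^sub>R g (x + r *\<^sub>R y)) \<le> 6 / bump_mass TYPE('a) * norm v * M" for y
    proof (cases "norm y \<ge> 1")
      case True
      then show ?thesis using bm \<open>0 \<le> M\<close> by (simp add: gkernel_def bump_eq_0)
    next
      case False
      have "norm (g (x + r *\<^sub>R y)) \<le> M"
        using False r by (intro M) (auto simp: dist_norm mult_left_le)
      moreover have "\<bar>y \<bullet> v\<bar> \<le> norm v"
        using Cauchy_Schwarz_ineq2[of y v] False mult_right_mono[of "norm y" 1 "norm v"] by auto
      then have "\<bar>gkernel v y\<bar> \<le> 6 / bump_mass TYPE('a) * norm v * 1"
        unfolding gkernel_def abs_mult using bm bump_le_1[of 2 y]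
        by (intro mult_mono) auto
      ultimately show ?thesis using \<open>0 \<le> M\<close> 
        by (simp only: norm_scaleR mult_1_right) (intro mult_mono; simp)
    qed
  qed
  then show ?thesis by (simp add: cauchy_const_def mult_ac)
qed

lemma cauchy_estimate:
  assumes f: "nullsol f" and r: "0 < r" and M: "\<And>y. y \<in> cball x r \<Longrightarrow> norm (f y) \<le> M"
  shows "norm (dirder v f x) \<le> cauchy_const * norm v / r * M"
proof -
  have "0 \<le> M" using M[of x] r norm_ge_zero[of "f x"] by (simp del: norm_ge_zero)
  have "norm (r *\<^sub>R dirder v f x) \<le> cauchy_const * norm v * M"
    unfolding dirder_convolution[OF f] 
    by (rule norm_gkernel_convolution_le) (use r M \<open>0 \<le> M\<close> in \<open>auto intro!: C1_continuous[OF nullsol_C1[OF f], of UNIV "\<lambda>x. x"]\<close>)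
  then show ?thesis using r by (simp add: field_simps)
qed

lemma nullsol_foldr_dirder: "nullsol f \<Longrightarrow> nullsol (foldr dirder vs f)"
  by (induction vs) (auto intro: nullsol_dirder)

text \<open>Every derivative uses up one radius r. The induction on the list therefore lets the
  inner radius \<open>\<rho>\<close> grow by r while the ball on which \<open>f\<close> is bounded
  stays the same.\<close>

lemma iterated_cauchy:
  assumes f: "nullsol f" and r: "0 < r" and "0 \<le> M"
  shows "\<lbrakk>\<And>y. y \<in> cball x (\<rho> + r * real (length vs)) \<Longrightarrow> norm (f y) \<le> M; \<And>v. v \<in> set vs \<Longrightarrow> norm v \<le> L;
     y \<in> cball x \<rho>\<rbrakk> \<Longrightarrow> norm (foldr dirder vs f y) \<le> (cauchy_const * L / r) ^ length vs * M"
proof (induction vs arbitrary: \<rho> y)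
  case Nil
  then show ?case by simp
next
  case (Cons v vs)
  have IH: "norm (foldr dirder vs f z) \<le> (cauchy_const * L / r) ^ length vs * M" if "z \<in> cball y r" for z
  proof (rule Cons.IH[of "\<rho> + r"])
    show "z \<in> cball x (\<rho> + r)" using that Cons.prems(3) dist_triangle[of x z y] by auto
  qed (use Cons.prems in \<open>auto simp: algebra_simps\<close>)
  have L: "norm v \<le> L" "0 \<le> L" using Cons.prems(2)[of v] norm_ge_zero[of v] by (auto simp del: norm_ge_zero)
  have "norm (foldr dirder (v # vs) f y) \<le> cauchy_const * norm v / r * ((cauchy_const * L / r) ^ length vs * M)"
    using cauchy_estimate[OF nullsol_foldr_dirder[OF f] r IH] by simp
  also have "\<dots> \<le> cauchy_const * L / r * ((cauchy_const * L / r) ^ length vs * M)"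
    using L r \<open>0 \<le> M\<close> cauchy_const_nonneg by (intro mult_right_mono divide_right_mono mult_left_mono) auto
  finally show ?case by simp
qed

definition cauchy_base :: real where "cauchy_base = cauchy_const * exp 1"

lemma cauchy_base_nonneg: "0 \<le> cauchy_base" using cauchy_const_nonneg by (simp add: cauchy_base_def)

lemma cauchy_factorial:
  assumes f: "nullsol f" and R: "0 < R" and M: "\<And>y. y \<in> cball x R \<Longrightarrow> norm (f y) \<le> M"
    and L: "\<And>v. v \<in> set vs \<Longrightarrow> norm v \<le> L" "0 \<le> L"
  shows "norm (foldr dirder vs f x) \<le> fact (length vs) * (cauchy_base * L / R) ^ length vs * M"
proof (cases "vs = []")
  case True
  then show ?thesis using M[of x] R by simp
next
  case False
  define m where "m = length vs"
  have m: "m > 0" using False by (simp add: m_def)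
  have M0: "0 \<le> M" using M[of x] R norm_ge_zero[of "f x"] by (simp del: norm_ge_zero)
  \<comment> \<open>m steps of length R/m use up exactly the radius R.\<close>
  have "norm (foldr dirder vs f x) \<le> (cauchy_const * L / (R / real m)) ^ length vs * M"
    by (rule iterated_cauchy[where \<rho> = 0 and x = x]) (use f R M L M0 m in \<open>auto simp: m_def\<close>)
  also have "(cauchy_const * L / (R / real m)) ^ length vs = (cauchy_const * L / R) ^ m * real m ^ m"
    by (simp add: m_def power_mult_distrib[symmetric])
  also have "\<dots> \<le> (cauchy_const * L / R) ^ m * (exp 1 ^ m * fact m)"
    using R L cauchy_const_nonneg by (intro mult_left_mono power_self_le_fact) auto
  also have "\<dots> = fact m * (cauchy_base * L / R) ^ m"
    by (simp add: cauchy_base_def power_mult_distrib power_divide)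
  finally show ?thesis using M0 by (simp add: m_def mult_right_mono)
qed

lemma nullsol_bounded_cball:
  assumes "nullsol f" obtains M where "0 \<le> M" "\<And>y. y \<in> cball x R \<Longrightarrow> norm (f y) \<le> M"
proof -
  have "compact (f ` cball x R)"
    by (intro compact_continuous_image C1_continuous[OF nullsol_C1[OF assms]] continuous_on_id) auto
  then obtain M where "\<And>y. y \<in> cball x R \<Longrightarrow> norm (f y) \<le> M"
    using compact_imp_bounded bounded_iff by (metis imageI)
  then show ?thesis using that[of "max 0 M"] by fastforce
qed

lemma nullsol_taylor:
  assumes f: "nullsol f"
  shows "(\<lambda>m. (1 / fact m) *\<^sub>R (dirder v ^^ m) f x) sums f (x + v)"
proof -
  \<comment> \<open>With this radius each derivative along v contributes at most a factor 1/4
    besides the factorial. The bound on \<open>f\<close> is taken on the ball of radius R + |v|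
    because the estimates are centred at all points of the segment from x to x + v.\<close>
  define R where "R = 4 * (cauchy_base * norm v) + 1"
  have R: "R > 0" using cauchy_base_nonneg by (simp add: R_def add_nonneg_pos)
  obtain M where M: "0 \<le> M" "\<And>y. y \<in> cball x (R + norm v) \<Longrightarrow> norm (f y) \<le> M"
    using nullsol_bounded_cball[OF f] by blast
  have mgm: "nullsol ((dirder v ^^ m) f)" for m using nullsol_foldr_dirder[OF f, of "replicate m v"] by (simp add: foldr_replicate)
  have quarter: "cauchy_base * norm v / R \<le> 1/4" "0 \<le> cauchy_base * norm v / R"
    using R cauchy_base_nonneg by (auto simp: R_def field_simps add_nonneg_pos)
  define Df where "Df m t = (dirder v ^^ m) f (x + t *\<^sub>R v)" for m t
  have bd: "norm (Df m t) \<le> fact m * (1/4) ^ m * M" if "0 \<le> t" "t \<le> 1" for m t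
  proof -
    have "norm (foldr dirder (replicate m v) f (x + t *\<^sub>R v)) \<le> fact (length (replicate m v)) * (cauchy_base * norm v / R) ^ length (replicate m v) * M"
    proof (rule cauchy_factorial[OF f R])
      fix y assume "y \<in> cball (x + t *\<^sub>R v) R"
      moreover have "dist x (x + t *\<^sub>R v) \<le> norm v" using that by (simp add: dist_norm mult_left_le_one_le)
      ultimately have "y \<in> cball x (R + norm v)" using dist_triangle[of x y "x + t *\<^sub>R v"] by auto
      then show "norm (f y) \<le> M" by (rule M)
    qed auto
    also have "\<dots> \<le> fact m * (1/4) ^ m * M"
      using quarter M by (auto intro!: mult_right_mono mult_left_mono power_mono)
    finally show ?thesis by (simp add: Df_def foldr_replicate)
  qed
  have Df: "(Df m has_vector_derivative Df (Suc m) t) (at t within {0..1})" for m t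
  proof -
    have "((\<lambda>t. (dirder v ^^ m) f (x + t *\<^sub>R v)) has_derivative (\<lambda>s. dirder (s *\<^sub>R v) ((dirder v ^^ m) f) (x + t *\<^sub>R v))) (at t within {0..1})"
      by (rule has_derivative_compose[OF _ C1_has_derivative[OF nullsol_C1[OF mgm]]]) (auto intro!: derivative_eq_intros)
    then show ?thesis
      by (simp add: Df_def[abs_def] has_vector_derivative_def linear_scale[OF C1_linear[OF nullsol_C1[OF mgm]]])
  qed
  have rem: "norm (f (x + v) - (\<Sum>m<p. (1 / fact m) *\<^sub>R (dirder v ^^ m) f x)) \<le> real p * (1/4) ^ p * M" if p: "p > 0" for p
  proof -
    have "((\<lambda>t. ((1 - t) ^ (p - 1) / fact (p - 1)) *\<^sub>R Df p t) has_integral 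
       Df 0 1 - (\<Sum>i<p. ((1 - 0) ^ i / fact i) *\<^sub>R Df i 0)) {0..1}"
      by (rule Taylor_has_integral[OF p]) (use Df in auto)
    then have "norm (Df 0 1 - (\<Sum>i<p. ((1 - 0) ^ i / fact i) *\<^sub>R Df i 0)) \<le> (real p * (1/4) ^ p * M) * Henstock_Kurzweil_Integration.content {0..1::real}"
    proof (rule has_integral_bound_real[rotated 2])
      fix t :: real assume t: "t \<in> {0..1} - {}"
      have "norm (((1 - t) ^ (p - 1) / fact (p - 1)) *\<^sub>R Df p t) \<le> 1 / fact (p - 1) * (fact p * (1/4) ^ p * M)"
        unfolding norm_scaleR using t bd[of t p]
        by (intro mult_mono) (auto simp: power_le_one divide_right_mono)
      also have "\<dots> = real p * (1/4) ^ p * M" using p fact_reduce[OF p, where 'a = real] by simp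
      finally show "norm (((1 - t) ^ (p - 1) / fact (p - 1)) *\<^sub>R Df p t) \<le> real p * (1/4) ^ p * M" .
    qed (use M in auto)
    then show ?thesis by (simp add: Df_def)
  qed
  have "(\<lambda>p. (\<Sum>m<p. (1 / fact m) *\<^sub>R (dirder v ^^ m) f x) - f (x + v)) \<longlonglongrightarrow> 0"
  proof (rule Lim_null_comparison)
    show "\<forall>\<^sub>F p in sequentially. norm ((\<Sum>m<p. (1 / fact m) *\<^sub>R (dirder v ^^ m) f x) - f (x + v)) \<le> real p * (1/4) ^ p * M"
      using eventually_gt_at_top[of 0] by eventually_elim (use rem in \<open>simp add: norm_minus_commute\<close>)
    have "(\<lambda>n. real n * (1/4) ^ n) \<longlonglongrightarrow> 0" by (rule lim_n_over_pown[of 4, simplified, THEN filterlim_cong[THEN iffD1, rotated -1]]) (auto simp: power_divide)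
    then show "(\<lambda>p. real p * (1/4) ^ p * M) \<longlonglongrightarrow> 0" using tendsto_mult_left_zero by blast
  qed
  then show ?thesis unfolding sums_def by (rule LIM_zero_cancel)
qed

section \<open>Closure of null solutions under linear operations and locally uniform limits\<close>

lemma nullsol_0: "nullsol (\<lambda>x. 0)"
  by (simp add: nullsol_def C1_const dirder_const bounded_bilinear.zero_right[OF E])

lemma nullsol_add: "nullsol f \<Longrightarrow> nullsol g \<Longrightarrow> nullsol (\<lambda>x. f x + g x)"
  unfolding nullsol_def by (simp add: C1_add dirder_add bounded_bilinear.add_right[OF E] sum.distrib)

lemma nullsol_scaleR: "nullsol f \<Longrightarrow> nullsol (\<lambda>x. c *\<^sub>R f x)"
  unfolding nullsol_def
  by (simp add: C1_scaleR_right dirder_scaleR_right bounded_bilinear.scaleR_right[OF E] scaleR_sum_right[symmetric])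

lemma nullsol_diff: "nullsol f \<Longrightarrow> nullsol g \<Longrightarrow> nullsol (\<lambda>x. f x - g x)"
  using nullsol_add[of f "\<lambda>x. (-1) *\<^sub>R g x"] nullsol_scaleR[of g "-1"] by simp

lemma nullsol_sum: "(\<And>i. i \<in> I \<Longrightarrow> nullsol (f i)) \<Longrightarrow> nullsol (\<lambda>x. \<Sum>i\<in>I. f i x)"
  by (induction I rule: infinite_finite_induct) (auto intro: nullsol_0 nullsol_add)

text \<open>Derivatives of the approximants are convolutions of the approximants with the fixed
  kernel \<open>gkernel\<close>, so locally uniform convergence passes to the derivatives. The
  candidate derivative of the limit is the same convolution applied to the limit.\<close>

lemma nullsol_uniform_limit:
  assumes F: "\<And>n. nullsol (F n)" and lim: "\<And>r. uniform_limit (cball 0 r) F f sequentially"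
  shows "nullsol f"
proof -
  interpret E: bounded_bilinear E by (rule E)
  note Fc = C1_continuous[OF nullsol_C1[OF F], of UNIV "\<lambda>x. x"]
  have dcoeff: "continuous_on UNIV f"
  proof -
    have "continuous_on (cball 0 r) f" for r
      by (rule uniform_limit_theorem[OF _ lim]) (auto intro!: always_eventually continuous_on_subset[OF Fc])
    from continuous_on_subset[OF this ball_subset_cball] have "continuous_on (ball 0 r) f" for r .
    then have "isCont f x" for x
      using continuous_on_eq_continuous_at[OF open_ball, of 0 "norm x + 1" f] by auto
    then show ?thesis by (simp add: continuous_at_imp_continuous_on)
  qed
  define g where "g x v = integral ubox (\<lambda>y. gkernel v y *\<^sub>R f (x + 1 *\<^sub>R y))" for x v
  have pt: "(\<lambda>n. F n x) \<longlonglongrightarrow> f x" for x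
    using tendsto_uniform_limitI[OF lim[of "norm x"], of x] by simp
  have diff: "dirder v (F n) x - g x v = integral ubox (\<lambda>y. gkernel v y *\<^sub>R (F n (x + 1 *\<^sub>R y) - f (x + 1 *\<^sub>R y)))" for n x v
    unfolding g_def nullsol_dirder_eq[OF F] scaleR_diff_right
    by (rule integral_diff[symmetric]; rule ubox_integrable)
       (intro continuous_intros continuous_on_compose2[OF Fc] continuous_on_compose2[OF dcoeff] subset_UNIV)+
  have unif: "\<forall>\<^sub>F n in sequentially. \<forall>x\<in>ball 0 r. \<forall>v. norm (dirder v (F n) x - g x v) \<le> e * norm v" if "e > 0" for r e
  proof -
    define d where "d = e / (cauchy_const + 1)"
    have d: "d > 0" using that cauchy_const_nonneg by (simp add: d_def add_nonneg_pos)
    have "\<forall>\<^sub>F n in sequentially. \<forall>x\<in>cball 0 (r + 1). dist (F n x) (f x) < d"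
      using uniform_limitD[OF lim d] .
    then show ?thesis
    proof eventually_elim
      case (elim n)
      show ?case
      proof (intro ballI allI)
        fix x v :: 'a assume x: "x \<in> ball 0 r"
        have "norm (dirder v (F n) x - g x v) \<le> cauchy_const * norm v * d"
          unfolding diff
        proof (rule norm_gkernel_convolution_le[of "\<lambda>z. F n z - f z"])
          show "continuous_on UNIV (\<lambda>z. F n z - f z)" by (intro continuous_intros Fc dcoeff)
          fix y assume "y \<in> cball x 1"
          then have "y \<in> cball 0 (r + 1)" using x dist_triangle[of 0 y x] by auto
          then show "norm (F n y - f y) \<le> d" using elim by (fastforce simp: dist_norm less_imp_le)
        qed (use d in auto)
        also have "\<dots> = cauchy_const * d * norm v" by simp
        also have "\<dots> \<le> e * norm v"
          using that cauchy_const_nonneg by (intro mult_right_mono) (auto simp: d_def field_simps)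
        finally show "norm (dirder v (F n) x - g x v) \<le> e * norm v" .
      qed
    qed
  qed
  have fd: "(f has_derivative g x) (at x)" for x
  proof -
    define S where "S = ball (0::'a) (norm x + 1)"
    have xS: "x \<in> S" by (simp add: S_def)
    have "\<exists>h. \<forall>x\<in>S. (\<lambda>n. F n x) \<longlonglongrightarrow> h x \<and> (h has_derivative g x) (at x within S)"
    proof (rule has_derivative_sequence[of S F "\<lambda>n x v. dirder v (F n) x"])
      show "convex S" by (simp add: S_def)
      show "(F n has_derivative (\<lambda>v. dirder v (F n) x)) (at x within S)" for n x
        by (rule has_derivative_at_withinI[OF C1_has_derivative[OF nullsol_C1[OF F]]])
      show "\<forall>\<^sub>F n in sequentially. \<forall>x\<in>S. \<forall>v. norm (dirder v (F n) x - g x v) \<le> e * norm v" if "e > 0" for e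
        unfolding S_def using that by (rule unif)
    qed (rule xS pt)+
    then obtain h where h: "\<And>x. x \<in> S \<Longrightarrow> (\<lambda>n. F n x) \<longlonglongrightarrow> h x" "\<And>x. x \<in> S \<Longrightarrow> (h has_derivative g x) (at x within S)"
      by blast
    have "(h has_derivative g x) (at x)" using h(2)[OF xS] xS by (simp add: S_def at_within_open[OF _ open_ball])
    moreover have "h z = f z" if "z \<in> S" for z using h(1)[OF that] pt by (rule LIMSEQ_unique)
    ultimately show ?thesis
      using has_derivative_transform_within_open[of h "g x" x UNIV S f] xS by (simp add: S_def)
  qed
  have "C1 f" 
    by (rule C1I[OF fd]) (simp only: g_def, intro convolution_continuous dcoeff continuous_intros)
  moreover have "(\<Sum>b\<in>Basis. E b (dirder b f x)) = 0" for x
  proof -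
    have "(\<lambda>n. dirder v (F n) x) \<longlonglongrightarrow> g x v" for v
    proof (rule LIMSEQ_I)
      fix e :: real assume "e > 0"
      define d where "d = e / (norm v + 1)"
      have d: "d > 0" using \<open>e > 0\<close> by (simp add: d_def add_nonneg_pos)
      have "d * (norm v + 1) = e" using norm_ge_zero[of v] unfolding d_def by (simp del: norm_ge_zero)
      then have "d * norm v < e" using d by (simp add: algebra_simps)
      moreover have "x \<in> ball 0 (norm x + 1)" by simp
      with unif[OF d, of "norm x + 1"] obtain N where "\<forall>n\<ge>N. norm (dirder v (F n) x - g x v) \<le> d * norm v"
        unfolding eventually_sequentially by blast
      ultimately show "\<exists>N. \<forall>n\<ge>N. norm (dirder v (F n) x - g x v) < e" by (meson le_less_trans)
    qed
    then have "(\<lambda>n. \<Sum>b\<in>Basis. E b (dirder b (F n) x)) \<longlonglongrightarrow> (\<Sum>b\<in>Basis. E b (g x b))"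
      by (intro tendsto_sum E.tendsto tendsto_const)
    then have "(\<Sum>b\<in>Basis. E b (g x b)) = 0"
      using F by (simp add: nullsol_def LIMSEQ_const_iff)
    then show ?thesis using dirder_eq[OF fd] by simp
  qed
  ultimately show ?thesis by (simp add: nullsol_def)
qed

end

section \<open>Dirac operators of Clifford modules\<close>

locale clifford =
  fixes c :: "'v::euclidean_space \<Rightarrow> 'b::euclidean_space \<Rightarrow> 'b"
  assumes c: "bounded_bilinear c" and csq: "c v (c v a) = - (v \<bullet> v) *\<^sub>R a"
begin

sublocale c: bounded_bilinear c by (rule c)

lemma bilinear_E:
  "bounded_bilinear (\<lambda>x a. fst x *\<^sub>R a + c (snd x) a)" (is "bounded_bilinear ?E")
  "bounded_bilinear (\<lambda>x a. fst x *\<^sub>R a - c (snd x) a)" (is "bounded_bilinear ?F")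
proof -
  obtain K where K: "\<And>(a::real \<times> 'v) b. norm (c (snd a) b) \<le> norm a * norm b * K"
    using bounded_bilinear.bounded[OF bounded_bilinear.comp1[OF c bounded_linear_snd]] by blast
  have fst: "norm (fst a *\<^sub>R b) \<le> norm a * norm b * 1" for a :: "real \<times> 'v" and b :: 'b
    using norm_fst_le[of "fst a" "snd a"] by (simp add: mult_right_mono)
  have bd: "norm (?E a b) \<le> norm a * norm b * (1 + K)" "norm (?F a b) \<le> norm a * norm b * (1 + K)" for a b
    unfolding distrib_left
    by (rule order_trans[OF norm_triangle_ineq add_mono[OF fst K]] order_trans[OF norm_triangle_ineq4 add_mono[OF fst K]])+
  show "bounded_bilinear ?E"
    by (rule bounded_bilinear.intro; (intro exI allI, rule bd(1))?)
       (simp_all add: c.add_left c.add_right c.scaleR_left c.scaleR_right algebra_simps)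
  show "bounded_bilinear ?F"
    by (rule bounded_bilinear.intro; (intro exI allI, rule bd(2))?)
       (simp_all add: c.add_left c.add_right c.scaleR_left c.scaleR_right algebra_simps)
qed

lemma bilinear_minus_c: "bounded_bilinear (\<lambda>v a. - c v a)"
proof
  obtain K where "\<And>a b. norm (c a b) \<le> norm a * norm b * K" using c.bounded by blast
  then show "\<exists>K. \<forall>a b. norm (- c a b) \<le> norm a * norm b * K" by auto
qed (auto simp: c.add_left c.add_right c.scaleR_left c.scaleR_right)

sublocale X: dirac "\<lambda>x a. fst x *\<^sub>R a + c (snd x) a" "\<lambda>x a. fst x *\<^sub>R a - c (snd x) a"
  by (rule dirac.intro[OF bilinear_E]) (simp add: inner_prod_def c.add_right c.scaleR_right csq algebra_simps)

sublocale V: dirac c "\<lambda>v a. - c v a"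
  by (rule dirac.intro[OF c bilinear_minus_c]) (simp add: csq)

lemma c_polar: "c u (c v a) = - c v (c u a) - (2 * (u \<bullet> v)) *\<^sub>R a"
proof -
  have "c u (c v a) = - (- c u (c v a) + - c v (c u a)) - c v (c u a)" by simp
  then show ?thesis unfolding V.EbE_polar by simp
qed

definition dirac_op :: "('v \<Rightarrow> 'b) \<Rightarrow> 'v \<Rightarrow> 'b" where
  "dirac_op S x = (\<Sum>b\<in>Basis. c b (dirder b S x))"

lemma V_nullsol_iff: "V.nullsol f \<longleftrightarrow> C1 f \<and> (\<forall>x. dirac_op f x = 0)"
  by (simp add: V.nullsol_def dirac_op_def)

lemma X_nullsol_iff: "X.nullsol f \<longleftrightarrow> C1 f \<and> (\<forall>x. dirder (1, 0) f x + (\<Sum>b\<in>Basis. c b (dirder (0, b) f x)) = 0)"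
proof -
  have "(\<Sum>b\<in>Basis. fst b *\<^sub>R dirder b f x + c (snd b) (dirder b f x)) = 
     dirder (1, 0) f x + (\<Sum>b\<in>Basis. c b (dirder (0, b) f x))" for x
    unfolding Basis_prod_def
    by (subst sum.union_disjoint) (auto simp: sum.reindex inj_on_def c.zero_left)
  then show ?thesis by (simp add: X.nullsol_def)
qed

definition homog :: "nat \<Rightarrow> ('v \<Rightarrow> 'b) \<Rightarrow> bool" where
  "homog d S \<longleftrightarrow> C1 S \<and> (\<forall>t x. S (t *\<^sub>R x) = t ^ d *\<^sub>R S x)"

lemma euler:
  assumes "homog d S" shows "dirder x S x = real d *\<^sub>R S x"
proof -
  have S: "C1 S" "\<And>t. S (t *\<^sub>R x) = t ^ d *\<^sub>R S x" using assms by (auto simp: homog_def)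
  have "((\<lambda>t. S (t *\<^sub>R x)) has_derivative (\<lambda>s. dirder (s *\<^sub>R x) S (1 *\<^sub>R x))) (at 1)"
    by (rule has_derivative_compose[OF _ C1_has_derivative[OF S(1)]]) (auto intro!: derivative_eq_intros)
  moreover have "((\<lambda>t. S (t *\<^sub>R x)) has_derivative (\<lambda>s. (real d * s) *\<^sub>R S x)) (at 1)"
    unfolding S(2) by (auto intro!: derivative_eq_intros)
  ultimately have "(\<lambda>s. dirder (s *\<^sub>R x) S (1 *\<^sub>R x)) = (\<lambda>s. (real d * s) *\<^sub>R S x)"
    by (rule has_derivative_unique)
  from fun_cong[OF this, of 1] show ?thesis by simp
qed

lemma homog_scaleR: "homog d S \<Longrightarrow> homog d (\<lambda>x. r *\<^sub>R S x)"
  by (auto simp: homog_def C1_scaleR_right)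

lemma homog_sum: "(\<And>i. i \<in> I \<Longrightarrow> homog d (S i)) \<Longrightarrow> homog d (\<lambda>x. \<Sum>i\<in>I. S i x)"
  by (auto simp: homog_def C1_sum scaleR_sum_right)

lemma dirder_c: "C1 S \<Longrightarrow> dirder v (\<lambda>x. c x (S x)) x = c x (dirder v S x) + c v (S x)"
  using dirder_bilinear[OF c C1_ident] by (simp add: dirder_ident)

lemma homog_c: "homog d S \<Longrightarrow> homog (Suc d) (\<lambda>x. c x (S x))"
  by (auto simp: homog_def c.scaleR_left c.scaleR_right mult.commute intro: C1_bilinear[OF c C1_ident])

lemma homog_cpow: "homog d S \<Longrightarrow> homog (d + i) (\<lambda>x. (c x ^^ i) (S x))"
  by (induction i) (auto dest: homog_c)

text \<open>Moving e_b past x leaves -2 x_b times the b-th derivative, which sums to the Euler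
  operator and hence to -2 d S; the squares e_b e_b = -1 sum to minus the dimension.\<close>

lemma dirac_op_c:
  assumes S: "homog d S"
  shows "dirac_op (\<lambda>x. c x (S x)) x = - c x (dirac_op S x) - (real DIM('v) + 2 * real d) *\<^sub>R S x"
proof -
  have S1: "C1 S" using S by (simp add: homog_def)
  have "c b (c x (dirder b S x) + c b (S x)) = - c x (c b (dirder b S x)) - 2 *\<^sub>R ((x \<bullet> b) *\<^sub>R dirder b S x) - S x"
    if "b \<in> Basis" for b
    using that by (simp add: c.add_right csq c_polar[of b x] inner_commute)
  then have "dirac_op (\<lambda>x. c x (S x)) x = (\<Sum>b\<in>Basis. - c x (c b (dirder b S x)) - 2 *\<^sub>R ((x \<bullet> b) *\<^sub>R dirder b S x) - S x)"
    unfolding dirac_op_def by (intro sum.cong) (simp_all add: dirder_c[OF S1])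
  also have "\<dots> = - c x (dirac_op S x) - 2 *\<^sub>R dirder x S x - real DIM('v) *\<^sub>R S x"
    by (simp only: sum_subtractf sum_negf dirac_op_def c.sum_right scaleR_sum_right[symmetric] dirder_basis[OF S1, symmetric] sum_constant_scaleR)
  finally show ?thesis by (simp add: euler[OF S] algebra_simps)
qed

text \<open>These numbers appear in \<open>D (x\<^sup>i S)\<close> for \<open>S\<close> homogeneous of degree \<open>d\<close>.\<close>
definition dcoeff :: "nat \<Rightarrow> nat \<Rightarrow> real" where
  "dcoeff i d = (if even i then real i else real DIM('v) + 2 * real d + real i - 1)"

lemma dcoeff_0 [simp]: "dcoeff 0 d = 0" by (simp add: dcoeff_def)

lemma dcoeff_Suc: "dcoeff (Suc i) d = real DIM('v) + 2 * real d + 2 * real i - dcoeff i d"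
  by (simp add: dcoeff_def)

text \<open>Reflects x^(i + j) S = x^j (x^i S): for a null solution S the two ways of computing D
  must produce the same scalar.\<close>

lemma dcoeff_add: "dcoeff (i + j) d = (- 1) ^ j * dcoeff i d + dcoeff j (d + i)"
  by (auto simp: dcoeff_def)

text \<open>This lower bound is the source of the factors 1/i! and 1/j! in the bounds for
  \<open>pcoeff\<close> and \<open>fcoeff\<close>.\<close>

lemma dcoeff_ge: "real i \<le> dcoeff i d"
proof -
  have "1 \<le> real DIM('v)" "0 \<le> real d" using DIM_positive[where 'a = 'v] by linarith+
  then have "real i \<le> real DIM('v) + 2 * real d + real i - 1" by linarith
  then show ?thesis unfolding dcoeff_def by simp
qed

lemma dcoeff_Suc_pos: "0 < dcoeff (Suc i) d"
  using dcoeff_ge[of "Suc i" d] by simp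

lemma dirac_op_cpow:
  assumes S: "homog d S"
  shows "dirac_op (\<lambda>x. (c x ^^ i) (S x)) x = (- 1) ^ i *\<^sub>R (c x ^^ i) (dirac_op S x) - dcoeff i d *\<^sub>R (c x ^^ (i - 1)) (S x)"
proof (induction i)
  case (Suc i)
  have "dirac_op (\<lambda>x. (c x ^^ Suc i) (S x)) x = - c x (dirac_op (\<lambda>x. (c x ^^ i) (S x)) x) - (real DIM('v) + 2 * real (d + i)) *\<^sub>R (c x ^^ i) (S x)"
    using dirac_op_c[OF homog_cpow[OF S, of i]] by simp
  moreover have "dcoeff i d *\<^sub>R c x ((c x ^^ (i - 1)) (S x)) = dcoeff i d *\<^sub>R (c x ^^ i) (S x)" by (cases i) auto
  ultimately show ?case
    unfolding Suc dcoeff_Suc by (simp add: c.diff_right c.scaleR_right algebra_simps)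
qed simp

lemma dirac_op_sum: "(\<And>i. i \<in> I \<Longrightarrow> C1 (S i)) \<Longrightarrow> dirac_op (\<lambda>x. \<Sum>i\<in>I. S i x) x = (\<Sum>i\<in>I. dirac_op (S i) x)"
  by (simp add: dirac_op_def dirder_sum c.sum_right) (rule sum.swap)

lemma dirac_op_scaleR: "C1 S \<Longrightarrow> dirac_op (\<lambda>x. r *\<^sub>R S x) x = r *\<^sub>R dirac_op S x"
  by (simp add: dirac_op_def dirder_scaleR_right c.scaleR_right scaleR_sum_right)

lemma homog_C1: "homog d S \<Longrightarrow> C1 S" by (simp add: homog_def)

lemma cpow_linear: "(c x ^^ i) (r *\<^sub>R a) = r *\<^sub>R (c x ^^ i) a" "(c x ^^ i) (a + b) = (c x ^^ i) a + (c x ^^ i) b"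
   "(c x ^^ i) 0 = 0"
  by (induction i) (auto simp: c.scaleR_right c.add_right c.zero_right)

lemma cpow_sum: "(c x ^^ i) (\<Sum>k\<in>I. f k) = (\<Sum>k\<in>I. (c x ^^ i) (f k))"
  by (induction I rule: infinite_finite_induct) (auto simp: cpow_linear)

text \<open>D removes the summand j = 0, shifts the others down by one and multiplies them by a
  nonzero \<open>dcoeff\<close>. The induction hypothesis then annihilates all \<open>T j\<close>
  with j >= 1, and the original relation leaves \<open>T 0\<close> alone.\<close>

lemma fischer_unique:
  "\<lbrakk>\<And>j. j \<le> m \<Longrightarrow> homog (m - j) (T j); \<And>j x. j \<le> m \<Longrightarrow> dirac_op (T j) x = 0; \<And>x. (\<Sum>j\<le>m. (c x ^^ j) (T j x)) = 0\<rbrakk>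
    \<Longrightarrow> j \<le> m \<Longrightarrow> T j x = 0"
proof (induction m arbitrary: T j x)
  case 0
  then show ?case using 0(3)[of x] by simp
next
  case (Suc m)
  have homog: "homog (m - j) (T (Suc j))" if "j \<le> m" for j using Suc.prems(1)[of "Suc j"] that by simp
  define T' where "T' j x = dcoeff (Suc j) (m - j) *\<^sub>R T (Suc j) x" for j x
  have "T' j x = 0" if "j \<le> m" for j x
  proof (rule Suc.IH[of T'])
    fix j assume j: "j \<le> m"
    show "homog (m - j) (T' j)" unfolding T'_def by (rule homog_scaleR[OF homog[OF j]])
    show "dirac_op (T' j) x = 0" for x
      unfolding T'_def dirac_op_scaleR[OF homog_C1[OF homog[OF j]]] using Suc.prems(2)[of "Suc j" x] j by simp
  next
    fix x
    have "0 = dirac_op (\<lambda>x. \<Sum>j\<le>Suc m. (c x ^^ j) (T j x)) x"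
      unfolding Suc.prems(3) by (simp add: dirac_op_def dirder_const c.zero_right)
    also have "\<dots> = (\<Sum>j\<le>Suc m. dirac_op (\<lambda>x. (c x ^^ j) (T j x)) x)"
      by (rule dirac_op_sum) (use Suc.prems(1) homog_C1 homog_cpow in \<open>metis atMost_iff\<close>)
    also have "\<dots> = (\<Sum>j\<le>Suc m. - (dcoeff j (Suc m - j) *\<^sub>R (c x ^^ (j - 1)) (T j x)))"
      by (intro sum.cong refl) (simp add: dirac_op_cpow[OF Suc.prems(1)] Suc.prems(2) cpow_linear)
    also have "\<dots> = - (\<Sum>j\<le>m. (c x ^^ j) (T' j x))"
      unfolding sum.atMost_Suc_shift by (simp add: T'_def cpow_linear sum_negf)
    finally show "(\<Sum>j\<le>m. (c x ^^ j) (T' j x)) = 0" by simp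
  qed (use that in auto)
  then have *: "T (Suc j) x = 0" if "j \<le> m" for j x
    using that dcoeff_Suc_pos[of j "m - j"] by (fastforce simp: T'_def)
  show ?case
  proof (cases j)
    case 0
    have "(\<Sum>j\<le>Suc m. (c x ^^ j) (T j x)) = T 0 x"
      unfolding sum.atMost_Suc_shift using * by (simp add: cpow_linear del: funpow.simps)
    then show ?thesis using Suc.prems(3)[of x] 0 by simp
  next
    case (Suc j')
    then show ?thesis using * Suc.prems(4) by simp
  qed
qed

end

section \<open>Fischer decomposition of Taylor polynomials\<close>

context dirac begin

lemma nullsol_funpow: "nullsol f \<Longrightarrow> nullsol ((dirder v ^^ m) f)"
  by (induction m) (auto intro: nullsol_dirder)

lemma funpow_dirder_lincomb:
  assumes "\<And>i. i \<in> I \<Longrightarrow> bounded_linear (A i)" "\<And>i. i \<in> I \<Longrightarrow> nullsol (g i)"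
  shows "(dirder w ^^ d) (\<lambda>z. \<Sum>i\<in>I. A i (g i z)) = (\<lambda>z. \<Sum>i\<in>I. A i ((dirder w ^^ d) (g i) z))"
proof (induction d)
  case (Suc d)
  note C = nullsol_C1[OF nullsol_funpow[OF assms(2)]]
  have "dirder w (\<lambda>z. \<Sum>i\<in>I. A i ((dirder w ^^ d) (g i) z)) z = (\<Sum>i\<in>I. dirder w (\<lambda>z. A i ((dirder w ^^ d) (g i) z)) z)" for z
    by (rule dirder_sum[OF C1_bounded_linear[OF assms(1) C]])
  also have "\<dots> z = (\<Sum>i\<in>I. A i (dirder w ((dirder w ^^ d) (g i)) z))" for z
    by (intro sum.cong refl dirder_bounded_linear[OF assms(1) C])
  finally have "dirder w (\<lambda>z. \<Sum>i\<in>I. A i ((dirder w ^^ d) (g i) z)) z = (\<Sum>i\<in>I. A i (dirder w ((dirder w ^^ d) (g i)) z))" for z .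
  then show ?case by (simp add: Suc fun_eq_iff)
qed simp

end

text \<open>\<open>g\<close> stands for the later \<open>dcoeff\<close>. The recursion is the
  telescoping condition for D to annihilate the sum of p_i x^i H(i + j, k - i): what D makes of H in
  the i-th term must cancel what it makes of the power x^(i + 1) in the next one.\<close>

fun pcoeff_of :: "(nat \<Rightarrow> nat \<Rightarrow> real) \<Rightarrow> nat \<Rightarrow> nat \<Rightarrow> real" where
  "pcoeff_of g k 0 = 1"
| "pcoeff_of g k (Suc i) = (- 1) ^ i * pcoeff_of g k i / g (Suc i) (k - Suc i)"

text \<open>(-1)^j divided by the product of \<open>g l k\<close> for l = 1, ..., j: with
  \<open>g\<close> = \<open>dcoeff\<close>, the inverse of the scalar by which D^j acts on x^j S for
  a null solution S of degree k.\<close>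

fun fcoeff_of :: "(nat \<Rightarrow> nat \<Rightarrow> real) \<Rightarrow> nat \<Rightarrow> nat \<Rightarrow> real" where
  "fcoeff_of g k 0 = 1"
| "fcoeff_of g k (Suc j) = - fcoeff_of g k j / g (Suc j) k"

context clifford begin

text \<open>If a null solution vanishes on x_0 = 0, so do its tangential derivatives, and the
  equation forces the normal derivative to vanish there too. That derivative is again a null
  solution, so the argument iterates and the Taylor series in x_0 is zero.\<close>

lemma ck_unique:
  assumes u: "X.nullsol u" and z: "\<And>x. u (0, x) = 0"
  shows "u x = 0"
proof -
  have step: "dirder (1, 0) f (0, x) = 0" if f: "X.nullsol f" and z: "\<And>x. f (0, x) = 0" for f x
  proof -
    have d0: "dirder (0, b) f (0, x) = 0" for b
    proof -
      have "((\<lambda>t::real. f (0, x + t *\<^sub>R b)) has_derivative (\<lambda>s. dirder (0, s *\<^sub>R b) f (0, x + 0 *\<^sub>R b))) (at 0)"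
        by (rule has_derivative_compose[OF _ C1_has_derivative[OF X.nullsol_C1[OF f]]]) (auto intro!: derivative_eq_intros)
      moreover have "((\<lambda>t::real. f (0, x + t *\<^sub>R b)) has_derivative (\<lambda>s. 0)) (at 0)"
        unfolding z by simp
      ultimately have "(\<lambda>s. dirder (0, s *\<^sub>R b) f (0, x + 0 *\<^sub>R b)) = (\<lambda>s. 0)" by (rule has_derivative_unique)
      from fun_cong[OF this, of 1] show ?thesis by simp
    qed
    have "dirder (1, 0) f (0, x) + (\<Sum>b\<in>Basis. c b (dirder (0, b) f (0, x))) = 0"
      using f unfolding X_nullsol_iff by blast
    then show ?thesis by (simp add: d0 c.zero_right)
  qed
  have m: "(dirder (1, 0) ^^ m) u (0, x) = 0" for m x
  proof (induction m arbitrary: x)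
    case (Suc m)
    then show ?case using step[OF X.nullsol_funpow[OF u]] by simp
  qed (use z in simp)
  obtain t y where x: "x = (t, y)" by (cases x)
  have pow: "(dirder (t, 0) ^^ m) u z = t ^ m *\<^sub>R (dirder (1, 0) ^^ m) u z" for m z
  proof (induction m arbitrary: z)
    case (Suc m)
    have "(dirder (t, 0) ^^ m) u = (\<lambda>z. t ^ m *\<^sub>R (dirder (1, 0) ^^ m) u z)" using Suc by auto
    then have "dirder (t, 0) ((dirder (t, 0) ^^ m) u) z = t ^ m *\<^sub>R dirder (t, 0) ((dirder (1, 0) ^^ m) u) z"
      by (simp add: dirder_scaleR_right[OF X.nullsol_C1[OF X.nullsol_funpow[OF u]]])
    moreover have "dirder (t *\<^sub>R (1, 0)) f z = t *\<^sub>R dirder (1, 0) f z" if "C1 f" for f :: "real \<times> 'v \<Rightarrow> 'b"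
      by (rule linear_scale[OF C1_linear[OF that]])
    then have "dirder (t, 0) f z = t *\<^sub>R dirder (1, 0) f z" if "C1 f" for f :: "real \<times> 'v \<Rightarrow> 'b"
      using that by simp
    ultimately show ?case using X.nullsol_C1[OF X.nullsol_funpow[OF u]] by (simp add: mult.commute)
  qed simp
  have "(\<lambda>m. (1 / fact m) *\<^sub>R (dirder (t, 0) ^^ m) u (0, y)) sums u ((0, y) + (t, 0))"
    by (rule X.nullsol_taylor[OF u])
  then show ?thesis by (simp add: pow m x sums_iff)
qed

text \<open>This is d! times the degree d Taylor part at the origin of the restriction to x_0 =
  0.\<close>

definition jet :: "nat \<Rightarrow> (real \<times> 'v \<Rightarrow> 'b) \<Rightarrow> 'v \<Rightarrow> 'b" where
  "jet d u x = (dirder (0, x) ^^ d) u 0"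

lemma dirder_0_basis:
  fixes u :: "real \<times> 'v \<Rightarrow> 'b"
  assumes "C1 u" shows "dirder (0, x) u z = (\<Sum>b\<in>Basis. (x \<bullet> b) *\<^sub>R dirder (0, b) u z)"
proof -
  have "linear (\<lambda>x. dirder (0, x) u z)"
  proof (rule linearI)
    fix x y :: 'v and r :: real
    show "dirder (0, x + y) u z = dirder (0, x) u z + dirder (0, y) u z"
      using linear_add[OF C1_linear[OF assms], of "(0, x)" "(0, y)"] by simp
    show "dirder (0, r *\<^sub>R x) u z = r *\<^sub>R dirder (0, x) u z"
      using linear_scale[OF C1_linear[OF assms], of r "(0, x)"] by simp
  qed
  note l = this
  have "dirder (0, x) u z = dirder (0, (\<Sum>b\<in>Basis. (x \<bullet> b) *\<^sub>R b)) u z" by (simp add: euclidean_representation)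
  also have "\<dots> = (\<Sum>b\<in>Basis. (x \<bullet> b) *\<^sub>R dirder (0, b) u z)"
    by (simp only: linear_sum[OF l] linear_scale[OF l])
  finally show ?thesis .
qed

lemma jet_dirder:
  assumes u: "X.nullsol u"
  shows "jet d (dirder (0, v) u) x = (\<Sum>b\<in>Basis. (v \<bullet> b) *\<^sub>R jet d (dirder (0, b) u) x)"
proof -
  have "dirder (0, v) u = (\<lambda>z. \<Sum>b\<in>Basis. (v \<bullet> b) *\<^sub>R dirder (0, b) u z)"
    by (intro ext dirder_0_basis[OF X.nullsol_C1[OF u]])
  then show ?thesis unfolding jet_def
    using X.funpow_dirder_lincomb[where A = "\<lambda>b a. (v \<bullet> b) *\<^sub>R a" and I = Basis and g = "\<lambda>b. dirder (0, b) u"]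
    by (simp add: bounded_linear_scaleR_right X.nullsol_dirder[OF u])
qed

lemma jet_Suc:
  assumes u: "X.nullsol u"
  shows "jet (Suc d) u x = (\<Sum>b\<in>Basis. (x \<bullet> b) *\<^sub>R jet d (dirder (0, b) u) x)"
  unfolding jet_dirder[OF u, symmetric] by (simp add: jet_def funpow_swap1)

text \<open>The claims are proved together, by the recursion \<open>jet_Suc\<close>: the product
  rule gives d copies of the right-hand side from the lower jets, where commuting derivatives are
  used, and one more from the linear factors.\<close>

lemma jet_homog:
  "X.nullsol u \<Longrightarrow> homog d (jet d u) \<and> (\<forall>v x. dirder v (jet d u) x = real d *\<^sub>R jet (d - 1) (dirder (0, v) u) x)"
proof (induction d arbitrary: u)
  case 0
  have "jet 0 u = (\<lambda>x. u 0)" by (auto simp: jet_def)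
  then show ?case by (simp add: homog_def C1_const dirder_const)
next
  case (Suc d)
  note u = Suc.prems
  have eq: "jet (Suc d) u = (\<lambda>x. \<Sum>b\<in>Basis. (x \<bullet> b) *\<^sub>R jet d (dirder (0, b) u) x)"
    by (intro ext jet_Suc[OF u])
  have IH: "homog d (jet d (dirder (0, b) u))" "dirder v (jet d (dirder (0, b) u)) x = real d *\<^sub>R jet (d - 1) (dirder (0, v) (dirder (0, b) u)) x" for b v x
    using Suc.IH[OF X.nullsol_dirder[OF u]] by auto
  have in1: "C1 (\<lambda>x. x \<bullet> b)" "dirder v (\<lambda>x. x \<bullet> b) x = v \<bullet> b" for b v x :: 'v
    using C1_linear_map[OF bounded_linear_inner_left] dirder_linear_map[OF bounded_linear_inner_left] by auto
  have C1b: "C1 (\<lambda>x. (x \<bullet> b) *\<^sub>R jet d (dirder (0, b) u) x)" for b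
    by (rule C1_bilinear[OF bounded_bilinear_scaleR in1(1) homog_C1[OF IH(1)]])
  have "C1 (jet (Suc d) u)" unfolding eq by (rule C1_sum[OF C1b])
  moreover have "jet (Suc d) u (t *\<^sub>R x) = t ^ Suc d *\<^sub>R jet (Suc d) u x" for t x
    unfolding eq using IH(1) by (simp add: homog_def scaleR_sum_right mult_ac)
  moreover have "dirder v (jet (Suc d) u) x = real (Suc d) *\<^sub>R jet d (dirder (0, v) u) x" for v x
  proof -
    have "dirder v (jet (Suc d) u) x = (\<Sum>b\<in>Basis. (x \<bullet> b) *\<^sub>R (real d *\<^sub>R jet (d - 1) (dirder (0, v) (dirder (0, b) u)) x)
        + (v \<bullet> b) *\<^sub>R jet d (dirder (0, b) u) x)"
      unfolding eq
      by (subst dirder_sum[OF C1b])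
         (simp add: dirder_bilinear[OF bounded_bilinear_scaleR in1(1) homog_C1[OF IH(1)]] in1(2) IH(2))
    also have "\<dots> = real d *\<^sub>R (\<Sum>b\<in>Basis. (x \<bullet> b) *\<^sub>R jet (d - 1) (dirder (0, b) (dirder (0, v) u)) x)
        + jet d (dirder (0, v) u) x"
      unfolding sum.distrib jet_dirder[OF u, of d v]
      by (simp add: scaleR_sum_right mult_ac X.dirder_commute[OF u, of "(0, v)"])
    also have "real d *\<^sub>R (\<Sum>b\<in>Basis. (x \<bullet> b) *\<^sub>R jet (d - 1) (dirder (0, b) (dirder (0, v) u)) x) = real d *\<^sub>R jet d (dirder (0, v) u) x"
      using jet_Suc[OF X.nullsol_dirder[OF u], of "d - 1" "(0, v)" x] by (cases d) auto
    finally show ?thesis by (simp add: algebra_simps)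
  qed
  ultimately show ?case by (simp add: homog_def)
qed

text \<open>Differentiating a jet lowers its degree and puts a tangential derivative on
  \<open>u\<close>. Multiplied by e_b and summed, these form the tangential Dirac operator, which on
  null solutions is minus the x_0-derivative.\<close>

lemma dirac_op_jet:
  assumes u: "X.nullsol u"
  shows "dirac_op (jet d u) x = - real d *\<^sub>R jet (d - 1) (dirder (1, 0) u) x"
proof -
  have eq: "dirder (1, 0) u = (\<lambda>z. \<Sum>b\<in>Basis. - c b (dirder (0, b) u z))"
  proof
    fix z
    have "dirder (1, 0) u z + (\<Sum>b\<in>Basis. c b (dirder (0, b) u z)) = 0"
      using u unfolding X_nullsol_iff by blast
    then show "dirder (1, 0) u z = (\<Sum>b\<in>Basis. - c b (dirder (0, b) u z))"
      by (simp add: sum_negf eq_neg_iff_add_eq_0)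
  qed
  have "jet (d - 1) (dirder (1, 0) u) x = (\<Sum>b\<in>Basis. - c b (jet (d - 1) (dirder (0, b) u) x))"
    unfolding eq jet_def
    using X.funpow_dirder_lincomb[where A = "\<lambda>b a. - c b a" and I = Basis and g = "\<lambda>b. dirder (0, b) u"]
    by (simp add: bounded_linear_minus c.bounded_linear_right X.nullsol_dirder[OF u])
  then show ?thesis using jet_homog[OF u, of d]
    by (simp add: dirac_op_def c.scaleR_right scaleR_sum_right sum_negf)
qed

text \<open>The H(s, d) of the overview. Sign and factorial are arranged so that D maps (s, d + 1)
  to (s + 1, d) with coefficient exactly 1.\<close>

definition taylor_part :: "(real \<times> 'v \<Rightarrow> 'b) \<Rightarrow> nat \<Rightarrow> nat \<Rightarrow> 'v \<Rightarrow> 'b" where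
  "taylor_part f s d x = ((- 1) ^ s / fact d) *\<^sub>R jet d ((dirder (1, 0) ^^ s) f) x"

lemma homog_taylor_part: "X.nullsol f \<Longrightarrow> homog d (taylor_part f s d)"
  using homog_scaleR[OF conjunct1[OF jet_homog[OF X.nullsol_funpow]]] by (simp add: taylor_part_def[abs_def])

lemma dirac_op_taylor_part:
  assumes f: "X.nullsol f"
  shows "dirac_op (taylor_part f s (Suc d)) x = taylor_part f (Suc s) d x" "dirac_op (taylor_part f s 0) x = 0"
proof -
  have *: "dirac_op (taylor_part f s d) x = ((- 1) ^ s / fact d) *\<^sub>R dirac_op (jet d ((dirder (1, 0) ^^ s) f)) x" for d
    unfolding taylor_part_def[abs_def] by (rule dirac_op_scaleR[OF homog_C1[OF conjunct1[OF jet_homog[OF X.nullsol_funpow[OF f]]]]])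
  show "dirac_op (taylor_part f s (Suc d)) x = taylor_part f (Suc s) d x"
  proof -
    have e: "(- 1) ^ s / fact (Suc d) * - real (Suc d) = (- 1) ^ Suc s / (fact d :: real)"
      by (simp only: fact_Suc) (simp del: of_nat_Suc)
    show ?thesis unfolding * dirac_op_jet[OF X.nullsol_funpow[OF f]] taylor_part_def scaleR_scaleR e by simp
  qed
  show "dirac_op (taylor_part f s 0) x = 0" unfolding * dirac_op_jet[OF X.nullsol_funpow[OF f]] by simp
qed

section \<open>Coefficients of the Fischer decomposition\<close>

definition pcoeff :: "nat \<Rightarrow> nat \<Rightarrow> real" where "pcoeff = pcoeff_of dcoeff"
definition fcoeff :: "nat \<Rightarrow> nat \<Rightarrow> real" where "fcoeff = fcoeff_of dcoeff"

lemma pcoeff_simps [simp]: "pcoeff k 0 = 1" "pcoeff k (Suc i) = (- 1) ^ i * pcoeff k i / dcoeff (Suc i) (k - Suc i)"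
  and fcoeff_simps [simp]: "fcoeff k 0 = 1" "fcoeff k (Suc j) = - fcoeff k j / dcoeff (Suc j) k"
  by (simp_all add: pcoeff_def fcoeff_def)

lemma pcoeff_Suc: "dcoeff (Suc i) (k - Suc i) * pcoeff k (Suc i) = (- 1) ^ i * pcoeff k i"
  using dcoeff_Suc_pos[of i "k - Suc i"] by simp

lemma fcoeff_Suc: "dcoeff (Suc j) k * fcoeff k (Suc j) = - fcoeff k j"
  using dcoeff_Suc_pos[of j k] by simp

lemma abs_pcoeff_le: "\<bar>pcoeff k i\<bar> \<le> 1 / fact i"
proof (induction i)
  case (Suc i)
  have "\<bar>pcoeff k (Suc i)\<bar> = \<bar>pcoeff k i\<bar> / dcoeff (Suc i) (k - Suc i)"
    using dcoeff_Suc_pos[of i "k - Suc i"] by (simp add: abs_mult)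
  also have "\<dots> \<le> (1 / fact i) / real (Suc i)"
    using dcoeff_ge[of "Suc i" "k - Suc i"] by (intro frac_le Suc) auto
  finally show ?case by (simp add: field_simps)
qed simp

lemma abs_fcoeff_le: "\<bar>fcoeff k j\<bar> \<le> 1 / fact j"
proof (induction j)
  case (Suc i)
  have "\<bar>fcoeff k (Suc i)\<bar> = \<bar>fcoeff k i\<bar> / dcoeff (Suc i) k"
    using dcoeff_Suc_pos[of i k] by (simp add: abs_mult)
  also have "\<dots> \<le> (1 / fact i) / real (Suc i)"
    using dcoeff_ge[of "Suc i" k] by (intro frac_le Suc) auto
  finally show ?case by (simp add: field_simps)
qed simp

text \<open>This is the formal content of the Fischer decomposition: the induction step is what \<open>D\<close> does to both of its sides.\<close>
lemma pcoeff_fcoeff_convolution: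
  "s \<le> m \<Longrightarrow> (\<Sum>j\<le>s. fcoeff (m - j) j * pcoeff (m - j) (s - j)) = (if s = 0 then 1 else 0)"
proof (induction s arbitrary: m)
  case (Suc s)
  \<comment> \<open>The sum is multiplied by \<open>dcoeff (Suc s) d\<close>, which
    \<open>dcoeff_add\<close> splits in two. One part lowers the index of \<open>pcoeff\<close> and
    yields a sign times the case s of m, the other lowers the index of \<open>fcoeff\<close> and
    yields minus the case s of m - 1. Both vanish for s > 0, and for s = 0 they are 1 and
    -1.\<close>
  define d where "d = m - Suc s"
  have m: "m = d + Suc s" using Suc.prems by (simp add: d_def)
  have "dcoeff (Suc s) d * (\<Sum>j\<le>Suc s. fcoeff (m - j) j * pcoeff (m - j) (Suc s - j)) =
     (\<Sum>j\<le>Suc s. ((- 1) ^ j * dcoeff (Suc s - j) d + dcoeff j (m - j)) * (fcoeff (m - j) j * pcoeff (m - j) (Suc s - j)))"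
    unfolding sum_distrib_left
  proof (intro sum.cong refl)
    fix j assume "j \<in> {..Suc s}"
    then show "dcoeff (Suc s) d * (fcoeff (m - j) j * pcoeff (m - j) (Suc s - j)) =
      ((- 1) ^ j * dcoeff (Suc s - j) d + dcoeff j (m - j)) * (fcoeff (m - j) j * pcoeff (m - j) (Suc s - j))"
      using dcoeff_add[of "Suc s - j" j d] m by simp
  qed
  also have "\<dots> = (\<Sum>j\<le>Suc s. (- 1) ^ j * fcoeff (m - j) j * (dcoeff (Suc s - j) d * pcoeff (m - j) (Suc s - j)))
     + (\<Sum>j\<le>Suc s. (dcoeff j (m - j) * fcoeff (m - j) j) * pcoeff (m - j) (Suc s - j))"
    by (simp only: sum.distrib[symmetric] algebra_simps)
  also have "(\<Sum>j\<le>Suc s. (- 1) ^ j * fcoeff (m - j) j * (dcoeff (Suc s - j) d * pcoeff (m - j) (Suc s - j))) =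
      (- 1) ^ s * (\<Sum>j\<le>s. fcoeff (m - j) j * pcoeff (m - j) (s - j))"
  proof -
    have *: "(- 1) ^ j * fcoeff (m - j) j * (dcoeff (Suc s - j) d * pcoeff (m - j) (Suc s - j)) = (- 1) ^ s * (fcoeff (m - j) j * pcoeff (m - j) (s - j))"
      if "j \<le> s" for j
    proof -
      have "dcoeff (Suc s - j) d * pcoeff (m - j) (Suc s - j) = (- 1) ^ (s - j) * pcoeff (m - j) (s - j)"
        using pcoeff_Suc[of "s - j" "m - j"] that m by (simp add: Suc_diff_le del: pcoeff_simps)
      moreover have "(- 1) ^ j * (- 1) ^ (s - j) = ((- 1) ^ s :: real)" using that by (simp flip: power_add)
      ultimately show ?thesis by (simp add: mult_ac)
    qed
    have "(\<Sum>j\<le>s. (- 1) ^ j * fcoeff (m - j) j * (dcoeff (Suc s - j) d * pcoeff (m - j) (Suc s - j))) =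
        (\<Sum>j\<le>s. (- 1) ^ s * (fcoeff (m - j) j * pcoeff (m - j) (s - j)))"
      by (intro sum.cong refl *) simp
    then show ?thesis unfolding sum.atMost_Suc sum_distrib_left by simp
  qed
  also have "(\<Sum>j\<le>Suc s. (dcoeff j (m - j) * fcoeff (m - j) j) * pcoeff (m - j) (Suc s - j)) =
      - (\<Sum>j\<le>s. fcoeff (m - 1 - j) j * pcoeff (m - 1 - j) (s - j))"
    unfolding sum.atMost_Suc_shift by (simp only: fcoeff_Suc) (simp add: sum_negf)
  finally have "dcoeff (Suc s) d * (\<Sum>j\<le>Suc s. fcoeff (m - j) j * pcoeff (m - j) (Suc s - j)) = 0"
    using Suc.IH[of m] Suc.IH[of "m - 1"] Suc.prems by (auto split: if_splits)
  then show ?case using dcoeff_Suc_pos[of s d] by (simp only: mult_eq_0_iff) simp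
qed simp

definition fischer :: "(real \<times> 'v \<Rightarrow> 'b) \<Rightarrow> nat \<Rightarrow> nat \<Rightarrow> 'v \<Rightarrow> 'b" where
  "fischer f k j x = fcoeff k j *\<^sub>R (\<Sum>i\<le>k. pcoeff k i *\<^sub>R (c x ^^ i) (taylor_part f (i + j) (k - i) x))"

lemma homog_fischer:
  assumes f: "X.nullsol f" shows "homog k (fischer f k j)"
proof -
  have "homog k (\<lambda>x. (c x ^^ i) (taylor_part f (i + j) (k - i) x))" if "i \<le> k" for i
    using homog_cpow[OF homog_taylor_part[OF f, of "k - i" "i + j"], of i] that by simp
  then show ?thesis unfolding fischer_def[abs_def] by (intro homog_scaleR homog_sum) auto
qed

lemma dirac_op_fischer:
  assumes f: "X.nullsol f" shows "dirac_op (fischer f k j) x = 0"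
proof -
  have h: "homog k (\<lambda>x. (c x ^^ i) (taylor_part f (i + j) (k - i) x))" if "i \<le> k" for i
    using homog_cpow[OF homog_taylor_part[OF f, of "k - i" "i + j"], of i] that by simp
  define t where "t i = ((- 1) ^ i * pcoeff k i) *\<^sub>R (c x ^^ i) (dirac_op (taylor_part f (i + j) (k - i)) x)" for i
  have "dirac_op (fischer f k j) x = fcoeff k j *\<^sub>R (\<Sum>i\<le>k. pcoeff k i *\<^sub>R dirac_op (\<lambda>x. (c x ^^ i) (taylor_part f (i + j) (k - i) x)) x)"
  proof -
    have C: "C1 (\<lambda>x. pcoeff k i *\<^sub>R (c x ^^ i) (taylor_part f (i + j) (k - i) x))" if "i \<in> {..k}" for i
      using that by (intro C1_scaleR_right homog_C1[OF h]) simp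
    have "dirac_op (fischer f k j) x = fcoeff k j *\<^sub>R dirac_op (\<lambda>x. \<Sum>i\<le>k. pcoeff k i *\<^sub>R (c x ^^ i) (taylor_part f (i + j) (k - i) x)) x"
      unfolding fischer_def[abs_def] by (rule dirac_op_scaleR[OF C1_sum[OF C]])
    also have "dirac_op (\<lambda>x. \<Sum>i\<le>k. pcoeff k i *\<^sub>R (c x ^^ i) (taylor_part f (i + j) (k - i) x)) x =
        (\<Sum>i\<le>k. dirac_op (\<lambda>x. pcoeff k i *\<^sub>R (c x ^^ i) (taylor_part f (i + j) (k - i) x)) x)"
      by (rule dirac_op_sum[OF C])
    also have "\<dots> = (\<Sum>i\<le>k. pcoeff k i *\<^sub>R dirac_op (\<lambda>x. (c x ^^ i) (taylor_part f (i + j) (k - i) x)) x)"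
      by (intro sum.cong refl dirac_op_scaleR homog_C1[OF h]) simp
    finally show ?thesis .
  qed
  also have "(\<Sum>i\<le>k. pcoeff k i *\<^sub>R dirac_op (\<lambda>x. (c x ^^ i) (taylor_part f (i + j) (k - i) x)) x) =
     (\<Sum>i\<le>k. t i) - (\<Sum>i\<le>k. (dcoeff i (k - i) * pcoeff k i) *\<^sub>R (c x ^^ (i - 1)) (taylor_part f (i + j) (k - i) x))"
    by (simp add: dirac_op_cpow[OF homog_taylor_part[OF f]] t_def sum_subtractf[symmetric] scaleR_diff_right mult_ac)
  also have "(\<Sum>i\<le>k. (dcoeff i (k - i) * pcoeff k i) *\<^sub>R (c x ^^ (i - 1)) (taylor_part f (i + j) (k - i) x)) = (\<Sum>i\<le>k. t i)"
  proof (cases k)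
    case 0
    then show ?thesis by (simp add: t_def dirac_op_taylor_part[OF f])
  next
    case (Suc k')
    have "(dcoeff (Suc i) (k - Suc i) * pcoeff k (Suc i)) *\<^sub>R (c x ^^ i) (taylor_part f (Suc i + j) (k - Suc i) x) = t i" if "i \<le> k'" for i
      unfolding pcoeff_Suc using that dirac_op_taylor_part(1)[OF f, of "i + j" "k' - i"] by (simp add: t_def Suc Suc_diff_le)
    moreover have "t (Suc k') = 0" by (simp add: t_def Suc dirac_op_taylor_part[OF f] cpow_linear del: funpow.simps)
    ultimately show ?thesis unfolding Suc by (subst sum.atMost_Suc_shift) (simp add: Suc del: pcoeff_simps)
  qed
  finally show ?thesis by simp
qed

text \<open>Inserting the definition gives multiples of x^(i + j) H(i + j, m - i - j). Collected
  along i + j = s, the coefficient is the convolution just computed, so only s = 0 survives.\<close>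

lemma fischer_decomposition:
  "(\<Sum>j\<le>m. (c x ^^ j) (fischer f (m - j) j x)) = taylor_part f 0 m x"
proof -
  define G where "G j i = (fcoeff (m - j) j * pcoeff (m - j) i) *\<^sub>R (c x ^^ (i + j)) (taylor_part f (i + j) (m - (i + j)) x)" for i j
  have "(\<Sum>j\<le>m. (c x ^^ j) (fischer f (m - j) j x)) = (\<Sum>j\<le>m. \<Sum>i\<le>m - j. G j i)"
    unfolding fischer_def G_def
    by (intro sum.cong refl)
       (simp add: cpow_linear cpow_sum scaleR_sum_right funpow_add[symmetric] add.commute flip: o_apply[of "c x ^^ _" "c x ^^ _"])
  also have "\<dots> = (\<Sum>s\<le>m. \<Sum>j\<le>s. G j (s - j))"
  proof -
    have "(\<Sum>j\<le>m. \<Sum>i\<le>m - j. G j i) = (\<Sum>(j, i)\<in>(SIGMA j:{..m}. {..m - j}). G j i)"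
      by (rule sum.Sigma) auto
    also have "\<dots> = (\<Sum>(s, j)\<in>(SIGMA s:{..m}. {..s}). G j (s - j))"
      by (rule sum.reindex_bij_witness[of _ "\<lambda>(s, j). (j, s - j)" "\<lambda>(j, i). (i + j, j)"]) auto
    also have "\<dots> = (\<Sum>s\<le>m. \<Sum>j\<le>s. G j (s - j))"
      by (rule sum.Sigma[symmetric]) auto
    finally show ?thesis .
  qed
  also have "\<dots> = (\<Sum>s\<le>m. (\<Sum>j\<le>s. fcoeff (m - j) j * pcoeff (m - j) (s - j)) *\<^sub>R (c x ^^ s) (taylor_part f s (m - s) x))"
    by (intro sum.cong refl) (simp add: G_def scaleR_sum_left)
  also have "\<dots> = (\<Sum>s\<le>m. (if s = 0 then 1 else 0) *\<^sub>R (c x ^^ s) (taylor_part f s (m - s) x))"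
    by (intro sum.cong refl) (simp only: pcoeff_fcoeff_convolution atMost_iff)
  also have "\<dots> = taylor_part f 0 m x" by (simp add: if_distrib if_distribR sum.delta cong: if_cong)
  finally show ?thesis .
qed

end

section \<open>Gegenbauer polynomials\<close>

text \<open>Being 0 for 2 i > m, it allows sums over the uniform range i <= m, and the truncated
  exponent \<open>m - 2 * i\<close> does no harm.\<close>

definition hgeg_coeff :: "real \<Rightarrow> nat \<Rightarrow> nat \<Rightarrow> real" where
  "hgeg_coeff \<nu> m i = (if 2 * i \<le> m then (-1) ^ i * pochhammer \<nu> (m - i) / (fact i * fact (m - 2 * i)) else 0)"

text \<open>With \<open>s = r\<^sup>2\<close> this is \<open>r\<^sup>m C\<^sub>m(p / r)\<close>, which makes sense at \<open>r = 0\<close> as well.\<close>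
definition hgeg :: "real \<Rightarrow> nat \<Rightarrow> real \<Rightarrow> real \<Rightarrow> real" where
  "hgeg \<nu> m p s = (\<Sum>i\<le>m. hgeg_coeff \<nu> m i * (2 * p) ^ (m - 2 * i) * s ^ i)"

text \<open>The polynomial of index \<open>m - e\<close>, with the convention that negative indices give 0.\<close>
definition hgeg_lag :: "real \<Rightarrow> nat \<Rightarrow> nat \<Rightarrow> real \<Rightarrow> real \<Rightarrow> real" where
  "hgeg_lag \<nu> e m p s = (if e \<le> m then hgeg \<nu> (m - e) p s else 0)"

lemma hgeg_lag_1: "2 * p * hgeg_lag \<nu> 1 m p s = (\<Sum>i\<le>m. (if m = 0 then 0 else hgeg_coeff \<nu> (m - 1) i) * (2 * p) ^ (m - 2 * i) * s ^ i)"
proof (cases m)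
  case (Suc m')
  have "2 * p * hgeg \<nu> m' p s = (\<Sum>i\<le>m'. hgeg_coeff \<nu> m' i * (2 * p) ^ (m - 2 * i) * s ^ i)"
    unfolding hgeg_def sum_distrib_left
  proof (intro sum.cong refl)
    fix i
    show "2 * p * (hgeg_coeff \<nu> m' i * (2 * p) ^ (m' - 2 * i) * s ^ i) = hgeg_coeff \<nu> m' i * (2 * p) ^ (m - 2 * i) * s ^ i"
    proof (cases "2 * i \<le> m'")
      case True
      then have "m - 2 * i = Suc (m' - 2 * i)" using Suc by simp
      then show ?thesis by simp
    qed (simp add: hgeg_coeff_def)
  qed
  moreover have "hgeg_coeff \<nu> m' (Suc m') = 0" by (simp add: hgeg_coeff_def)
  ultimately show ?thesis using Suc by (simp add: hgeg_lag_def)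
qed (simp add: hgeg_lag_def)

lemma hgeg_lag_2: "s * hgeg_lag \<nu> 2 m p s = (\<Sum>i\<le>m. (if i = 0 \<or> m < 2 then 0 else hgeg_coeff \<nu> (m - 2) (i - 1)) * (2 * p) ^ (m - 2 * i) * s ^ i)"
proof (cases "2 \<le> m")
  case True
  then obtain m' where m: "m = Suc (Suc m')" by (metis add_2_eq_Suc le_Suc_ex)
  have "(\<Sum>i\<le>m. (if i = 0 \<or> m < 2 then 0 else hgeg_coeff \<nu> (m - 2) (i - 1)) * (2 * p) ^ (m - 2 * i) * s ^ i) =
     (\<Sum>i\<le>Suc m'. hgeg_coeff \<nu> m' i * (2 * p) ^ (m - 2 * Suc i) * s ^ Suc i)"
    unfolding m by (subst sum.atMost_Suc_shift) simp
  also have "\<dots> = (\<Sum>i\<le>m'. hgeg_coeff \<nu> m' i * (2 * p) ^ (m' - 2 * i) * s ^ Suc i)"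
    by (simp add: m hgeg_coeff_def[of \<nu> m' "Suc m'"])
  also have "\<dots> = s * hgeg \<nu> m' p s" unfolding hgeg_def by (simp add: sum_distrib_left mult_ac)
  finally show ?thesis using m by (simp add: hgeg_lag_def)
qed (auto simp: hgeg_lag_def)

lemma hgeg_coeff_lower: "real (m - 2 * i) * hgeg_coeff \<nu> m i = (if m = 0 then 0 else \<nu> * hgeg_coeff (\<nu> + 1) (m - 1) i)"
proof (cases "2 * i < m")
  case True
  then obtain q where q: "m = Suc q + 2 * i" by (metis add.commute add_Suc_right less_imp_Suc_add)
  then have "m - i = Suc (q + i)" "m - 1 - i = q + i" "m - 2 * i = Suc q" "m - 1 - 2 * i = q" by auto
  then show ?thesis using True by (simp add: hgeg_coeff_def pochhammer_rec del: of_nat_Suc)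
qed (auto simp: hgeg_coeff_def)

lemma hgeg_coeff_lower2: "real i * hgeg_coeff \<nu> m i = (if i = 0 \<or> m < 2 then 0 else - \<nu> * hgeg_coeff (\<nu> + 1) (m - 2) (i - 1))"
proof (cases "i > 0 \<and> 2 * i \<le> m")
  case True
  then obtain i' where i: "i = Suc i'" using gr0_implies_Suc by blast
  with True obtain q where q: "m = q + 2 * i" by (metis add.commute le_Suc_ex)
  have "m - i = Suc (q + i')" "m - 2 - i' = q + i'" "m - 2 * i = q" "m - 2 - 2 * i' = q" using q i by auto
  then show ?thesis using True i by (simp add: hgeg_coeff_def pochhammer_rec del: of_nat_Suc)
qed (auto simp: hgeg_coeff_def)

lemma hgeg_coeff_contig:
  "(2 * \<nu> + real m) * hgeg_coeff \<nu> m i + (if m = 0 then 0 else \<nu> * hgeg_coeff (\<nu> + 1) (m - 1) i) = 2 * \<nu> * hgeg_coeff (\<nu> + 1) m i"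
proof (cases "2 * i \<le> m")
  case True
  then obtain q where q: "m = q + 2 * i" by (metis add.commute le_Suc_ex)
  then have m: "m - i = q + i" "m - 2 * i = q" by auto
  have "(2 * \<nu> + real m) * hgeg_coeff \<nu> m i + real (m - 2 * i) * hgeg_coeff \<nu> m i = 2 * ((\<nu> + real (q + i)) * hgeg_coeff \<nu> m i)"
    by (simp add: q m(2) algebra_simps)
  also have "(\<nu> + real (q + i)) * hgeg_coeff \<nu> m i = (- 1) ^ i * pochhammer \<nu> (Suc (q + i)) / (fact i * fact q)"
    using True by (simp add: hgeg_coeff_def m pochhammer_Suc)
  also have "\<dots> = \<nu> * hgeg_coeff (\<nu> + 1) m i"
    using True by (simp add: hgeg_coeff_def m pochhammer_rec)
  finally show ?thesis unfolding hgeg_coeff_lower by simp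
qed (auto simp: hgeg_coeff_def)

text \<open>A contiguous relation for Gegenbauer polynomials. On coefficients it compares the two
  ways of splitting a factor off a Pochhammer symbol, at its upper end or at its lower end.\<close>

lemma hgeg_contig:
  "(2 * \<nu> + real m) * hgeg \<nu> m p s + 2 * \<nu> * p * hgeg_lag (\<nu> + 1) 1 m p s = 2 * \<nu> * hgeg (\<nu> + 1) m p s"
proof -
  have "(2 * \<nu> + real m) * hgeg \<nu> m p s + \<nu> * (2 * p * hgeg_lag (\<nu> + 1) 1 m p s) =
     (\<Sum>i\<le>m. ((2 * \<nu> + real m) * hgeg_coeff \<nu> m i + (if m = 0 then 0 else \<nu> * hgeg_coeff (\<nu> + 1) (m - 1) i)) * (2 * p) ^ (m - 2 * i) * s ^ i)"
    unfolding hgeg_lag_1 hgeg_def sum_distrib_left sum.distrib[symmetric]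
    by (intro sum.cong refl) (simp add: algebra_simps)
  also have "\<dots> = 2 * \<nu> * hgeg (\<nu> + 1) m p s"
    unfolding hgeg_coeff_contig hgeg_def by (simp add: sum_distrib_left mult_ac)
  finally show ?thesis by (simp add: mult_ac)
qed

text \<open>Euler's identity for a polynomial of weight m, where p has weight 1 and s has weight 2;
  the lagged polynomials are its partial derivatives up to constants, as
  \<open>hgeg_has_derivative\<close> shows.\<close>

lemma hgeg_euler:
  "real m * hgeg \<nu> m p s + 2 * \<nu> * s * hgeg_lag (\<nu> + 1) 2 m p s = 2 * \<nu> * p * hgeg_lag (\<nu> + 1) 1 m p s"
proof -
  have "real m * hgeg \<nu> m p s + 2 * \<nu> * (s * hgeg_lag (\<nu> + 1) 2 m p s) =
     (\<Sum>i\<le>m. (real m * hgeg_coeff \<nu> m i - 2 * (if i = 0 \<or> m < 2 then 0 else - \<nu> * hgeg_coeff (\<nu> + 1) (m - 2) (i - 1))) * (2 * p) ^ (m - 2 * i) * s ^ i)"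
    unfolding hgeg_lag_2 hgeg_def sum_distrib_left sum.distrib[symmetric]
    by (intro sum.cong refl) (simp add: algebra_simps)
  also have "\<dots> = (\<Sum>i\<le>m. (real (m - 2 * i) * hgeg_coeff \<nu> m i) * (2 * p) ^ (m - 2 * i) * s ^ i)"
    unfolding hgeg_coeff_lower2[symmetric]
  proof (intro sum.cong refl)
    fix i
    have "real m * hgeg_coeff \<nu> m i - 2 * (real i * hgeg_coeff \<nu> m i) = real (m - 2 * i) * hgeg_coeff \<nu> m i"
    proof (cases "2 * i \<le> m")
      case True
      then have "real (m - 2 * i) = real m - 2 * real i" by (simp add: of_nat_diff)
      then show ?thesis by (simp only: left_diff_distrib mult.assoc)
    qed (simp add: hgeg_coeff_def)
    then show "(real m * hgeg_coeff \<nu> m i - 2 * (real i * hgeg_coeff \<nu> m i)) * (2 * p) ^ (m - 2 * i) * s ^ i =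
       (real (m - 2 * i) * hgeg_coeff \<nu> m i) * (2 * p) ^ (m - 2 * i) * s ^ i" by simp
  qed
  also have "\<dots> = \<nu> * (2 * p * hgeg_lag (\<nu> + 1) 1 m p s)"
    unfolding hgeg_coeff_lower hgeg_lag_1 sum_distrib_left by (intro sum.cong refl) simp
  finally show ?thesis by (simp add: mult_ac)
qed

lemma hgeg_has_derivative:
  assumes p: "(p has_derivative p') (at x)" and q: "(q has_derivative q') (at x)"
  shows "((\<lambda>x. hgeg \<nu> m (p x) (q x)) has_derivative
     (\<lambda>h. 2 * \<nu> * hgeg_lag (\<nu> + 1) 1 m (p x) (q x) * p' h - \<nu> * hgeg_lag (\<nu> + 1) 2 m (p x) (q x) * q' h)) (at x)"
proof -
  have 1: "2 * \<nu> * hgeg_lag (\<nu> + 1) 1 m P S = (\<Sum>i\<le>m. hgeg_coeff \<nu> m i * (real (m - 2 * i) * (2 * P) ^ (m - 2 * i - 1) * 2) * S ^ i)" for P S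
  proof (cases m)
    case (Suc m')
    have "(\<Sum>i\<le>m. hgeg_coeff \<nu> m i * (real (m - 2 * i) * (2 * P) ^ (m - 2 * i - 1) * 2) * S ^ i) =
       (\<Sum>i\<le>m. 2 * ((real (m - 2 * i) * hgeg_coeff \<nu> m i) * (2 * P) ^ (m - 2 * i - 1) * S ^ i))"
      by (intro sum.cong refl) simp
    also have "\<dots> = 2 * \<nu> * (\<Sum>i\<le>m'. hgeg_coeff (\<nu> + 1) m' i * (2 * P) ^ (m' - 2 * i) * S ^ i)"
      unfolding hgeg_coeff_lower using Suc by (simp add: hgeg_coeff_def[of _ m' "Suc m'"] sum_distrib_left mult_ac)
    finally show ?thesis using Suc by (simp add: hgeg_lag_def hgeg_def)
  qed (simp add: hgeg_lag_def)
  have 2: "- \<nu> * hgeg_lag (\<nu> + 1) 2 m P S = (\<Sum>i\<le>m. hgeg_coeff \<nu> m i * (2 * P) ^ (m - 2 * i) * (real i * S ^ (i - 1)))" for P S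
  proof -
    have "(\<Sum>i\<le>m. hgeg_coeff \<nu> m i * (2 * P) ^ (m - 2 * i) * (real i * S ^ (i - 1))) =
       (\<Sum>i\<le>m. (real i * hgeg_coeff \<nu> m i) * (2 * P) ^ (m - 2 * i) * S ^ (i - 1))"
      by (intro sum.cong refl) simp
    also have "\<dots> = - \<nu> * hgeg_lag (\<nu> + 1) 2 m P S"
    proof (cases "2 \<le> m")
      case True
      then obtain m' where m: "m = Suc (Suc m')" by (metis add_2_eq_Suc le_Suc_ex)
      show ?thesis unfolding hgeg_coeff_lower2 unfolding m
        by (subst sum.atMost_Suc_shift)
           (simp add: hgeg_coeff_def[of _ m' "Suc m'"] hgeg_lag_def hgeg_def sum_distrib_left sum_negf mult_ac)
    qed (auto simp: hgeg_coeff_lower2 hgeg_lag_def)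
    finally show ?thesis by simp
  qed
  have t: "((\<lambda>x. hgeg_coeff \<nu> m i * (2 * p x) ^ (m - 2 * i) * q x ^ i) has_derivative
      (\<lambda>h. hgeg_coeff \<nu> m i * (real (m - 2 * i) * (2 * p x) ^ (m - 2 * i - 1) * 2) * q x ^ i * p' h
         + hgeg_coeff \<nu> m i * (2 * p x) ^ (m - 2 * i) * (real i * q x ^ (i - 1)) * q' h)) (at x)" for i
    by (rule has_derivative_eq_rhs,
        rule has_derivative_mult[OF has_derivative_mult_right[OF has_derivative_power[OF has_derivative_mult_right[OF p]]]
          has_derivative_power[OF q]])
       (simp add: algebra_simps fun_eq_iff)
  show ?thesis
    unfolding hgeg_def
    by (rule has_derivative_eq_rhs, rule has_derivative_sum[OF t])
       (simp only: sum.distrib sum_distrib_right[symmetric] 1[symmetric] 2[symmetric], simp)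
qed

lemma continuous_on_hgeg [continuous_intros]:
  "continuous_on S p \<Longrightarrow> continuous_on S q \<Longrightarrow> continuous_on S (\<lambda>x. hgeg \<nu> m (p x) (q x))"
  unfolding hgeg_def by (intro continuous_intros)

lemma continuous_on_hgeg_lag [continuous_intros]:
  "continuous_on S p \<Longrightarrow> continuous_on S q \<Longrightarrow> continuous_on S (\<lambda>x. hgeg_lag \<nu> e m (p x) (q x))"
  unfolding hgeg_lag_def by (cases "e \<le> m") (auto intro!: continuous_on_hgeg)

lemma gegen_homogenized:
  assumes "r \<noteq> 0" shows "r ^ m * gegen \<nu> m (p / r) = hgeg \<nu> m p (r\<^sup>2)"
proof -
  have "hgeg \<nu> m p (r\<^sup>2) = (\<Sum>i = 0..m div 2. hgeg_coeff \<nu> m i * (2 * p) ^ (m - 2 * i) * (r\<^sup>2) ^ i)"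
    unfolding hgeg_def by (rule sum.mono_neutral_right) (auto simp: hgeg_coeff_def)
  also have "\<dots> = (\<Sum>i = 0..m div 2. r ^ m * ((-1) ^ i * pochhammer \<nu> (m - i) / (fact i * fact (m - 2 * i)) * (2 * (p / r)) ^ (m - 2 * i)))"
  proof (intro sum.cong refl)
    fix i assume "i \<in> {0..m div 2}"
    then have i: "2 * i \<le> m" by auto
    then have "r ^ m = r ^ (m - 2 * i) * (r\<^sup>2) ^ i" by (simp flip: power_mult power_add)
    then have "(2 * p) ^ (m - 2 * i) * (r\<^sup>2) ^ i = r ^ m * (2 * (p / r)) ^ (m - 2 * i)"
      using assms by (simp add: power_divide)
    then show "hgeg_coeff \<nu> m i * (2 * p) ^ (m - 2 * i) * (r\<^sup>2) ^ i =
       r ^ m * ((-1) ^ i * pochhammer \<nu> (m - i) / (fact i * fact (m - 2 * i)) * (2 * (p / r)) ^ (m - 2 * i))"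
      using i by (simp add: hgeg_coeff_def mult.assoc)
  qed
  also have "\<dots> = r ^ m * gegen \<nu> m (p / r)" unfolding gegen_def by (simp add: sum_distrib_left)
  finally show ?thesis by simp
qed

lemma hgeg_at_0:
  "hgeg \<nu> (2 * l) 0 s = (-1) ^ l * pochhammer \<nu> l / fact l * s ^ l" "hgeg \<nu> (Suc (2 * l)) 0 s = 0"
proof -
  have "hgeg \<nu> (2 * l) 0 s = (\<Sum>i\<in>{l}. hgeg_coeff \<nu> (2 * l) i * (2 * 0) ^ (2 * l - 2 * i) * s ^ i)"
    unfolding hgeg_def by (rule sum.mono_neutral_right) (auto simp: hgeg_coeff_def)
  then show "hgeg \<nu> (2 * l) 0 s = (-1) ^ l * pochhammer \<nu> l / fact l * s ^ l"
    by (simp add: hgeg_coeff_def mult_2)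
  show "hgeg \<nu> (Suc (2 * l)) 0 s = 0"
    unfolding hgeg_def by (rule sum.neutral) (auto simp: hgeg_coeff_def Suc_diff_le)
qed

lemma gegen_at_0: "gegen \<nu> (2 * l) 0 = (-1) ^ l * pochhammer \<nu> l / fact l"
  using gegen_homogenized[of 1 "2 * l" \<nu> 0] hgeg_at_0(1)[of \<nu> l 1] by simp

section \<open>Growth bounds for Gegenbauer polynomials and for \<open>mu\<close>\<close>

lemma pochhammer_nonneg': "0 \<le> x \<Longrightarrow> 0 \<le> pochhammer (x::real) q"
  by (induction q) (auto simp: pochhammer_Suc)

lemma pochhammer_mono: "0 \<le> x \<Longrightarrow> x \<le> y \<Longrightarrow> pochhammer x q \<le> pochhammer (y::real) q"
  by (induction q) (auto simp: pochhammer_Suc intro!: mult_mono pochhammer_nonneg')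

text \<open>(M)_q / q! is the binomial coefficient "M + q - 1 choose q", hence at most a power of
  2.\<close>

lemma pochhammer_le_pow2:
  assumes "0 \<le> \<nu>" "\<nu> \<le> real M" "0 < M"
  shows "pochhammer \<nu> q \<le> 2 ^ (M + q) * fact q"
proof -
  have "pochhammer (real M) q / fact q = real (M + q - 1) gchoose q"
    using assms(3) by (simp add: gbinomial_pochhammer' of_nat_diff)
  also have "\<dots> = real ((M + q - 1) choose q)" by (simp add: binomial_gbinomial)
  also have "\<dots> \<le> 2 ^ (M + q - 1)" using binomial_le_pow2[of "M + q - 1" q] by (metis of_nat_le_iff of_nat_numeral of_nat_power)
  also have "\<dots> \<le> 2 ^ (M + q)" by (rule power_increasing) auto
  finally have "pochhammer (real M) q \<le> 2 ^ (M + q) * fact q" by (simp add: field_simps)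
  then show ?thesis using pochhammer_mono[OF assms(1,2), of q] by linarith
qed

lemma abs_hgeg_coeff_le:
  assumes "0 \<le> \<nu>" "\<nu> \<le> real M" "0 < M"
  shows "\<bar>hgeg_coeff \<nu> m i\<bar> \<le> 2 ^ (M + 2 * m)"
proof (cases "2 * i \<le> m")
  case True
  have "\<bar>hgeg_coeff \<nu> m i\<bar> = pochhammer \<nu> (m - i) / (fact i * fact (m - 2 * i))"
    using True assms(1) by (simp add: hgeg_coeff_def abs_mult pochhammer_nonneg')
  also have "\<dots> \<le> 2 ^ (M + (m - i)) * fact (m - i) / (fact i * fact (m - 2 * i))"
    by (intro divide_right_mono pochhammer_le_pow2 assms) auto
  also have "\<dots> = 2 ^ (M + (m - i)) * real ((m - i) choose i)"
    using True by (simp add: binomial_fact mult_2)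
  also have "\<dots> \<le> 2 ^ (M + (m - i)) * 2 ^ (m - i)"
    using binomial_le_pow2[of "m - i" i] by (intro mult_left_mono) (metis of_nat_le_iff of_nat_numeral of_nat_power, simp)
  also have "\<dots> = 2 ^ (M + (m - i) + (m - i))" by (simp add: power_add)
  also have "\<dots> \<le> 2 ^ (M + 2 * m)" by (rule power_increasing) auto
  finally show ?thesis .
qed (simp add: hgeg_coeff_def)

lemma abs_hgeg_le:
  assumes \<nu>: "0 \<le> \<nu>" "\<nu> \<le> real M" "0 < M" and p: "\<bar>p\<bar> \<le> r" and s: "0 \<le> s" "s \<le> r\<^sup>2"
  shows "\<bar>hgeg \<nu> m p s\<bar> \<le> 2 ^ (M + 4 * m) * r ^ m"
proof -
  have r: "0 \<le> r" using p by linarith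
  have "\<bar>hgeg_coeff \<nu> m i * (2 * p) ^ (m - 2 * i) * s ^ i\<bar> \<le> 2 ^ (M + 2 * m) * (2 ^ m * r ^ m)" for i
  proof (cases "2 * i \<le> m")
    case True
    have "\<bar>(2 * p) ^ (m - 2 * i) * s ^ i\<bar> = 2 ^ (m - 2 * i) * (\<bar>p\<bar> ^ (m - 2 * i) * s ^ i)"
      using s by (simp add: abs_mult power_abs power_mult_distrib)
    also have "\<dots> \<le> 2 ^ m * (r ^ (m - 2 * i) * (r\<^sup>2) ^ i)"
      using p s r by (intro mult_mono power_mono power_increasing) auto
    also have "r ^ (m - 2 * i) * (r\<^sup>2) ^ i = r ^ m" using True by (simp flip: power_mult power_add)
    finally have "\<bar>(2 * p) ^ (m - 2 * i) * s ^ i\<bar> \<le> 2 ^ m * r ^ m" .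
    then have "\<bar>hgeg_coeff \<nu> m i\<bar> * \<bar>(2 * p) ^ (m - 2 * i) * s ^ i\<bar> \<le> 2 ^ (M + 2 * m) * (2 ^ m * r ^ m)"
      by (intro mult_mono abs_hgeg_coeff_le \<nu>) auto
    then show ?thesis by (simp add: abs_mult mult.assoc)
  qed (use r in \<open>simp add: hgeg_coeff_def\<close>)
  then have "\<bar>hgeg \<nu> m p s\<bar> \<le> (\<Sum>i\<le>m. 2 ^ (M + 2 * m) * (2 ^ m * r ^ m))"
    unfolding hgeg_def by (intro order_trans[OF sum_abs] sum_mono)
  also have "\<dots> = real (Suc m) * (2 ^ (M + 2 * m) * (2 ^ m * r ^ m))" by simp
  \<comment> \<open>The number m + 1 of terms is absorbed into 2^m. Together with 2 m from the
    coefficients and m from the powers of 2 p this makes the exponent 4 m.\<close>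
  also have "\<dots> \<le> 2 ^ m * (2 ^ (M + 2 * m) * (2 ^ m * r ^ m))"
  proof (intro mult_right_mono)
    show "real (Suc m) \<le> 2 ^ m" using of_nat_less_two_power[of m, where 'a = real] by (metis Suc_leI less_exp of_nat_le_iff of_nat_numeral of_nat_power)
  qed (use r in auto)
  also have "\<dots> = 2 ^ (M + 4 * m) * r ^ m" by (simp add: power_add power_mult mult_ac eval_nat_numeral)
  finally show ?thesis .
qed

text \<open>The extreme case is \<nu> = 1/2, where the quotient (1/2)_l / l! is the central binomial
  coefficient over 4^l. The bound keeps the Gegenbauer values at 0, the denominators of
  \<open>mu\<close>, from being too small.\<close>

lemma fact_le_pochhammer: "1 / 2 \<le> \<nu> \<Longrightarrow> fact l \<le> (2 * real l + 1) * pochhammer \<nu> l"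
proof (induction l)
  case (Suc l)
  have "fact (Suc l) = real (Suc l) * fact l" by simp
  also have "\<dots> \<le> real (Suc l) * ((2 * real l + 1) * pochhammer \<nu> l)"
    using Suc by (intro mult_left_mono) auto
  also have "\<dots> \<le> (2 * real (Suc l) + 1) * (pochhammer \<nu> l * (\<nu> + real l))"
  proof -
    have "real (Suc l) * (2 * real l + 1) \<le> (2 * real (Suc l) + 1) * (1/2 + real l)" by (simp add: field_simps)
    also have "\<dots> \<le> (2 * real (Suc l) + 1) * (\<nu> + real l)" using Suc by (intro mult_left_mono) auto
    finally have "real (Suc l) * (2 * real l + 1) * pochhammer \<nu> l \<le> (2 * real (Suc l) + 1) * (\<nu> + real l) * pochhammer \<nu> l"
      using Suc.prems by (intro mult_right_mono pochhammer_nonneg) auto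
    then show ?thesis by (simp only: mult_ac)
  qed
  finally show ?case by (simp add: pochhammer_Suc)
qed simp

lemma gegen_0_inverse_le:
  assumes "1 / 2 \<le> \<nu>" shows "1 / \<bar>gegen \<nu> (2 * l) 0\<bar> \<le> 2 * real l + 1"
proof -
  have "0 < pochhammer \<nu> l" using assms by (intro pochhammer_pos) auto
  then show ?thesis using fact_le_pochhammer[OF assms, of l]
    unfolding gegen_at_0 by (simp add: abs_mult field_simps)
qed

lemma abs_mu_le:
  assumes n: "2 \<le> n" shows "\<bar>mu n k j\<bar> \<le> 2 ^ (n + 2 * k + 2 * j)"
proof -
  define l where "l = j div 2"
  have l: "2 * real l \<le> real j" unfolding l_def by linarith
  have lt: "real i \<le> 2 ^ i" for i using of_nat_less_two_power[of i, where 'a = real] by simp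
  have pow: "real (n + 2 * k + j) * real (Suc j) \<le> 2 ^ (n + 2 * k + 2 * j)"
  proof -
    have "real (n + 2 * k + j) * real (Suc j) \<le> 2 ^ (n + 2 * k + j) * 2 ^ j"
      by (intro mult_mono lt) (auto, metis Suc_leI less_exp of_nat_Suc of_nat_le_iff of_nat_numeral of_nat_power)
    also have "\<dots> = 2 ^ (n + 2 * k + j + j)" by (simp only: power_add)
    also have "n + 2 * k + j + j = n + 2 * k + 2 * j" by simp
    finally show ?thesis .
  qed
  have nn: "1 \<le> real n + 2 * real k - 1" using n by simp
  show ?thesis
  proof (cases "even j")
    case True
    have "\<bar>mu n k j\<bar> = 1 / \<bar>gegen ((real n - 1) / 2 + real k) (2 * l) 0\<bar>"
      using True by (simp add: mu_def l_def Let_def)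
    also have "\<dots> \<le> 2 * real l + 1"
    proof (rule gegen_0_inverse_le)
      have "2 \<le> real n" "0 \<le> real k" using n by auto
      then show "1 / 2 \<le> (real n - 1) / 2 + real k" by (simp add: divide_simps)
    qed
    also have "\<dots> \<le> 1 * real (Suc j)" using l by simp
    also have "\<dots> \<le> real (n + 2 * k + j) * real (Suc j)" using n by (intro mult_right_mono) auto
    finally show ?thesis using pow by linarith
  next
    case False
    have "\<bar>mu n k j\<bar> = (real n + 2 * real k + 2 * real l) / (real n + 2 * real k - 1) * (1 / \<bar>gegen ((real n + 1) / 2 + real k) (2 * l) 0\<bar>)"
      using False nn by (simp add: mu_def l_def Let_def abs_mult)
    also have "\<dots> \<le> (real n + 2 * real k + 2 * real l) * (2 * real l + 1)"
    proof (intro mult_mono gegen_0_inverse_le)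
      show "(real n + 2 * real k + 2 * real l) / (real n + 2 * real k - 1) \<le> real n + 2 * real k + 2 * real l"
        using nn by (simp add: divide_le_eq mult_le_cancel_left1)
      show "1 / 2 \<le> (real n + 1) / 2 + real k" using n by (simp add: divide_simps)
    qed (use n in auto)
    also have "\<dots> \<le> real (n + 2 * k + j) * real (Suc j)" using l by (intro mult_mono) auto
    finally show ?thesis using pow by linarith
  qed
qed

section \<open>The monogenic factors\<close>

lemma
  fixes P :: "'v::euclidean_space \<Rightarrow> 'b::euclidean_space"
  assumes P: "C1 P"
  shows C1_snd: "C1 (\<lambda>x::real \<times> 'v. P (snd x))"
    and dirder_snd: "dirder h (\<lambda>x::real \<times> 'v. P (snd x)) x = dirder (snd h) P (snd x)"
proof -
  have d: "((\<lambda>x::real \<times> 'v. P (snd x)) has_derivative (\<lambda>h. dirder (snd h) P (snd x))) (at x)" for x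
    by (rule has_derivative_compose[OF has_derivative_snd[OF has_derivative_ident] C1_has_derivative[OF P]])
  show "C1 (\<lambda>x::real \<times> 'v. P (snd x))"
    by (rule C1I[OF d]) (intro C1_dirder_continuous[OF P] continuous_intros)
  show "dirder h (\<lambda>x::real \<times> 'v. P (snd x)) x = dirder (snd h) P (snd x)"
    by (rule dirder_eq[OF d])
qed

text \<open>The two expressions are the coefficients of P and of y P when the Cauchy-Riemann
  operator is applied to the factor with j = m + 1. Here p is x_0, s is |x|^2, and s - p^2 is |y|^2
  for the vector part y.\<close>

lemma gegenbauer_dirac_identities:
  fixes \<nu> p s :: real and m :: nat
  assumes "0 < \<nu>"
  defines "b \<equiv> 2 * \<nu> / (2 * \<nu> + real (Suc m))"
  defines "G \<equiv> hgeg (\<nu> + 1) m p s" and "G1 \<equiv> hgeg_lag (\<nu> + 1) 1 m p s"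
    and "H1 \<equiv> hgeg_lag (\<nu> + 2) 1 m p s" and "H2 \<equiv> hgeg_lag (\<nu> + 2) 2 m p s"
  shows "2 * \<nu> * G - 2 * \<nu> * p * G1 + 2 * b * (\<nu> + 1) * (s - p\<^sup>2) * H2 - (2 * \<nu> + 1) * b * G = 0"
    and "2 * b * (\<nu> + 1) * H1 - 2 * b * (\<nu> + 1) * p * H2 - 2 * \<nu> * G1 = 0"
proof -
  have pos: "2 * \<nu> + real (Suc m) > 0" using assms by simp
  \<comment> \<open>The relation that determines the ratio \<open>b\<close> of vector to scalar
    part. It makes both expressions multiples of b, which then vanish by Euler's identity and the
    contiguous relation.\<close>
  have b: "2 * \<nu> = b * (2 * \<nu> + real (Suc m))" unfolding b_def using pos by simp
  have 1: "real m * G + 2 * (\<nu> + 1) * s * H2 = 2 * (\<nu> + 1) * p * H1"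
    using hgeg_euler[of m "\<nu> + 1" p s] by (simp add: G_def H1_def H2_def add.commute add.left_commute)
  have 2: "(2 * \<nu> + real (Suc m)) * G1 + 2 * (\<nu> + 1) * p * H2 = 2 * (\<nu> + 1) * H1"
  proof (cases m)
    case 0
    then show ?thesis by (simp add: G1_def H1_def H2_def hgeg_lag_def)
  next
    case (Suc m')
    have l: "hgeg_lag q 1 m p s = hgeg q m' p s" "hgeg_lag q 2 m p s = hgeg_lag q 1 m' p s" for q
      by (simp_all add: hgeg_lag_def Suc)
    show ?thesis unfolding G1_def H1_def H2_def l
      using hgeg_contig[of "\<nu> + 1" m' p s] by (simp add: Suc algebra_simps)
  qed
  have "2 * \<nu> * G - 2 * \<nu> * p * G1 + 2 * b * (\<nu> + 1) * (s - p\<^sup>2) * H2 - (2 * \<nu> + 1) * b * G =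
      b * (real m * G + 2 * (\<nu> + 1) * s * H2 - p * ((2 * \<nu> + real (Suc m)) * G1 + 2 * (\<nu> + 1) * p * H2))"
    by (subst (1 2) b) (simp add: algebra_simps power2_eq_square)
  also have "\<dots> = 0" unfolding 1 2 by (simp add: algebra_simps)
  finally show "2 * \<nu> * G - 2 * \<nu> * p * G1 + 2 * b * (\<nu> + 1) * (s - p\<^sup>2) * H2 - (2 * \<nu> + 1) * b * G = 0" .
  have "2 * b * (\<nu> + 1) * H1 - 2 * b * (\<nu> + 1) * p * H2 - 2 * \<nu> * G1 = 
      b * (2 * (\<nu> + 1) * H1 - ((2 * \<nu> + real (Suc m)) * G1 + 2 * (\<nu> + 1) * p * H2))"
  proof -
    have "2 * \<nu> * G1 = b * ((2 * \<nu> + real (Suc m)) * G1)" by (subst b) simp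
    then show ?thesis by (simp only:) (simp only: algebra_simps)
  qed
  also have "\<dots> = 0" unfolding 2 by simp
  finally show "2 * b * (\<nu> + 1) * H1 - 2 * b * (\<nu> + 1) * p * H2 - 2 * \<nu> * G1 = 0" .
qed

lemma
  shows C1_hgeg: "C1 (\<lambda>x::real \<times> 'v::euclidean_space. hgeg \<nu> m (fst x) (x \<bullet> x))"
    and dirder_hgeg: "dirder h (\<lambda>x::real \<times> 'v. hgeg \<nu> m (fst x) (x \<bullet> x)) x =
      2 * \<nu> * hgeg_lag (\<nu> + 1) 1 m (fst x) (x \<bullet> x) * fst h + (- 2 * \<nu> * hgeg_lag (\<nu> + 1) 2 m (fst x) (x \<bullet> x)) * (x \<bullet> h)"
proof -
  have "((\<lambda>x. x \<bullet> x) has_derivative (\<lambda>h. 2 * (x \<bullet> h))) (at x)" for x :: "real \<times> 'v"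
    by (auto intro!: derivative_eq_intros simp: inner_commute)
  note d = hgeg_has_derivative[OF has_derivative_fst[OF has_derivative_ident] this, of \<nu> m]
  show "C1 (\<lambda>x::real \<times> 'v::euclidean_space. hgeg \<nu> m (fst x) (x \<bullet> x))"
    by (rule C1I[OF d]) (intro continuous_intros)
  show "dirder h (\<lambda>x::real \<times> 'v. hgeg \<nu> m (fst x) (x \<bullet> x)) x =
      2 * \<nu> * hgeg_lag (\<nu> + 1) 1 m (fst x) (x \<bullet> x) * fst h + (- 2 * \<nu> * hgeg_lag (\<nu> + 1) 2 m (fst x) (x \<bullet> x)) * (x \<bullet> h)"
    by (subst dirder_eq[OF d]) simp
qed

context clifford begin

definition gidx :: "nat \<Rightarrow> real" where "gidx k = (real DIM('v) - 1) / 2 + real k"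

text \<open>Left multiplication by \<open>X\<^sub>k\<^sup>(\<^sup>j\<^sup>)(x)\<close>, written without division by \<open>|x|\<close>.\<close>
definition Xact :: "nat \<Rightarrow> nat \<Rightarrow> real \<times> 'v \<Rightarrow> 'b \<Rightarrow> 'b" where
  "Xact k j x a = (if j = 0 then a else mu DIM('v) k j *\<^sub>R
     (hgeg (gidx k) j (fst x) (x \<bullet> x) *\<^sub>R a + (2 * gidx k / (2 * gidx k + real j) * hgeg (gidx k + 1) (j - 1) (fst x) (x \<bullet> x)) *\<^sub>R c (snd x) a))"

text \<open>The gradient of the scalar factor has a part along x_0 and a part along x; the
  tangential components of the latter add up to left multiplication by \<open>snd x\<close>.\<close>

lemma dirac_scalar_mult:
  assumes A: "C1 A" and P: "C1 P" and dA: "\<And>h. dirder h A x = \<alpha> * fst h + \<beta> * (x \<bullet> h)"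
  defines "F \<equiv> \<lambda>x. A x *\<^sub>R P (snd x)"
  shows "C1 F" "dirder (1, 0) F x + (\<Sum>b\<in>Basis. c b (dirder (0, b) F x)) =
     (\<alpha> + \<beta> * fst x) *\<^sub>R P (snd x) + A x *\<^sub>R dirac_op P (snd x) + \<beta> *\<^sub>R c (snd x) (P (snd x))"
proof -
  note P2 = C1_snd[OF P]
  have d: "dirder h F x = A x *\<^sub>R dirder (snd h) P (snd x) + (\<alpha> * fst h + \<beta> * (x \<bullet> h)) *\<^sub>R P (snd x)" for h
    unfolding F_def dirder_bilinear[OF bounded_bilinear_scaleR A P2] dirder_snd[OF P] dA ..
  show "C1 F" unfolding F_def by (rule C1_bilinear[OF bounded_bilinear_scaleR A P2])
  have 0: "dirder 0 P y = 0" for y using linear_0[OF C1_linear[OF P]] .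
  have "(\<Sum>b\<in>Basis. c b (dirder (0, b) F x)) = (\<Sum>b\<in>Basis. A x *\<^sub>R c b (dirder b P (snd x)) + \<beta> *\<^sub>R ((snd x \<bullet> b) *\<^sub>R c b (P (snd x))))"
    by (simp add: d inner_prod_def c.add_right c.scaleR_right)
  also have "\<dots> = A x *\<^sub>R dirac_op P (snd x) + \<beta> *\<^sub>R (\<Sum>b\<in>Basis. (snd x \<bullet> b) *\<^sub>R c b (P (snd x)))"
    by (simp add: sum.distrib dirac_op_def scaleR_sum_right)
  also have "(\<Sum>b\<in>Basis. (snd x \<bullet> b) *\<^sub>R c b (P (snd x))) = c (\<Sum>b\<in>Basis. (snd x \<bullet> b) *\<^sub>R b) (P (snd x))"
    by (simp only: c.sum_left c.scaleR_left)
  also have "\<dots> = c (snd x) (P (snd x))" by (simp add: euclidean_representation)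
  finally show "dirder (1, 0) F x + (\<Sum>b\<in>Basis. c b (dirder (0, b) F x)) =
     (\<alpha> + \<beta> * fst x) *\<^sub>R P (snd x) + A x *\<^sub>R dirac_op P (snd x) + \<beta> *\<^sub>R c (snd x) (P (snd x))"
    by (simp add: d inner_prod_def 0)
qed

text \<open>With Q = y P one has D Q a multiple of P, by \<open>dirac_op_c\<close>, and y Q = -|y|^2
  P. The operator therefore returns only scalar multiples of P and Q, whose coefficients are the two
  Gegenbauer identities.\<close>

lemma nullsol_Xact:
  assumes n: "2 \<le> DIM('v)" and P: "homog k P" "\<And>x. dirac_op P x = 0"
  shows "X.nullsol (\<lambda>x. Xact k j x (P (snd x)))"
proof (cases j)
  case 0
  have "dirder 0 P y = 0" for y using linear_0[OF C1_linear[OF homog_C1[OF P(1)]]] .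
  then show ?thesis using P(2) 0
    by (simp add: Xact_def X_nullsol_iff C1_snd[OF homog_C1[OF P(1)]] dirder_snd[OF homog_C1[OF P(1)]] dirac_op_def)
next
  case (Suc m)
  define \<nu> where "\<nu> = gidx k"
  have gidx: "0 < \<nu>" "2 * \<nu> + 1 = real DIM('v) + 2 * real k" using n by (auto simp: \<nu>_def gidx_def field_simps)
  define b where "b = 2 * \<nu> / (2 * \<nu> + real (Suc m))"
  define Q where "Q y = c y (P y)" for y
  note P1 = homog_C1[OF P(1)]
  have Q: "homog (Suc k) Q" unfolding Q_def by (rule homog_c[OF P(1)])
  have dirQ: "dirac_op Q y = - ((2 * \<nu> + 1) *\<^sub>R P y)" for y
    unfolding Q_def dirac_op_c[OF P(1)] P(2) gidx(2) by (simp add: c.zero_right)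
  have cQ: "c y (Q y) = - (y \<bullet> y) *\<^sub>R P y" for y unfolding Q_def by (rule csq)
  define A where "A x = hgeg \<nu> (Suc m) (fst x) (x \<bullet> x)" for x :: "real \<times> 'v"
  define B where "B x = b *\<^sub>R hgeg (\<nu> + 1) m (fst x) (x \<bullet> x)" for x :: "real \<times> 'v"
  define F where "F x = A x *\<^sub>R P (snd x) + B x *\<^sub>R Q (snd x)" for x
  have A: "C1 A" unfolding A_def by (rule C1_hgeg)
  have B: "C1 B" unfolding B_def by (rule C1_scaleR_right[OF C1_hgeg])
  have dA: "dirder h A x = (2 * \<nu> * hgeg_lag (\<nu> + 1) 1 (Suc m) (fst x) (x \<bullet> x)) * fst h + (- 2 * \<nu> * hgeg_lag (\<nu> + 1) 2 (Suc m) (fst x) (x \<bullet> x)) * (x \<bullet> h)" for h x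
    unfolding A_def by (rule dirder_hgeg)
  have dB: "dirder h B x = (2 * b * (\<nu> + 1) * hgeg_lag (\<nu> + 2) 1 m (fst x) (x \<bullet> x)) * fst h + (- 2 * b * (\<nu> + 1) * hgeg_lag (\<nu> + 2) 2 m (fst x) (x \<bullet> x)) * (x \<bullet> h)" for h x
    unfolding B_def dirder_scaleR_right[OF C1_hgeg] dirder_hgeg by (simp add: algebra_simps)
  have lag: "hgeg_lag (\<nu> + 1) 1 (Suc m) p s = hgeg (\<nu> + 1) m p s" "hgeg_lag (\<nu> + 1) 2 (Suc m) p s = hgeg_lag (\<nu> + 1) 1 m p s" for p s
    by (auto simp: hgeg_lag_def)
  have "X.nullsol F"
    unfolding X_nullsol_iff
  proof (intro conjI allI)
    show "C1 F" unfolding F_def by (intro C1_add dirac_scalar_mult(1)[OF A P1 dA] dirac_scalar_mult(1)[OF B homog_C1[OF Q] dB])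
    fix x :: "real \<times> 'v"
    define p where "p = fst x"
    define s where "s = x \<bullet> x"
    define y where "y = snd x"
    have yy: "y \<bullet> y = s - p\<^sup>2" unfolding y_def s_def p_def inner_prod_def power2_eq_square by simp
    have "dirder (1, 0) F x + (\<Sum>b\<in>Basis. c b (dirder (0, b) F x)) =
       ((2 * \<nu> * hgeg (\<nu> + 1) m p s + (- 2 * \<nu> * hgeg_lag (\<nu> + 1) 1 m p s) * p) *\<^sub>R P y + A x *\<^sub>R dirac_op P y + (- 2 * \<nu> * hgeg_lag (\<nu> + 1) 1 m p s) *\<^sub>R c y (P y)) +
       ((2 * b * (\<nu> + 1) * hgeg_lag (\<nu> + 2) 1 m p s + (- 2 * b * (\<nu> + 1) * hgeg_lag (\<nu> + 2) 2 m p s) * p) *\<^sub>R Q y + B x *\<^sub>R dirac_op Q y + (- 2 * b * (\<nu> + 1) * hgeg_lag (\<nu> + 2) 2 m p s) *\<^sub>R c y (Q y))"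
      unfolding F_def dirder_add[OF dirac_scalar_mult(1)[OF A P1 dA] dirac_scalar_mult(1)[OF B homog_C1[OF Q] dB]] p_def s_def y_def
        dirac_scalar_mult(2)[OF A P1 dA, unfolded lag, symmetric] dirac_scalar_mult(2)[OF B homog_C1[OF Q] dB, symmetric]
      by (simp add: c.add_right sum.distrib)
    also have "\<dots> = (2 * \<nu> * hgeg (\<nu> + 1) m p s - 2 * \<nu> * p * hgeg_lag (\<nu> + 1) 1 m p s + 2 * b * (\<nu> + 1) * (s - p\<^sup>2) * hgeg_lag (\<nu> + 2) 2 m p s
          - (2 * \<nu> + 1) * b * hgeg (\<nu> + 1) m p s) *\<^sub>R P y
       + (2 * b * (\<nu> + 1) * hgeg_lag (\<nu> + 2) 1 m p s - 2 * b * (\<nu> + 1) * p * hgeg_lag (\<nu> + 2) 2 m p s - 2 * \<nu> * hgeg_lag (\<nu> + 1) 1 m p s) *\<^sub>R Q y"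
    proof -
      have B': "B x = b * hgeg (\<nu> + 1) m p s" by (simp add: B_def p_def s_def)
      show ?thesis unfolding P(2) dirQ cQ yy B' Q_def[of y, symmetric]
        by (simp add: scaleR_add_left scaleR_diff_left left_diff_distrib distrib_left mult_ac)
           (simp add: algebra_simps)
    qed
    also have "\<dots> = 0"
      unfolding gegenbauer_dirac_identities[OF gidx(1), of m p s, folded b_def] by simp
    finally show "dirder (1, 0) F x + (\<Sum>b\<in>Basis. c b (dirder (0, b) F x)) = 0" .
  qed
  from X.nullsol_scaleR[OF this, of "mu DIM('v) k j"] show ?thesis
    by (simp add: Xact_def Suc F_def A_def B_def Q_def b_def \<nu>_def)
qed

lemma cpow_even: "(c y ^^ (2 * l)) a = ((- 1) ^ l * (y \<bullet> y) ^ l) *\<^sub>R a"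
  by (induction l) (auto simp: csq c.scaleR_right mult_ac)

text \<open>Gegenbauer polynomials of odd degree vanish at 0. So for j >= 1 only one summand
  survives, the scalar one for even j and the vector one for odd j, and \<open>mu\<close> cancels
  its value up to the sign of (-|y|^2)^l.\<close>

lemma Xact_restrict:
  assumes n: "2 \<le> DIM('v)" shows "Xact k j (0, y) a = (c y ^^ j) a"
proof -
  have gidx: "1 / 2 \<le> gidx k" using n by (simp add: gidx_def field_simps)
  have nz: "pochhammer (gidx k) l \<noteq> 0" "pochhammer (gidx k + 1) l \<noteq> 0" for l
    using pochhammer_pos[of "gidx k" l] pochhammer_pos[of "gidx k + 1" l] gidx by auto
  have e1: "(real DIM('v) - 1) / 2 + real k = gidx k" "(real DIM('v) + 1) / 2 + real k = gidx k + 1"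
     "real DIM('v) + 2 * real k - 1 = 2 * gidx k"
    by (simp_all add: gidx_def field_simps)
  show ?thesis
  proof (cases "even j")
    case True
    then obtain l where j: "j = 2 * l" by blast
    show ?thesis
    proof (cases l)
      case 0 then show ?thesis by (simp add: Xact_def j)
    next
      case (Suc l')
      have "hgeg (gidx k + 1) (j - 1) 0 s = 0" for s using hgeg_at_0(2)[of "gidx k + 1" l' s] by (simp add: j Suc)
      moreover have "mu DIM('v) k j = (- 1) ^ l / ((-1) ^ l * pochhammer (gidx k) l / fact l)"
        by (simp add: mu_def Let_def j e1 gegen_at_0)
      moreover have "j \<noteq> 0" by (simp add: j Suc)
      moreover have "hgeg (gidx k) j 0 s = (-1) ^ l * pochhammer (gidx k) l / fact l * s ^ l" for s
        unfolding j by (rule hgeg_at_0)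
      ultimately have "Xact k j (0, y) a = ((- 1) ^ l * (y \<bullet> y) ^ l) *\<^sub>R a"
        using nz(1)[of l] by (simp add: Xact_def inner_prod_def)
      then show ?thesis by (simp add: j cpow_even)
    qed
  next
    case False
    then obtain l where j: "j = Suc (2 * l)" by (metis oddE Suc_eq_plus1)
    have dn: "real DIM('v) + 2 * real k + 2 * real l = 2 * gidx k + real j" by (simp add: gidx_def j diff_divide_distrib)
    have m: "mu DIM('v) k j = (- 1) ^ l * (2 * gidx k + real j) / (2 * gidx k) / ((-1) ^ l * pochhammer (gidx k + 1) l / fact l)"
      unfolding mu_def using dn by (simp add: Let_def j e1 gegen_at_0)
    have "Xact k j (0, y) a = (mu DIM('v) k j * (2 * gidx k / (2 * gidx k + real j) * ((-1) ^ l * pochhammer (gidx k + 1) l / fact l * (y \<bullet> y) ^ l))) *\<^sub>R c y a"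
      by (simp add: Xact_def j inner_prod_def hgeg_at_0)
    also have "mu DIM('v) k j * (2 * gidx k / (2 * gidx k + real j) * ((-1) ^ l * pochhammer (gidx k + 1) l / fact l * (y \<bullet> y) ^ l)) = (- 1) ^ l * (y \<bullet> y) ^ l"
    proof -
      have alg: "sg * B / A / (sg * p / q) * (A / B * (sg * p / q * s)) = sg * s" 
        if "A \<noteq> 0" "B \<noteq> 0" "p \<noteq> 0" "q \<noteq> 0" "sg * sg = 1" for sg A B p q s :: real
        using that by (simp add: field_simps)
      have "2 * gidx k \<noteq> 0" "2 * gidx k + real j \<noteq> 0" "(- 1) ^ l * (- 1) ^ l = (1::real)" 
        using gidx by (auto simp flip: power_add mult_2)
      then show ?thesis unfolding m using nz(2)[of l] by (intro alg) auto
    qed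
    finally show ?thesis by (simp add: j cpow_even c.scaleR_right)
  qed
qed

lemma Xact_bound:
  assumes n: "2 \<le> DIM('v)"
  obtains C where "0 < C" "\<And>k j x a. norm (Xact k j x a) \<le> C * 64 ^ (j + k) * norm x ^ j * norm a"
proof -
  obtain K where K: "0 < K" "\<And>y a. norm (c y a) \<le> norm y * norm a * K" using c.pos_bounded by blast
  define N where "N = DIM('v)"
  define C where "C = 2 ^ (2 * N + 1) * (1 + K)"
  have bd: "norm (Xact k j x a) \<le> C * 64 ^ (j + k) * norm x ^ j * norm a" for k j x a
  proof (cases j)
    case 0
    have "1 * 1 \<le> C" unfolding C_def using K by (intro mult_mono one_le_power) auto
    then have "1 * 1 \<le> C * 64 ^ (j + k)" by (intro mult_mono one_le_power) auto
    from mult_right_mono[OF this norm_ge_zero[of a]] show ?thesis by (simp add: Xact_def 0)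
  next
    case (Suc m)
    define r where "r = norm x"
    \<comment> \<open>A common integer bound for the two Gegenbauer indices \<open>gidx k\<close>
      and \<open>gidx k + 1\<close>.\<close>
    define M where "M = N + k + 1"
    have r: "0 \<le> r" by (simp add: r_def)
    have gidx: "0 \<le> gidx k" "gidx k \<le> real M" "0 \<le> gidx k + 1" "gidx k + 1 \<le> real M" "0 < M"
      using n by (auto simp: gidx_def M_def N_def field_simps)
    have p: "\<bar>fst x\<bar> \<le> r" unfolding r_def by (metis norm_fst_le prod.collapse real_norm_def)
    have y: "norm (snd x) \<le> r" unfolding r_def by (metis norm_snd_le prod.collapse)
    have s: "0 \<le> x \<bullet> x" "x \<bullet> x \<le> r\<^sup>2" by (simp_all add: r_def power2_norm_eq_inner)
    have g1: "\<bar>hgeg (gidx k) j (fst x) (x \<bullet> x)\<bar> \<le> 2 ^ (M + 4 * j) * r ^ j" by (rule abs_hgeg_le) (use gidx p s in auto)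
    have g2: "\<bar>hgeg (gidx k + 1) (j - 1) (fst x) (x \<bullet> x)\<bar> \<le> 2 ^ (M + 4 * (j - 1)) * r ^ (j - 1)" by (rule abs_hgeg_le) (use gidx p s in auto)
    have q: "\<bar>2 * gidx k / (2 * gidx k + real j)\<bar> \<le> 1" using gidx Suc by (simp add: divide_le_eq)
    have t1: "norm (hgeg (gidx k) j (fst x) (x \<bullet> x) *\<^sub>R a) \<le> 2 ^ (M + 4 * j) * r ^ j * norm a"
      unfolding norm_scaleR by (intro mult_right_mono g1) auto
    have t2: "norm ((2 * gidx k / (2 * gidx k + real j) * hgeg (gidx k + 1) (j - 1) (fst x) (x \<bullet> x)) *\<^sub>R c (snd x) a)
        \<le> 2 ^ (M + 4 * j) * r ^ j * norm a * K"
    proof -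
      have "norm ((2 * gidx k / (2 * gidx k + real j) * hgeg (gidx k + 1) (j - 1) (fst x) (x \<bullet> x)) *\<^sub>R c (snd x) a)
          \<le> 1 * (2 ^ (M + 4 * (j - 1)) * r ^ (j - 1)) * (norm (snd x) * norm a * K)"
        unfolding norm_scaleR abs_mult using r by (intro mult_mono q g2 K) auto
      also have "\<dots> \<le> 1 * (2 ^ (M + 4 * j) * r ^ (j - 1)) * (r * norm a * K)"
        using r K y by (intro mult_mono power_increasing order_refl zero_le_power) auto
      also have "\<dots> = 2 ^ (M + 4 * j) * r ^ j * norm a * K" by (simp add: Suc)
      finally show ?thesis .
    qed
    have "norm (Xact k j x a) \<le> 2 ^ (N + 2 * k + 2 * j) * (2 ^ (M + 4 * j) * r ^ j * norm a + 2 ^ (M + 4 * j) * r ^ j * norm a * K)"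
    proof -
      have eq: "norm (Xact k j x a) = \<bar>mu DIM('v) k j\<bar> * norm (hgeg (gidx k) j (fst x) (x \<bullet> x) *\<^sub>R a +
          (2 * gidx k / (2 * gidx k + real j) * hgeg (gidx k + 1) (j - 1) (fst x) (x \<bullet> x)) *\<^sub>R c (snd x) a)"
        using Suc unfolding Xact_def by simp
      show ?thesis unfolding eq N_def
        by (intro mult_mono abs_mu_le[OF n] order_trans[OF norm_triangle_ineq] add_mono t1 t2) auto
    qed
    also have "\<dots> = 2 ^ (N + 2 * k + 2 * j + (M + 4 * j)) * (1 + K) * r ^ j * norm a"
    proof -
      have "u * (v * R * A + v * R * A * K) = (u * v) * (1 + K) * R * A" for u v R A :: real
        by (simp add: algebra_simps)
      then show ?thesis unfolding power_add[of 2 "N + 2 * k + 2 * j" "M + 4 * j"] .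
    qed
    also have "\<dots> \<le> (2 ^ (2 * N + 1) * 64 ^ (j + k)) * (1 + K) * r ^ j * norm a"
    proof -
      \<comment> \<open>N + 2 k + 2 j comes from \<open>mu\<close> and M + 4 j from the Gegenbauer
        factors; 64 = 2^6 dominates the resulting 6 j + 3 k.\<close>
      have "(2::real) ^ (N + 2 * k + 2 * j + (M + 4 * j)) \<le> 2 ^ (2 * N + 1 + 6 * (j + k))"
        by (rule power_increasing) (auto simp: M_def)
      also have "\<dots> = 2 ^ (2 * N + 1) * 64 ^ (j + k)" by (simp add: power_add power_mult)
      finally show ?thesis using K r by (intro mult_right_mono) auto
    qed
    finally show ?thesis by (simp add: C_def r_def mult_ac)
  qed
  moreover have "0 < C" using K by (simp add: C_def)
  ultimately show ?thesis using that by blast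
qed

end

section \<open>Expansions over a Clifford module\<close>

lemma bij_diag: "bij_betw (\<lambda>(m, j). (j, m - j)) (SIGMA m:(UNIV::nat set). {..m}) UNIV"
  by (rule bij_betw_byWitness[where f' = "\<lambda>(j, k). (j + k, j)"]) auto

lemma has_sum_diag:
  fixes g :: "nat \<times> nat \<Rightarrow> 'b::euclidean_space"
  assumes "(g has_sum S) UNIV"
  shows "(\<lambda>m. \<Sum>j\<le>m. g (j, m - j)) sums S"
proof -
  have "((\<lambda>x. g ((\<lambda>(m, j). (j, m - j)) x)) has_sum S) (SIGMA m:UNIV. {..m})"
    using has_sum_reindex_bij_betw[OF bij_diag, of g S] assms by simp
  then have "((\<lambda>m. \<Sum>j\<le>m. g (j, m - j)) has_sum S) UNIV"
    by (rule has_sum_SigmaD) auto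
  then show ?thesis by (rule has_sum_imp_sums)
qed

text \<open>A diagonal j + k = m has m + 1 terms; relaxing the rate from 1/4 to 1/2 pays for
  them.\<close>

lemma Suc_pow4_le: "real (Suc m) * (1/4) ^ m \<le> (1/2) ^ m"
proof -
  have "real (Suc m) \<le> 2 ^ m" by (metis Suc_leI less_exp of_nat_le_iff of_nat_numeral of_nat_power)
  then have "real (Suc m) * (1/4) ^ m \<le> 2 ^ m * (1/4) ^ m" by (intro mult_right_mono) auto
  also have "\<dots> = (1/2) ^ m" by (simp flip: power_mult_distrib)
  finally show ?thesis .
qed

lemma diag_bound:
  fixes g :: "nat \<times> nat \<Rightarrow> 'b::euclidean_space"
  assumes "\<And>j k. N \<le> j + k \<Longrightarrow> norm (g (j, k)) \<le> C * (1/4) ^ (j + k)" "0 \<le> C" "N \<le> m"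
  shows "(\<Sum>j\<le>m. norm (g (j, m - j))) \<le> C * (1/2) ^ m"
proof -
  have "norm (g (j, m - j)) \<le> C * (1/4) ^ m" if "j \<le> m" for j using assms(1)[of j "m - j"] assms(3) that by simp
  then have "(\<Sum>j\<le>m. norm (g (j, m - j))) \<le> (\<Sum>j\<le>m. C * (1/4) ^ m)" by (intro sum_mono) auto
  also have "\<dots> = C * (real (Suc m) * (1/4) ^ m)" by simp
  also have "\<dots> \<le> C * (1/2) ^ m" using assms(2) by (intro mult_left_mono Suc_pow4_le)
  finally show ?thesis .
qed

lemma has_sum_geometric_bound:
  fixes g :: "nat \<times> nat \<Rightarrow> 'b::euclidean_space"
  assumes g: "\<And>j k. N \<le> j + k \<Longrightarrow> norm (g (j, k)) \<le> C * (1/4) ^ (j + k)" and C: "0 \<le> C"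
  shows "(g has_sum (\<Sum>m. \<Sum>j\<le>m. g (j, m - j))) UNIV"
proof -
  have "(\<lambda>x. norm (g ((\<lambda>(m, j). (j, m - j)) x))) summable_on (SIGMA m:UNIV. {..m})"
  proof (rule Infinite_Sum.abs_summable_on_Sigma_iff[THEN iffD2], intro conjI ballI)
    have "summable (\<lambda>m. norm (\<Sum>j\<le>m. norm (g (j, m - j))))"
    proof (rule summable_comparison_test_ev)
      show "\<forall>\<^sub>F m in sequentially. norm (norm (\<Sum>j\<le>m. norm (g (j, m - j)))) \<le> C * (1/2) ^ m"
        using eventually_ge_at_top[of N]
      proof eventually_elim
        case (elim m)
        have "(\<Sum>j\<le>m. norm (g (j, m - j))) \<le> C * (1/2) ^ m" by (rule diag_bound[OF g C elim])
        then show ?case by (simp add: sum_nonneg)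
      qed
    qed (auto intro!: summable_mult)
    then show "(\<lambda>m. norm (\<Sum>\<^sub>\<infinity>j\<in>{..m}. norm (g ((\<lambda>(m, j). (j, m - j)) (m, j))))) summable_on UNIV"
      by (intro norm_summable_imp_summable_on) simp
  qed auto
  then have "(\<lambda>x. norm (g x)) summable_on UNIV"
    using summable_on_reindex_bij_betw[OF bij_diag, of "\<lambda>x. norm (g x)"] by simp
  then have "g summable_on UNIV" by (rule abs_summable_summable)
  then obtain S where S: "(g has_sum S) UNIV" by (auto simp: summable_on_def)
  then show ?thesis using has_sum_diag[OF S] by (simp add: sums_iff)
qed

text \<open>Once the lower coefficients vanish, dividing by x^n and letting x tend to 0 isolates the
  n-th one.\<close>

lemma powser_zero_coeff:
  fixes a :: "nat \<Rightarrow> real"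
  assumes "\<And>x. (\<lambda>n. a n * x ^ n) sums 0"
  shows "a n = 0"
proof (induction n rule: less_induct)
  case (less n)
  have "(\<lambda>m. a (m + n) * x ^ m) sums 0" if "x \<noteq> 0" for x
  proof -
    have "(\<lambda>m. a (m + n) * x ^ (m + n)) sums 0"
      using sums_iff_shift[of "\<lambda>n. a n * x ^ n" n 0] assms[of x] less by simp
    then have "(\<lambda>m. a (m + n) * x ^ (m + n) * (1 / x ^ n)) sums (0 * (1 / x ^ n))" by (rule sums_mult2)
    then show ?thesis using that by (simp add: power_add)
  qed
  then have "((\<lambda>x. 0) \<longlongrightarrow> a (0 + n)) (at (0::real))"
    by (intro powser_limit_0_strong[where s = 1 and a = "\<lambda>m. a (m + n)"]) auto
  from LIM_unique[OF this tendsto_const] show ?case by simp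
qed

context clifford begin

definition sph_mono :: "nat \<Rightarrow> ('v \<Rightarrow> 'b) \<Rightarrow> bool" where
  "sph_mono k P \<longleftrightarrow> homog k P \<and> (\<forall>x. dirac_op P x = 0)"

text \<open>The limsup condition with the root unfolded, for values on the unit sphere. Since every
  e > 0 is allowed, geometric factors C^(j + k) do not affect it, which makes it independent of the
  choice of norm.\<close>

definition decay :: "(nat \<Rightarrow> nat \<Rightarrow> 'v \<Rightarrow> 'b) \<Rightarrow> bool" where
  "decay P \<longleftrightarrow> (\<forall>e>0. \<exists>N. \<forall>j k x. N \<le> j + k \<longrightarrow> norm x = 1 \<longrightarrow> norm (P k j x) \<le> e ^ (j + k))"

lemma homog_norm_le:
  assumes P: "homog k P" and M: "\<And>u. norm u = 1 \<Longrightarrow> norm (P u) \<le> M"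
  shows "norm (P y) \<le> norm y ^ k * M"
proof -
  \<comment> \<open>For y = 0 any unit vector serves, which also covers k = 0 with the convention
    0^0 = 1.\<close>
  obtain u :: 'v where u: "norm u = 1" "y = norm y *\<^sub>R u"
  proof (cases "y = 0")
    case True
    obtain b :: 'v where "b \<in> Basis" using nonempty_Basis by blast
    then show ?thesis using that[of b] True by simp
  next
    case False
    then show ?thesis using that[of "y /\<^sub>R norm y"] by simp
  qed
  have "P y = P (norm y *\<^sub>R u)" using u(2) by simp
  also have "\<dots> = norm y ^ k *\<^sub>R P u" using P by (simp add: homog_def)
  finally have "norm (P y) = norm y ^ k * norm (P u)" by simp
  then show ?thesis using M[OF u(1)] by (simp add: mult_left_mono)
qed

lemma Xact_term_bound:
  assumes n: "2 \<le> DIM('v)" and P: "\<And>k j. sph_mono k (P k j)" and d: "decay P"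
  obtains C N where "0 \<le> C" "\<And>j k x. N \<le> j + k \<Longrightarrow> x \<in> cball 0 r \<Longrightarrow> norm (Xact k j x (P k j (snd x))) \<le> C * (1/4) ^ (j + k)"
proof -
  obtain C where C: "0 < C" "\<And>k j x a. norm (Xact k j x a) \<le> C * 64 ^ (j + k) * norm x ^ j * norm a"
    using Xact_bound[OF n] by blast
  define R where "R = max r 1"
  \<comment> \<open>R^j bounds |x|^j and R^k comes from the homogeneity of P, so the terms decay
    with ratio \<open>64 * R * e\<close>, which this choice makes 1/4.\<close>
  define e where "e = 1 / (256 * R)"
  have R: "R \<ge> 1" "R \<ge> r" by (auto simp: R_def)
  then have e: "e > 0" by (simp add: e_def)
  obtain N where N: "\<And>j k x. N \<le> j + k \<Longrightarrow> norm x = 1 \<Longrightarrow> norm (P k j x) \<le> e ^ (j + k)"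
    using d e unfolding decay_def by blast
  have "norm (Xact k j x (P k j (snd x))) \<le> C * (1/4) ^ (j + k)" if "N \<le> j + k" "x \<in> cball 0 r" for j k x
  proof -
    have xr: "norm x \<le> R" using that R by simp
    have "norm (snd x) \<le> R" using xr norm_snd_le[of "snd x" "fst x"] by simp
    have "norm (P k j (snd x)) \<le> norm (snd x) ^ k * e ^ (j + k)"
      using P[of k j] by (intro homog_norm_le N that) (auto simp: sph_mono_def)
    also have "\<dots> \<le> R ^ k * e ^ (j + k)"
      using e \<open>norm (snd x) \<le> R\<close> by (intro mult_right_mono power_mono) auto
    finally have p: "norm (P k j (snd x)) \<le> R ^ k * e ^ (j + k)" .
    have "norm (Xact k j x (P k j (snd x))) \<le> C * 64 ^ (j + k) * norm x ^ j * norm (P k j (snd x))" by (rule C)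
    also have "\<dots> \<le> C * 64 ^ (j + k) * R ^ j * (R ^ k * e ^ (j + k))"
      using C(1) R xr p by (intro mult_mono power_mono order_refl) auto
    also have "\<dots> = C * (64 ^ (j + k) * R ^ (j + k) * e ^ (j + k))" by (simp add: power_add)
    also have "\<dots> = C * (64 * R * e) ^ (j + k)" by (simp only: power_mult_distrib)
    also have "64 * R * e = 1/4" using R by (simp add: e_def)
    finally show ?thesis .
  qed
  then show ?thesis using that[of C N] C(1) by force
qed

lemma expansion_converges:
  assumes n: "2 \<le> DIM('v)" and P: "\<And>k j. sph_mono k (P k j)" and d: "decay P"
  shows "\<exists>h. X.nullsol h \<and> (\<forall>x. ((\<lambda>(j, k). Xact k j x (P k j (snd x))) has_sum h x) UNIV)"
proof -
  define D where "D m x = (\<Sum>j\<le>m. Xact (m - j) j x (P (m - j) j (snd x)))" for m x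
  define h where "h x = (\<Sum>m. D m x)" for x
  have "X.nullsol h"
  proof (rule X.nullsol_uniform_limit)
    show "X.nullsol (\<lambda>x. \<Sum>m<i. D m x)" for i
      unfolding D_def using P by (intro X.nullsol_sum nullsol_Xact n) (auto simp: sph_mono_def)
    show "uniform_limit (cball 0 r) (\<lambda>i x. \<Sum>m<i. D m x) h sequentially" for r
    proof -
      obtain C N where C: "0 \<le> C" "\<And>j k x. N \<le> j + k \<Longrightarrow> x \<in> cball 0 r \<Longrightarrow> norm (Xact k j x (P k j (snd x))) \<le> C * (1/4) ^ (j + k)"
        using Xact_term_bound[OF n P d, of r] by blast
      show ?thesis unfolding h_def
      proof (rule Weierstrass_m_test_ev[where M = "\<lambda>m. C * (1/2) ^ m"])
        show "\<forall>\<^sub>F m in sequentially. \<forall>x\<in>cball 0 r. norm (D m x) \<le> C * (1/2) ^ m"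
          using eventually_ge_at_top[of N]
        proof eventually_elim
          case (elim m)
          show ?case
          proof
            fix x :: "real \<times> 'v" assume x: "x \<in> cball 0 r"
            have "norm (D m x) \<le> (\<Sum>j\<le>m. norm (Xact (m - j) j x (P (m - j) j (snd x))))"
              unfolding D_def by (rule norm_sum)
            also have "\<dots> \<le> C * (1/2) ^ m"
              using diag_bound[of N "\<lambda>(j, k). Xact k j x (P k j (snd x))" C m] C x elim by simp
            finally show "norm (D m x) \<le> C * (1/2) ^ m" .
          qed
        qed
      qed (auto intro!: summable_mult)
    qed
  qed
  moreover have "((\<lambda>(j, k). Xact k j x (P k j (snd x))) has_sum h x) UNIV" for x
  proof -
    obtain C N where C: "0 \<le> C" "\<And>j k z. N \<le> j + k \<Longrightarrow> z \<in> cball 0 (norm x) \<Longrightarrow> norm (Xact k j z (P k j (snd z))) \<le> C * (1/4) ^ (j + k)"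
      using Xact_term_bound[OF n P d, of "norm x"] by blast
    have "((\<lambda>(j, k). Xact k j x (P k j (snd x))) has_sum (\<Sum>m. \<Sum>j\<le>m. (\<lambda>(j, k). Xact k j x (P k j (snd x))) (j, m - j))) UNIV"
      by (rule has_sum_geometric_bound[of N _ C]) (use C in auto)
    then show ?thesis by (simp add: h_def D_def)
  qed
  ultimately show ?thesis by blast
qed

lemma expansion_unique:
  assumes n: "2 \<le> DIM('v)" and P: "\<And>k j. sph_mono k (P k j)" and Q: "\<And>k j. sph_mono k (Q k j)"
    and sP: "\<And>x. ((\<lambda>(j, k). Xact k j x (P k j (snd x))) has_sum f x) UNIV"
    and sQ: "\<And>x. ((\<lambda>(j, k). Xact k j x (Q k j (snd x))) has_sum f x) UNIV"
  shows "P = Q"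
proof -
  define T where "T k j x = P k j x + (- 1) *\<^sub>R Q k j x" for k j x
  have homP: "homog k (P k j)" "homog k (Q k j)" "dirac_op (P k j) x = 0" "dirac_op (Q k j) x = 0" for k j x using P Q by (auto simp: sph_mono_def)
  have homT: "homog k (T k j)" for k j
  proof -
    have "C1 (T k j)"
      unfolding T_def by (rule C1_add[OF homog_C1[OF homP(1)] C1_scaleR_right[OF homog_C1[OF homP(2)]]])
    then show ?thesis using homP(1,2)[of k j] by (simp add: homog_def T_def scaleR_diff_right)
  qed
  have dirT: "dirac_op (T k j) x = 0" for k j x
  proof -
    have "dirder b (T k j) x = dirder b (P k j) x + (- 1) *\<^sub>R dirder b (Q k j) x" for b
      unfolding T_def dirder_add[OF homog_C1[OF homP(1)] C1_scaleR_right[OF homog_C1[OF homP(2)]]]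
        dirder_scaleR_right[OF homog_C1[OF homP(2)]] ..
    then show ?thesis using homP(3,4)[of k j x] by (simp add: dirac_op_def c.diff_right sum_subtractf)
  qed
  have sums0: "(\<lambda>m. \<Sum>j\<le>m. (c y ^^ j) (T (m - j) j y)) sums 0" for y
  proof -
    have s1: "(\<lambda>m. \<Sum>j\<le>m. (c y ^^ j) (P (m - j) j y)) sums f (0, y)"
      using has_sum_diag[OF sP[of "(0, y)"]] by (simp add: Xact_restrict[OF n])
    have s2: "(\<lambda>m. \<Sum>j\<le>m. (c y ^^ j) (Q (m - j) j y)) sums f (0, y)"
      using has_sum_diag[OF sQ[of "(0, y)"]] by (simp add: Xact_restrict[OF n])
    have "(c y ^^ j) (T (m - j) j y) = (c y ^^ j) (P (m - j) j y) + (- 1) *\<^sub>R (c y ^^ j) (Q (m - j) j y)" for m j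
      unfolding T_def cpow_linear ..
    then show ?thesis using sums_diff[OF s1 s2] by (simp add: sum_subtractf)
  qed
  define U where "U m y = (\<Sum>j\<le>m. (c y ^^ j) (T (m - j) j y))" for m y
  have homU: "homog m (U m)" for m
    unfolding U_def
  proof (rule homog_sum)
    fix j assume "j \<in> {..m}"
    then show "homog m (\<lambda>y. (c y ^^ j) (T (m - j) j y))" using homog_cpow[OF homT[of "m - j" j], of j] by simp
  qed
  \<comment> \<open>Replacing y by t y turns the series into a power series in t, whose vanishing
    separates the homogeneous degrees.\<close>
  have U0: "U m y = 0" for m y
  proof (rule euclidean_eqI)
    fix b :: 'b assume "b \<in> Basis"
    have "(\<lambda>m. (U m y \<bullet> b) * t ^ m) sums 0" for t
    proof -
      have "(\<lambda>m. U m (t *\<^sub>R y)) sums 0" using sums0 by (simp add: U_def)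
      then have "(\<lambda>m. U m (t *\<^sub>R y) \<bullet> b) sums (0 \<bullet> b)" by (rule bounded_linear.sums[OF bounded_linear_inner_left])
      moreover have "U m (t *\<^sub>R y) = t ^ m *\<^sub>R U m y" for m using homU[of m] by (simp add: homog_def)
      ultimately show ?thesis by (simp add: mult.commute)
    qed
    from powser_zero_coeff[of "\<lambda>m. U m y \<bullet> b", OF this, of m] show "U m y \<bullet> b = 0 \<bullet> b" by simp
  qed
  have "T k j x = 0" for k j x
    using fischer_unique[of "j + k" "\<lambda>i. T (j + k - i) i" j x] homT dirT U0[of "j + k"] by (simp add: U_def)
  then have "P k j x = Q k j x" for k j x by (simp add: T_def)
  then show ?thesis by blast
qed

lemma norm_taylor_part_le:
  assumes f: "X.nullsol f" and R: "0 < R" and M: "\<And>y. y \<in> cball 0 R \<Longrightarrow> norm (f y) \<le> M" and x: "norm x = 1"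
  shows "norm (taylor_part f s d x) \<le> fact (d + s) * (X.cauchy_base / R) ^ (d + s) * M / fact d"
proof -
  define vs :: "(real \<times> 'v) list" where "vs = replicate d (0, x) @ replicate s (1, 0)"
  have "norm (foldr dirder vs f 0) \<le> fact (length vs) * (X.cauchy_base * 1 / R) ^ length vs * M"
    by (rule X.cauchy_factorial[OF f R M]) (use x in \<open>auto simp: vs_def norm_Pair split: if_splits\<close>)
  moreover have "length vs = d + s" by (simp add: vs_def)
  moreover have "foldr dirder vs f 0 = jet d ((dirder (1, 0) ^^ s) f) x"
    by (simp add: vs_def foldr_replicate jet_def)
  moreover have "norm (taylor_part f s d x) = norm (jet d ((dirder (1, 0) ^^ s) f) x) / fact d"
    by (simp add: taylor_part_def)
  ultimately show ?thesis by (simp add: divide_right_mono)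
qed

text \<open>The Cauchy estimate brings (j + k)! / (k - i)!, the recursive coefficients bring 1/i!
  and 1/j!. Summing over i gives 2^k / k!, and (j + k)! / (j! k!) is a binomial coefficient, so that
  only a geometric factor with arbitrarily small ratio remains.\<close>

lemma fischer_decay:
  assumes f: "X.nullsol f" shows "decay (fischer f)"
  unfolding decay_def
proof (intro allI impI)
  fix e :: real assume e: "e > 0"
  obtain K0 where K0: "0 < K0" "\<And>y a. norm (c y a) \<le> norm y * norm a * K0" using c.pos_bounded by blast
  define K where "K = max K0 1"
  have K: "K \<ge> 1" "norm (c y a) \<le> norm y * norm a * K" for y a
    using K0(2)[of y a] mult_left_mono[of K0 K "norm y * norm a"] by (auto simp: K_def)
  \<comment> \<open>Makes \<open>4 * K * q\<close> at most e/2: the 4 collects 2^m from the binomial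
    coefficient and 2^m from the sum over i, and K bounds left multiplication by unit vectors. The
    spare factor 1/2 later absorbs the constant \<open>M0\<close>.\<close>
  define R where "R = 8 * K * X.cauchy_base / e + 1"
  have R: "R > 0" using e K X.cauchy_base_nonneg by (simp add: R_def add_nonneg_pos)
  obtain M0 where M0: "0 \<le> M0" "\<And>y. y \<in> cball 0 R \<Longrightarrow> norm (f y) \<le> M0"
    using X.nullsol_bounded_cball[OF f] by blast
  define q where "q = X.cauchy_base / R"
  have q0: "0 \<le> q" using X.cauchy_base_nonneg R by (simp add: q_def)
  have q: "4 * K * q \<le> e / 2"
  proof -
    have "8 * K * X.cauchy_base \<le> e * R" using e by (simp add: R_def field_simps)
    then show ?thesis using R by (simp add: q_def field_simps)
  qed
  have main: "norm (fischer f k j x) \<le> (e / 2) ^ (j + k) * M0" if x: "norm x = 1" for j k x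
  proof -
    define m where "m = j + k"
    have cp: "norm ((c x ^^ i) a) \<le> K ^ i * norm a" for i a
    proof (induction i)
      case (Suc i)
      have "norm ((c x ^^ Suc i) a) \<le> norm ((c x ^^ i) a) * K" using K(2)[of x] x by simp
      also have "\<dots> \<le> K ^ i * norm a * K" using Suc K by (intro mult_right_mono) auto
      finally show ?case by (simp add: mult_ac)
    qed simp
    have t: "norm (pcoeff k i *\<^sub>R (c x ^^ i) (taylor_part f (i + j) (k - i) x)) \<le> (1 / (fact i * fact (k - i))) * (K ^ k * fact m * q ^ m * M0)"
      if i: "i \<le> k" for i
    proof -
      have "norm ((c x ^^ i) (taylor_part f (i + j) (k - i) x)) \<le> K ^ i * norm (taylor_part f (i + j) (k - i) x)" by (rule cp)
      also have "\<dots> \<le> K ^ k * (fact m * q ^ m * M0 / fact (k - i))"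
      proof (intro mult_mono)
        show "norm (taylor_part f (i + j) (k - i) x) \<le> fact m * q ^ m * M0 / fact (k - i)"
          using norm_taylor_part_le[OF f R M0(2) x, of "i + j" "k - i"] i by (simp add: q_def m_def add.commute)
        show "K ^ i \<le> K ^ k" using K i by (intro power_increasing) auto
      qed (use K in auto)
      finally have "\<bar>pcoeff k i\<bar> * norm ((c x ^^ i) (taylor_part f (i + j) (k - i) x)) \<le> (1 / fact i) * (K ^ k * (fact m * q ^ m * M0 / fact (k - i)))"
        by (intro mult_mono abs_pcoeff_le) auto
      then show ?thesis by simp
    qed
    have s2: "(\<Sum>i\<le>k. 1 / (fact i * fact (k - i))) = 2 ^ k / (fact k :: real)"
    proof -
      have "(\<Sum>i\<le>k. 1 / (fact i * fact (k - i))) = (\<Sum>i\<le>k. real (k choose i) / fact k)"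
        by (intro sum.cong refl) (simp add: binomial_fact)
      also have "\<dots> = real (\<Sum>i\<le>k. k choose i) / fact k" by (simp add: sum_divide_distrib)
      finally show ?thesis by (simp add: choose_row_sum)
    qed
    have "norm (\<Sum>i\<le>k. pcoeff k i *\<^sub>R (c x ^^ i) (taylor_part f (i + j) (k - i) x)) \<le> (\<Sum>i\<le>k. (1 / (fact i * fact (k - i))) * (K ^ k * fact m * q ^ m * M0))"
      by (rule order_trans[OF norm_sum sum_mono]) (use t in auto)
    also have "\<dots> = 2 ^ k / fact k * (K ^ k * fact m * q ^ m * M0)"
      unfolding sum_distrib_right[symmetric] s2 ..
    finally have "\<bar>fcoeff k j\<bar> * norm (\<Sum>i\<le>k. pcoeff k i *\<^sub>R (c x ^^ i) (taylor_part f (i + j) (k - i) x)) \<le> (1 / fact j) * (2 ^ k / fact k * (K ^ k * fact m * q ^ m * M0))"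
      by (intro mult_mono abs_fcoeff_le) auto
    then have "norm (fischer f k j x) \<le> (1 / fact j) * (2 ^ k / fact k * (K ^ k * fact m * q ^ m * M0))"
      by (simp add: fischer_def)
    also have "\<dots> = real (m choose j) * 2 ^ k * K ^ k * (q ^ m * M0)"
      by (simp add: m_def binomial_fact)
    also have "\<dots> \<le> 2 ^ m * 2 ^ m * K ^ m * (q ^ m * M0)"
    proof (intro mult_right_mono mult_mono)
      show "real (m choose j) \<le> 2 ^ m" using binomial_le_pow2[of m j] by (metis of_nat_le_iff of_nat_numeral of_nat_power)
      show "(2::real) ^ k \<le> 2 ^ m" "K ^ k \<le> K ^ m" using K by (auto intro!: power_increasing simp: m_def)
    qed (use K q0 M0 in auto)
    also have "\<dots> = (2 * 2 * K * q) ^ m * M0" by (simp only: power_mult_distrib mult_ac)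
    also have "\<dots> \<le> (e / 2) ^ m * M0"
      using q q0 K M0 by (intro mult_right_mono power_mono) auto
    finally show ?thesis by (simp add: m_def)
  qed
  obtain N where N: "M0 \<le> 2 ^ N" using real_arch_pow[of 2 M0] by (meson less_imp_le one_less_numeral_iff semiring_norm(76))
  have "norm (fischer f k j x) \<le> e ^ (j + k)" if "N \<le> j + k" "norm x = 1" for j k x
  proof -
    have "(2::real) ^ N \<le> 2 ^ (j + k)" using that by (intro power_increasing) auto
    with N have "M0 \<le> 2 ^ (j + k)" by (rule order_trans)
    then have "(e / 2) ^ (j + k) * M0 \<le> (e / 2) ^ (j + k) * 2 ^ (j + k)"
      using e by (intro mult_left_mono) auto
    also have "\<dots> = e ^ (j + k)" by (simp flip: power_mult_distrib)
    finally show ?thesis using main[OF that(2)] by (meson order_trans)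
  qed
  then show "\<exists>N. \<forall>j k x. N \<le> j + k \<longrightarrow> norm x = 1 \<longrightarrow> norm (fischer f k j x) \<le> e ^ (j + k)" by blast
qed

lemma expansion_exists:
  assumes n: "2 \<le> DIM('v)" and f: "X.nullsol f"
  shows "((\<lambda>(j, k). Xact k j x (fischer f k j (snd x))) has_sum f x) UNIV"
proof -
  have sm: "sph_mono k (fischer f k j)" for k j by (simp add: sph_mono_def homog_fischer[OF f] dirac_op_fischer[OF f])
  obtain h where h: "X.nullsol h" "\<And>x. ((\<lambda>(j, k). Xact k j x (fischer f k j (snd x))) has_sum h x) UNIV"
    using expansion_converges[OF n sm fischer_decay[OF f]] by blast
  have eq0: "h (0, y) = f (0, y)" for y
  proof -
    have "(\<lambda>m. taylor_part f 0 m y) sums h (0, y)"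
      using has_sum_diag[OF h(2)[of "(0, y)"]] by (simp add: Xact_restrict[OF n] fischer_decomposition)
    moreover have "(\<lambda>m. taylor_part f 0 m y) sums f (0, y)"
      using X.nullsol_taylor[OF f, of "(0, y)" 0] by (simp add: taylor_part_def jet_def)
    ultimately show ?thesis by (rule sums_unique2)
  qed
  have "f x - h x = 0" by (rule ck_unique[OF X.nullsol_diff[OF f h(1)]]) (simp add: eq0)
  then show ?thesis using h(2)[of x] by simp
qed

end

section \<open>The real Clifford algebra\<close>

definition sdiff :: "'n set \<Rightarrow> 'n set \<Rightarrow> 'n set" where "sdiff A B = (A - B) \<union> (B - A)"

lemma sdiff_sdiff: "sdiff {j} (sdiff {j} B) = B" and sdiff_commute: "sdiff {i} (sdiff {j} B) = sdiff {j} (sdiff {i} B)" by (auto simp: sdiff_def)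

lemma sdiff_eq_iff: "sdiff {j} B = C \<longleftrightarrow> B = sdiff {j} C" by (metis sdiff_sdiff)

text \<open>Transpositions are counted by b < j and the square e_j e_j = -1 by b = j, so the two
  exponents merge into one count.\<close>

lemma csign_singleton: "csign {j} B = (-1) ^ card {b \<in> B. b \<le> (j::'n::{finite,linorder})}"
proof -
  have "card {(a, b). a \<in> {j} \<and> b \<in> B \<and> b < a} = card (Pair j ` {b \<in> B. b < j})"
    by (rule arg_cong[of _ _ card]) auto
  also have "\<dots> = card {b \<in> B. b < j}" by (rule card_image) (auto simp: inj_on_def)
  moreover have "card {b \<in> B. b < j} + card ({j} \<inter> B) = card ({b \<in> B. b < j} \<union> ({j} \<inter> B))"
    by (rule card_Un_disjoint[symmetric]) auto
  moreover have "{b \<in> B. b < j} \<union> ({j} \<inter> B) = {b \<in> B. b \<le> j}" by (auto simp: less_le)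
  ultimately show ?thesis unfolding csign_def by simp
qed

text \<open>Adding or removing j changes the number of elements up to i by one exactly when j <=
  i.\<close>

lemma csign_toggle: "csign {i} (sdiff {j} B) = (if j \<le> i then - 1 else 1) * csign {i} (B::'n::{finite,linorder} set)"
proof (cases "j \<le> i")
  case True
  show ?thesis
  proof (cases "j \<in> B")
    case jB: True
    have "{b \<in> B. b \<le> i} = insert j {b \<in> sdiff {j} B. b \<le> i}" "j \<notin> {b \<in> sdiff {j} B. b \<le> i}"
      using jB True by (auto simp: sdiff_def)
    then have "card {b \<in> B. b \<le> i} = Suc (card {b \<in> sdiff {j} B. b \<le> i})" by simp
    then show ?thesis using True by (simp add: csign_singleton)
  next
    case jB: False
    have "{b \<in> sdiff {j} B. b \<le> i} = insert j {b \<in> B. b \<le> i}" "j \<notin> {b \<in> B. b \<le> i}"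
      using jB True by (auto simp: sdiff_def)
    then have "card {b \<in> sdiff {j} B. b \<le> i} = Suc (card {b \<in> B. b \<le> i})" by simp
    then show ?thesis using True by (simp add: csign_singleton)
  qed
next
  case False
  then have "{b \<in> sdiff {j} B. b \<le> i} = {b \<in> B. b \<le> i}" by (auto simp: sdiff_def)
  then show ?thesis using False by (simp add: csign_singleton)
qed

lemma cmul_basis:
  "cmul (\<chi> A. if A = A0 then 1 else 0) a $ C = (\<Sum>B\<in>UNIV. if sdiff A0 B = C then csign A0 B * a $ B else 0)"
proof -
  have "cmul (\<chi> A. if A = A0 then 1 else 0) a $ C =
      (\<Sum>A\<in>UNIV. if A = A0 then (\<Sum>B\<in>UNIV. if sdiff A0 B = C then csign A0 B * a $ B else 0) else 0)"
    unfolding cmul_def vec_lambda_beta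
  proof (intro sum.cong refl)
    fix A
    show "(\<Sum>B\<in>UNIV. if A - B \<union> (B - A) = C then csign A B * (if A = A0 then 1 else 0) * a $ B else 0) =
        (if A = A0 then (\<Sum>B\<in>UNIV. if sdiff A0 B = C then csign A0 B * a $ B else 0) else 0)"
      by (cases "A = A0") (simp_all add: sdiff_def cong: if_cong)
  qed
  then show ?thesis by simp
qed

lemma cmul_cgen: "cmul (cgen j) a $ C = csign {j} (sdiff {j} C) * a $ (sdiff {j} C)"
  unfolding cgen_def cmul_basis sdiff_eq_iff by simp

lemma cmul_cone: "cmul cone a = a"
proof (rule vec_eq_iff[THEN iffD2], rule allI)
  fix C
  have "sdiff {} B = B" for B :: "'a set" by (simp add: sdiff_def)
  then show "cmul cone a $ C = a $ C" unfolding cone_def cmul_basis by (simp add: csign_def)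
qed

lemma bilinear_cmul: "bounded_bilinear (cmul :: 'n::{finite,linorder} cliff \<Rightarrow> _)"
  unfolding bilinear_conv_bounded_bilinear[symmetric] bilinear_def
proof (intro conjI allI linearI)
  fix a b c :: "'n cliff" and r :: real
  have d: "(if P then x + y else 0) = (if P then x else 0) + (if P then y else 0)"
    "(if P then r * x else 0) = r * (if P then x else 0)" for P and x y :: real by auto
  show "cmul a (b + c) = cmul a b + cmul a c"
    unfolding cmul_def by (simp add: vec_eq_iff distrib_left d sum.distrib cong: if_cong)
  show "cmul (a + b) c = cmul a c + cmul b c"
    unfolding cmul_def by (simp add: vec_eq_iff distrib_left distrib_right d sum.distrib cong: if_cong)
  show "cmul a (r *\<^sub>R b) = r *\<^sub>R cmul a b"
    unfolding cmul_def vec_eq_iff by (simp add: sum_distrib_left mult.left_commute[of _ r] d cong: if_cong)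
  show "cmul (r *\<^sub>R a) b = r *\<^sub>R cmul a b"
    unfolding cmul_def vec_eq_iff by (simp add: sum_distrib_left mult.left_commute[of _ r] mult.assoc d cong: if_cong)
qed

text \<open>Both products reach the same component of \<open>a\<close> with the same symmetric sign
  factor. The remaining sign is -1 for exactly one of i <= j and j <= i if the indices differ, and
  for both if they coincide.\<close>

lemma cgen_anticommute:
  "cmul (cgen i) (cmul (cgen j) a) + cmul (cgen j) (cmul (cgen i) a) = (if i = j then - 2 else 0) *\<^sub>R a"
proof (rule vec_eq_iff[THEN iffD2], rule allI)
  fix C :: "'a set"
  have s: "csign {i} C * csign {i} C = 1" for i :: 'a and C by (simp add: csign_singleton flip: power_add mult_2)
  have c: "cmul (cgen i) (cmul (cgen j) a) $ C = (if i \<le> j then - 1 else 1) * (csign {i} C * csign {j} C) * a $ sdiff {i} (sdiff {j} C)" for i j :: 'a and a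
    unfolding cmul_cgen csign_toggle sdiff_commute[of j i C] by simp
  show "(cmul (cgen i) (cmul (cgen j) a) + cmul (cgen j) (cmul (cgen i) a)) $ C = ((if i = j then - 2 else 0) *\<^sub>R a) $ C"
    unfolding vector_add_component c sdiff_commute[of j i C]
    by (cases "i = j") (auto simp: s sdiff_sdiff)
qed

interpretation cl: bounded_bilinear cmul by (rule bilinear_cmul)

lemma linear_cvec: "bounded_linear cvec"
  unfolding linear_conv_bounded_linear[symmetric]
  by (rule linearI) (simp_all add: cvec_def scaleR_add_left sum.distrib scaleR_sum_right)

lemma cvec_square: "cmul (cvec v) (cmul (cvec v) a) = - (v \<bullet> v) *\<^sub>R a"
proof -
  define S where "S = cmul (cvec v) (cmul (cvec v) a)"
  have S: "S = (\<Sum>i\<in>UNIV. \<Sum>j\<in>UNIV. (v $ i * v $ j) *\<^sub>R cmul (cgen j) (cmul (cgen i) a))"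
    unfolding S_def cvec_def by (simp add: cl.sum_left cl.sum_right cl.scaleR_left cl.scaleR_right scaleR_sum_right)
  also have "\<dots> = (\<Sum>i\<in>UNIV. \<Sum>j\<in>UNIV. (v $ i * v $ j) *\<^sub>R cmul (cgen i) (cmul (cgen j) a))"
    by (subst sum.swap) (intro sum.cong refl, metis mult.commute)
  finally have "S + S = (\<Sum>i\<in>UNIV. \<Sum>j\<in>UNIV. (v $ i * v $ j) *\<^sub>R (cmul (cgen i) (cmul (cgen j) a) + cmul (cgen j) (cmul (cgen i) a)))"
    using S by (simp add: sum.distrib scaleR_add_right)
  also have "\<dots> = (\<Sum>i\<in>UNIV. (- 2 * (v $ i * v $ i)) *\<^sub>R a)"
    unfolding cgen_anticommute by (simp add: if_distrib if_distribR mult_ac cong: if_cong)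
  also have "\<dots> = (- 2 * (v \<bullet> v)) *\<^sub>R a"
    by (simp add: inner_vec_def scaleR_sum_left sum_distrib_left sum_negf)
  finally have "2 *\<^sub>R S = 2 *\<^sub>R (- (v \<bullet> v) *\<^sub>R a)" by (simp add: scaleR_2)
  then show ?thesis unfolding S_def by (subst (asm) scaleR_cancel_left) simp
qed

interpretation cm: clifford "\<lambda>v::real ^ 'n::{finite,linorder}. cmul (cvec v)"
  by (rule clifford.intro[OF bounded_bilinear.comp1[OF bilinear_cmul linear_cvec] cvec_square])

lemma sum_Basis_vec: "(\<Sum>b\<in>Basis. g b) = (\<Sum>i\<in>UNIV. g (axis i (1::real)))"
  for g :: "real ^ 'n::finite \<Rightarrow> 'b::comm_monoid_add"
proof -
  have "(Basis :: (real ^ 'n) set) = (\<lambda>i. axis i 1) ` UNIV" by (auto simp: Basis_vec_def)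
  moreover have "inj (\<lambda>i::'n. axis i (1::real))" by (auto simp: inj_on_def axis_eq_axis)
  ultimately show ?thesis using sum.reindex[of "\<lambda>i::'n. axis i (1::real)" UNIV g] by (simp only: o_def)
qed

lemma cvec_axis: "cvec (axis j 1) = cgen j"
  by (simp add: cvec_def axis_def if_distrib if_distribR cong: if_cong)

lemma dirac_op_eq: "cm.dirac_op P x = (\<Sum>j\<in>UNIV. cmul (cgen j) (dirder (axis j 1) P x))"
  unfolding cm.dirac_op_def sum_Basis_vec cvec_axis ..

lemma monogenic_iff: "monogenic f \<longleftrightarrow> cm.X.nullsol f"
proof
  assume "monogenic f"
  then obtain f' where f': "\<And>x. (f has_derivative f' x) (at x)" "\<And>v. continuous_on UNIV (\<lambda>x. f' x v)"
     "\<And>x. f' x (1, 0) + (\<Sum>j\<in>UNIV. cmul (cgen j) (f' x (0, axis j 1))) = 0"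
    unfolding monogenic_def by blast
  have "dirder v f x = f' x v" for v x by (rule dirder_eq[OF f'(1)])
  then show "cm.X.nullsol f" unfolding cm.X_nullsol_iff sum_Basis_vec cvec_axis using C1I[OF f'(1,2)] f'(3) by simp
next
  assume f: "cm.X.nullsol f"
  show "monogenic f"
    unfolding monogenic_def
  proof (intro exI[of _ "\<lambda>x v. dirder v f x"] conjI allI)
    show "(f has_derivative (\<lambda>v. dirder v f x)) (at x)" for x by (rule C1_has_derivative[OF cm.X.nullsol_C1[OF f]])
    show "continuous_on UNIV (\<lambda>x. dirder v f x)" for v by (rule C1_dirder_continuous[OF cm.X.nullsol_C1[OF f] continuous_on_id])
    show "dirder (1, 0) f x + (\<Sum>j\<in>UNIV. cmul (cgen j) (dirder (0, axis j 1) f x)) = 0" for x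
      using f unfolding cm.X_nullsol_iff sum_Basis_vec cvec_axis by blast
  qed
qed

lemma Xpoly_Xact:
  fixes x :: "real \<times> (real ^ 'n::{finite,linorder})"
  shows "cmul (Xpoly k j x) a = cm.Xact k j x a"
proof (cases "j = 0")
  case True
  then show ?thesis by (simp add: Xpoly_def cm.Xact_def cmul_cone)
next
  case False
  define n where "n = card (UNIV :: 'n set)"
  define r where "r = norm x"
  define \<nu> where "\<nu> = cm.gidx TYPE('n) k"
  have e: "(real n - 1) / 2 + real k = \<nu>" "(real n + 1) / 2 + real k = \<nu> + 1"
    "real n + 2 * real k - 1 = 2 * \<nu>" "real n + 2 * real k + real j - 1 = 2 * \<nu> + real j"
    by (simp_all add: \<nu>_def cm.gidx_def n_def field_simps)
  have xx: "x \<bullet> x = r\<^sup>2" by (simp add: r_def power2_norm_eq_inner)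
  have X: "cmul (Xpoly k j x) a = mu n k j *\<^sub>R ((r ^ j * gegen \<nu> j (fst x / r)) *\<^sub>R a
      + (2 * \<nu> / (2 * \<nu> + real j) * (r ^ j * gegen (\<nu> + 1) (j - 1) (fst x / r) / r)) *\<^sub>R cmul (cvec (snd x)) a)"
    unfolding Xpoly_def Let_def n_def[symmetric] r_def[symmetric] e
    using False by (simp add: cl.scaleR_left cl.add_left cmul_cone scaleR_add_right mult_ac)
  show ?thesis
  \<comment> \<open>At the origin the argument x_0 / |x| is 0 by the convention for division by
    zero, but the factor 0^j with j >= 1 makes the whole term 0, as in the homogenised form.\<close>
  proof (cases "r = 0")
    case True
    then have "x = 0" by (simp add: r_def)
    obtain m where j: "j = Suc m" using False by (cases j) auto
    have "hgeg \<nu> j 0 0 = 0" unfolding hgeg_def j by (rule sum.neutral) (auto simp: hgeg_coeff_def power_0_left)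
    moreover have "cvec (0 :: (real, 'n) vec) = 0" by (simp add: cvec_def)
    ultimately show ?thesis unfolding X using True False \<open>x = 0\<close>
      by (simp add: cm.Xact_def \<nu>_def n_def cl.zero_left)
  next
    case r: False
    have p: "r ^ j * gegen (\<nu> + 1) (j - 1) (fst x / r) / r = r ^ (j - 1) * gegen (\<nu> + 1) (j - 1) (fst x / r)"
      using False r by (cases j) auto
    show ?thesis unfolding X p gegen_homogenized[OF r] using False
      by (simp add: cm.Xact_def \<nu>_def n_def xx)
  qed
qed

section \<open>Homogeneous polynomials in coordinates\<close>

lemma finite_multiindex: "finite {\<alpha> :: 'n::finite \<Rightarrow> nat. sum \<alpha> UNIV = k}"
proof (rule finite_subset)
  show "{\<alpha> :: 'n \<Rightarrow> nat. sum \<alpha> UNIV = k} \<subseteq> PiE UNIV (\<lambda>_. {..k})"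
    by (auto simp: PiE_def intro: member_le_sum)
qed (auto intro: finite_PiE)

lemma hom_poly_const: "hom_poly 0 (\<lambda>x. a :: 'n::{finite,linorder} cliff)"
proof -
  have "{\<alpha> :: 'n \<Rightarrow> nat. sum \<alpha> UNIV = 0} = {\<lambda>_. 0}" by (auto simp: fun_eq_iff)
  then show ?thesis unfolding hom_poly_def by (intro exI[of _ "\<lambda>_. a"]) (simp only:, simp)
qed

lemma hom_poly_0: "hom_poly k (\<lambda>x. 0)"
  unfolding hom_poly_def by (intro exI[of _ "\<lambda>_. 0"]) simp

lemma hom_poly_add: "hom_poly k P \<Longrightarrow> hom_poly k Q \<Longrightarrow> hom_poly k (\<lambda>x. P x + Q x)"
  unfolding hom_poly_def
proof (elim exE)
  fix c d
  assume "P = (\<lambda>x. \<Sum>\<alpha> | sum \<alpha> UNIV = k. (\<Prod>i\<in>UNIV. x $ i ^ \<alpha> i) *\<^sub>R c \<alpha>)"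
    and "Q = (\<lambda>x. \<Sum>\<alpha> | sum \<alpha> UNIV = k. (\<Prod>i\<in>UNIV. x $ i ^ \<alpha> i) *\<^sub>R d \<alpha>)"
  then show "\<exists>e. (\<lambda>x. P x + Q x) = (\<lambda>x. \<Sum>\<alpha> | sum \<alpha> UNIV = k. (\<Prod>i\<in>UNIV. x $ i ^ \<alpha> i) *\<^sub>R e \<alpha>)"
    by (intro exI[of _ "\<lambda>\<alpha>. c \<alpha> + d \<alpha>"]) (simp add: scaleR_add_right sum.distrib)
qed

lemma hom_poly_sum: "(\<And>i. i \<in> I \<Longrightarrow> hom_poly k (P i)) \<Longrightarrow> hom_poly k (\<lambda>x. \<Sum>i\<in>I. P i x)"
  by (induction I rule: infinite_finite_induct) (auto intro: hom_poly_0 hom_poly_add)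

lemma hom_poly_linear:
  assumes A: "linear A" and P: "hom_poly k P" shows "hom_poly k (\<lambda>x. A (P x))"
proof -
  obtain c where "P = (\<lambda>x. \<Sum>\<alpha> | sum \<alpha> UNIV = k. (\<Prod>i\<in>UNIV. x $ i ^ \<alpha> i) *\<^sub>R c \<alpha>)"
    using P unfolding hom_poly_def by blast
  then show ?thesis unfolding hom_poly_def
    by (intro exI[of _ "\<lambda>\<alpha>. A (c \<alpha>)"]) (simp add: linear_sum[OF A] linear_scale[OF A])
qed

lemma hom_poly_mult_coord:
  fixes j :: "'n::{finite,linorder}"
  assumes P: "hom_poly k P" shows "hom_poly (Suc k) (\<lambda>x. (x $ j) *\<^sub>R P x)"
proof -
  obtain c where P: "P = (\<lambda>x. \<Sum>\<alpha> | sum \<alpha> UNIV = k. (\<Prod>i\<in>UNIV. x $ i ^ \<alpha> i) *\<^sub>R c \<alpha>)"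
    using P unfolding hom_poly_def by blast
  \<comment> \<open>Multiplication by x_j raises the j-th exponent, so the new coefficient at
    \<open>\<alpha>\<close> is the old one at the lowered multi-index, and 0 where nothing can be
    lowered.\<close>
  define d where "d \<alpha> = (if \<alpha> j = 0 then 0 else c (\<alpha>(j := \<alpha> j - 1)))" for \<alpha>
  have upd: "sum (\<alpha>(j := m)) UNIV = m + sum \<alpha> (UNIV - {j})" for \<alpha> :: "'n \<Rightarrow> nat" and m
    by (subst sum.remove[of _ j]) (auto intro!: sum.cong)
  have s: "sum \<alpha> UNIV = \<alpha> j + sum \<alpha> (UNIV - {j})" for \<alpha> :: "'n \<Rightarrow> nat"
    by (rule sum.remove) auto
  have pr: "(\<Prod>i\<in>UNIV. x $ i ^ (\<alpha>(j := Suc (\<alpha> j))) i) = x $ j * (\<Prod>i\<in>UNIV. x $ i ^ \<alpha> i)" for x :: "(real, 'n) vec" and \<alpha>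
  proof -
    have "(\<Prod>i\<in>UNIV - {j}. x $ i ^ (\<alpha>(j := Suc (\<alpha> j))) i) = (\<Prod>i\<in>UNIV - {j}. x $ i ^ \<alpha> i)" by (rule prod.cong) auto
    then show ?thesis by (simp add: prod.remove[of UNIV j])
  qed
  have "(x $ j) *\<^sub>R P x = (\<Sum>\<alpha> | sum \<alpha> UNIV = Suc k. (\<Prod>i\<in>UNIV. x $ i ^ \<alpha> i) *\<^sub>R d \<alpha>)" for x
  proof -
    have "(x $ j) *\<^sub>R P x = (\<Sum>\<alpha> | sum \<alpha> UNIV = k. (x $ j * (\<Prod>i\<in>UNIV. x $ i ^ \<alpha> i)) *\<^sub>R c \<alpha>)"
      by (simp add: P scaleR_sum_right)
    also have "\<dots> = (\<Sum>\<alpha> | sum \<alpha> UNIV = Suc k \<and> \<alpha> j \<noteq> 0. (\<Prod>i\<in>UNIV. x $ i ^ \<alpha> i) *\<^sub>R d \<alpha>)"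
    proof (rule sum.reindex_bij_witness[of _ "\<lambda>\<alpha>. \<alpha>(j := \<alpha> j - 1)" "\<lambda>\<alpha>. \<alpha>(j := Suc (\<alpha> j))"])
      fix \<alpha> :: "'n \<Rightarrow> nat" assume a: "\<alpha> \<in> {\<alpha>. sum \<alpha> UNIV = k}"
      show "\<alpha>(j := Suc (\<alpha> j)) \<in> {\<alpha>. sum \<alpha> UNIV = Suc k \<and> \<alpha> j \<noteq> 0}"
        using a s[of \<alpha>] by (auto simp del: fun_upd_apply simp: upd fun_upd_same)
      show "(\<Prod>i\<in>UNIV. x $ i ^ (\<alpha>(j := Suc (\<alpha> j))) i) *\<^sub>R d (\<alpha>(j := Suc (\<alpha> j))) = (x $ j * (\<Prod>i\<in>UNIV. x $ i ^ \<alpha> i)) *\<^sub>R c \<alpha>"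
        unfolding pr by (simp add: d_def)
    next
      fix \<alpha> :: "'n \<Rightarrow> nat" assume a: "\<alpha> \<in> {\<alpha>. sum \<alpha> UNIV = Suc k \<and> \<alpha> j \<noteq> 0}"
      show "\<alpha>(j := \<alpha> j - 1) \<in> {\<alpha>. sum \<alpha> UNIV = k}"
        using a s[of \<alpha>] by (auto simp del: fun_upd_apply simp: upd fun_upd_same)
    qed auto
    also have "\<dots> = (\<Sum>\<alpha> | sum \<alpha> UNIV = Suc k. (\<Prod>i\<in>UNIV. x $ i ^ \<alpha> i) *\<^sub>R d \<alpha>)"
      by (rule sum.mono_neutral_left) (auto simp: finite_multiindex d_def)
    finally show ?thesis .
  qed
  then show ?thesis unfolding hom_poly_def by blast
qed

lemma hom_poly_cvec: "hom_poly k P \<Longrightarrow> hom_poly (Suc k) (\<lambda>x. cmul (cvec x) (P x))"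
proof -
  assume P: "hom_poly k P"
  have "cmul (cvec x) (P x) = (\<Sum>j\<in>UNIV. (x $ j) *\<^sub>R cmul (cgen j) (P x))" for x
    by (simp add: cvec_def cl.sum_left cl.scaleR_left)
  then show ?thesis
    by (simp add: hom_poly_sum hom_poly_mult_coord
        hom_poly_linear[OF bounded_linear.linear[OF cl.bounded_linear_right] P])
qed

lemma hom_poly_cpow: "hom_poly k P \<Longrightarrow> hom_poly (k + i) (\<lambda>x. (cmul (cvec x) ^^ i) (P x))"
  by (induction i) (auto dest: hom_poly_cvec)

lemma hom_poly_scaleR: "hom_poly k P \<Longrightarrow> hom_poly k (\<lambda>x. r *\<^sub>R P x)"
  by (rule hom_poly_linear[OF linear_scaleR])

lemma hom_poly_jet: "cm.X.nullsol u \<Longrightarrow> hom_poly d (cm.jet d u)"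
proof (induction d arbitrary: u)
  case 0
  have "cm.jet 0 u = (\<lambda>x. u 0)" by (auto simp: cm.jet_def)
  then show ?case by (simp add: hom_poly_const)
next
  case (Suc d)
  have "cm.jet (Suc d) u = (\<lambda>x. \<Sum>i\<in>UNIV. (x $ i) *\<^sub>R cm.jet d (dirder (0, axis i 1) u) x)"
    by (intro ext) (simp only: cm.jet_Suc[OF Suc.prems] sum_Basis_vec inner_axis inner_real_def mult_1_right)
  then show ?case
    by (simp add: hom_poly_sum hom_poly_mult_coord Suc.IH cm.X.nullsol_dirder[OF Suc.prems])
qed

text \<open>The abstract locale records only continuous differentiability and homogeneity. That the
  constructed coefficients are polynomials is recovered here, from the recursion for jets.\<close>

lemma hom_poly_fischer: assumes f: "cm.X.nullsol f" shows "hom_poly k (cm.fischer f k j)"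
proof -
  have *: "hom_poly (k - i + i) (\<lambda>x. (cmul (cvec x) ^^ i) (cm.taylor_part f (i + j) (k - i) x))" for i
    unfolding cm.taylor_part_def by (intro hom_poly_cpow hom_poly_scaleR hom_poly_jet cm.X.nullsol_funpow f)
  have "hom_poly k (\<lambda>x. (cmul (cvec x) ^^ i) (cm.taylor_part f (i + j) (k - i) x))" if "i \<in> {..k}" for i
    using *[of i] that by simp
  then show ?thesis unfolding cm.fischer_def[abs_def]
    by (intro hom_poly_scaleR[OF hom_poly_sum[OF hom_poly_scaleR]])
qed

lemma C1_monomial: "C1 (\<lambda>x::real ^ 'n::finite. \<Prod>i\<in>I. x $ i ^ \<alpha> i)"
proof -
  have 1: "C1 (\<lambda>x::real ^ 'n. x $ i)" for i by (rule C1_linear_map[OF bounded_linear_vec_nth])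
  have 2: "C1 (\<lambda>x::real ^ 'n. x $ i ^ m)" for i m
    by (induction m) (auto intro: C1_const C1_bilinear[OF bounded_bilinear_mult 1])
  show ?thesis
    by (induction I rule: infinite_finite_induct) (auto intro: C1_const C1_bilinear[OF bounded_bilinear_mult 2])
qed

lemma hom_poly_homog: assumes "hom_poly k P" shows "cm.homog k P"
proof -
  obtain c where P: "P = (\<lambda>x. \<Sum>\<alpha> | sum \<alpha> UNIV = k. (\<Prod>i\<in>UNIV. x $ i ^ \<alpha> i) *\<^sub>R c \<alpha>)"
    using assms unfolding hom_poly_def by blast
  have "C1 P" unfolding P by (intro C1_sum C1_bilinear[OF bounded_bilinear_scaleR] C1_monomial C1_const)
  moreover have "P (t *\<^sub>R x) = t ^ k *\<^sub>R P x" for t x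
    unfolding P scaleR_sum_right
    by (intro sum.cong refl) (auto simp: power_mult_distrib prod.distrib power_sum)
  ultimately show ?thesis by (simp add: cm.homog_def)
qed

lemma spherical_monogenic_iff: "spherical_monogenic k P \<longleftrightarrow> hom_poly k P \<and> cm.sph_mono k P"
proof
  assume "spherical_monogenic k P"
  then obtain P' where P: "hom_poly k P" "\<And>x. (P has_derivative P' x) (at x)"
      "\<And>x. (\<Sum>j\<in>UNIV. cmul (cgen j) (P' x (axis j 1))) = 0"
    unfolding spherical_monogenic_def by blast
  have "cm.dirac_op P x = 0" for x unfolding dirac_op_eq dirder_eq[OF P(2)] by (rule P(3))
  then show "hom_poly k P \<and> cm.sph_mono k P" using P(1) hom_poly_homog by (auto simp: cm.sph_mono_def)
next
  assume P: "hom_poly k P \<and> cm.sph_mono k P"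
  then have "C1 P" by (simp add: cm.sph_mono_def cm.homog_def)
  show "spherical_monogenic k P"
    unfolding spherical_monogenic_def
  proof (intro conjI exI[of _ "\<lambda>x v. dirder v P x"] allI)
    show "(P has_derivative (\<lambda>v. dirder v P x)) (at x)" for x by (rule C1_has_derivative[OF \<open>C1 P\<close>])
    show "(\<Sum>j\<in>UNIV. cmul (cgen j) (dirder (axis j 1) P x)) = 0" for x
      using P unfolding dirac_op_eq[symmetric] cm.sph_mono_def by blast
  qed (use P in auto)
qed

section \<open>The limsup condition as a family of geometric bounds\<close>

lemma Limsup_root_iff:
  fixes a :: "nat \<Rightarrow> nat \<Rightarrow> real"
  assumes a: "\<And>j k. 0 \<le> a j k"
  shows "Limsup (filtercomap (\<lambda>(j :: nat, k :: nat). j + k) at_top) (\<lambda>(j, k). ereal (root (j + k) (a j k))) = 0 \<longleftrightarrow>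
     (\<forall>e>0. \<exists>N. \<forall>j k. N \<le> j + k \<longrightarrow> a j k \<le> e ^ (j + k))" (is "Limsup ?F ?r = 0 \<longleftrightarrow> ?R")
proof -
  have ev: "eventually Q ?F \<longleftrightarrow> (\<exists>N. \<forall>j k. N \<le> j + k \<longrightarrow> Q (j, k))" for Q
    unfolding eventually_filtercomap_at_top_linorder by auto
  \<comment> \<open>Nontriviality of the filter yields 0 <= Limsup, so that only the upper bound has
    to be discussed.\<close>
  have "?F \<noteq> bot"
  proof
    assume "?F = bot"
    then have "eventually (\<lambda>_. False) ?F" by simp
    then obtain N where "\<And>j k::nat. N \<le> j + k \<Longrightarrow> False" unfolding ev by blast
    from this[of N 0] show False by simp
  qed
  then have "0 \<le> Limsup ?F ?r"
    by (intro le_Limsup always_eventually) (auto simp: a real_root_ge_zero)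
  then have "Limsup ?F ?r = 0 \<longleftrightarrow> Limsup ?F ?r \<le> 0" by auto
  also have "\<dots> \<longleftrightarrow> (\<forall>y>0. \<exists>N. \<forall>j k. N \<le> j + k \<longrightarrow> ereal (root (j + k) (a j k)) < y)"
    unfolding Limsup_le_iff ev by simp
  also have "\<dots> \<longleftrightarrow> ?R"
  proof (intro iffI allI impI)
    fix e :: real
    assume L: "\<forall>y>0. \<exists>N. \<forall>j k. N \<le> j + k \<longrightarrow> ereal (root (j + k) (a j k)) < y" and e: "e > 0"
    from L e obtain N where N: "\<And>j k. N \<le> j + k \<Longrightarrow> ereal (root (j + k) (a j k)) < ereal e"
      by (metis ereal_less(2))
    \<comment> \<open>The index j + k = 0 is excluded because \<open>root 0\<close> is constantly 0
      and does not recover \<open>a j k\<close>.\<close>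
    have "a j k \<le> e ^ (j + k)" if "max N 1 \<le> j + k" for j k
    proof -
      have "0 < j + k" using that by linarith
      then have "a j k = root (j + k) (a j k) ^ (j + k)" by (rule real_root_pow_pos2[symmetric]) (rule a)
      also have "\<dots> \<le> e ^ (j + k)" using N[of j k] that a by (intro power_mono) (auto simp: real_root_ge_zero)
      finally show ?thesis .
    qed
    then show "\<exists>N. \<forall>j k. N \<le> j + k \<longrightarrow> a j k \<le> e ^ (j + k)" by blast
  next
    fix y :: ereal assume R: ?R and y: "0 < y"
    obtain e where e: "0 < e" "ereal e < y"
      using ereal_dense2[OF y] by (metis ereal_less(2))
    obtain N where N: "\<And>j k. N \<le> j + k \<Longrightarrow> a j k \<le> e ^ (j + k)" using R e by blast
    have "ereal (root (j + k) (a j k)) < y" if "max N 1 \<le> j + k" for j k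
    proof -
      have jk: "0 < j + k" using that by linarith
      have "root (j + k) (a j k) \<le> root (j + k) (e ^ (j + k))"
        by (rule real_root_le_mono[OF jk]) (use N that in auto)
      also have "\<dots> = e" using e by (intro real_root_power_cancel[OF jk]) simp
      finally show ?thesis using e by (meson ereal_less_eq(3) le_less_trans)
    qed
    then show "\<exists>N. \<forall>j k. N \<le> j + k \<longrightarrow> ereal (root (j + k) (a j k)) < y" by blast
  qed
  finally show ?thesis .
qed

section \<open>Norms on the sphere\<close>

lemma ball_integrable:
  fixes h :: "'a::euclidean_space \<Rightarrow> real"
  assumes "h \<in> borel_measurable borel" "\<And>x. x \<in> ball 0 1 \<Longrightarrow> \<bar>h x\<bar> \<le> B"
  shows "h integrable_on ball 0 1"
proof (rule set_borel_integral_eq_integral(1))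
  show "set_integrable lborel (ball 0 1) h"
    unfolding set_integrable_def
    by (rule integrableI_bounded_set_indicator[where B = B])
       (use assms emeasure_bounded_finite[OF bounded_ball, of "0::'a" 1] in auto)
qed

text \<open>For |x| <= 1/2 the mean value over radius 1/2 stays inside the unit ball. Instead of
  Cauchy-Schwarz for integrals, the pointwise inequality w <= t/2 + w^2/(2 t) is integrated, with t
  close to the square root of the energy.\<close>

lemma (in dirac) nullsol_norm_le_L2:
  obtains C where "0 < C" "\<And>P x. nullsol P \<Longrightarrow> norm x \<le> 1/2 \<Longrightarrow> norm (P x) \<le> C * sqrt (integral (ball 0 1) (\<lambda>y. (norm (P y))\<^sup>2))"
proof -
  define V where "V = Henstock_Kurzweil_Integration.content (ubox :: 'a set)"
  \<comment> \<open>The integral of t/2 over the cube is V t/2, and the substitution with scale 1/2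
    multiplies the energy by 2^DIM; for energy at most t^2 the sum is t (V + 2^DIM)/2, to be divided
    by the mass of the bump.\<close>
  define C where "C = (V + 2 ^ DIM('a)) / (2 * bump_mass TYPE('a))"
  note bm = bump_mass_pos[where 'a = 'a]
  have V: "0 \<le> V" by (simp add: V_def)
  have "0 < V + 2 ^ DIM('a)" using V by (intro add_nonneg_pos) auto
  then have C: "0 < C" using bm by (simp add: C_def)
  have "norm (P x) \<le> C * sqrt (integral (ball 0 1) (\<lambda>y. (norm (P y))\<^sup>2))" if P: "nullsol P" and x: "norm x \<le> 1/2" for P x
  proof -
    define J where "J = integral (ball 0 1) (\<lambda>y. (norm (P y))\<^sup>2)"
    define g where "g y = (if y \<in> ball 0 1 then (norm (P y))\<^sup>2 else 0)" for y
    have cP: "continuous_on S (\<lambda>x. P (q x))" if "continuous_on S q" for S :: "'a set" and q by (rule C1_continuous[OF nullsol_C1[OF P] that])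
    obtain M where M: "\<And>y. y \<in> cball 0 1 \<Longrightarrow> norm (P y) \<le> M" using nullsol_bounded_cball[OF P] by blast
    have intP: "(\<lambda>y. (norm (P y))\<^sup>2) integrable_on ball 0 1"
    proof (rule ball_integrable)
      show "(\<lambda>y. (norm (P y))\<^sup>2) \<in> borel_measurable borel"
        by (intro borel_measurable_continuous_onI continuous_intros cP)
      show "\<bar>(norm (P y))\<^sup>2\<bar> \<le> M\<^sup>2" if "y \<in> ball 0 1" for y using M[of y] that by (simp add: power_mono)
    qed
    have gJ: "(g has_integral J) UNIV"
      unfolding g_def has_integral_restrict_UNIV J_def using intP by blast
    have g0: "g y = 0" if "y \<notin> ubox" for y using notin_ubox_norm[OF that] by (simp add: g_def)
    have "(g has_integral J) (cbox (- One) One)"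
    proof -
      have "g = (\<lambda>y. if y \<in> cbox (- One) One then g y else 0)" using g0 by (auto simp: ubox_def)
      then show ?thesis using gJ has_integral_restrict_UNIV by metis
    qed
    from has_integral_affinity[OF this, of "1/2" x]
    have "((\<lambda>y. g ((1/2) *\<^sub>R y + x)) has_integral 2 ^ DIM('a) * J) ((\<lambda>y. 2 *\<^sub>R y + - (2 *\<^sub>R x)) ` cbox (- One) One)"
      by (simp add: power_divide)
    then have gi: "((\<lambda>y. g ((1/2) *\<^sub>R y + x)) has_integral 2 ^ DIM('a) * J) UNIV"
    proof (rule has_integral_on_superset)
      fix y assume "y \<notin> (\<lambda>y. 2 *\<^sub>R y + - (2 *\<^sub>R x)) ` cbox (- One) One"
      moreover have "y = 2 *\<^sub>R ((1/2) *\<^sub>R y + x) + - (2 *\<^sub>R x)" by (simp add: scaleR_add_right)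
      ultimately have "(1/2) *\<^sub>R y + x \<notin> cbox (- One) One" by blast
      then show "g ((1/2) *\<^sub>R y + x) = 0" by (intro g0) (simp add: ubox_def)
    qed auto
    then have gib: "(\<lambda>y. g ((1/2) *\<^sub>R y + x)) integrable_on ubox"
      unfolding ubox_def by (intro integrable_on_subcbox[of _ UNIV]) auto
    have gle: "integral ubox (\<lambda>y. g ((1/2) *\<^sub>R y + x)) \<le> 2 ^ DIM('a) * J"
    proof -
      have "integral ubox (\<lambda>y. g ((1/2) *\<^sub>R y + x)) \<le> integral UNIV (\<lambda>y. g ((1/2) *\<^sub>R y + x))"
        by (rule integral_subset_le[OF subset_UNIV gib]) (use gi in \<open>auto simp: g_def\<close>)
      then show ?thesis using integral_unique[OF gi] by simp
    qed
    have J0: "0 \<le> J" unfolding J_def by (rule integral_nonneg[OF intP]) auto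
    \<comment> \<open>Strictness keeps t positive even when J = 0; the bound at
      \<open>sqrt J\<close> itself follows by density.\<close>
    have "norm (P x) \<le> C * t" if t: "t > sqrt J" for t
    proof -
      have t0: "0 < t" using t J0 real_sqrt_ge_zero[OF J0] by linarith
      have Jt: "J \<le> t * t" using t J0 by (metis less_imp_le power2_eq_square real_le_lsqrt real_sqrt_le_iff real_sqrt_power t0 sqrt_le_D)
      have "bump_mass TYPE('a) * norm (P x) = norm (integral ubox (\<lambda>y. bump 3 y *\<^sub>R P (x + (1/2) *\<^sub>R y)))"
        unfolding mean_value[OF P] using bm by simp
      also have "\<dots> \<le> integral ubox (\<lambda>y. (1/2) * t + (1 / (2 * t)) * g ((1/2) *\<^sub>R y + x))"
      proof (rule Henstock_Kurzweil_Integration.integral_norm_bound_integral)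
        show "(\<lambda>y. bump 3 y *\<^sub>R P (x + (1/2) *\<^sub>R y)) integrable_on ubox"
          by (intro ubox_integrable continuous_intros cP)
        show "(\<lambda>y. (1/2) * t + (1 / (2 * t)) * g ((1/2) *\<^sub>R y + x)) integrable_on ubox"
          by (intro integrable_add integrable_on_mult_right gib ubox_integrable continuous_intros)
        fix y :: 'a
        show "norm (bump 3 y *\<^sub>R P (x + (1/2) *\<^sub>R y)) \<le> (1/2) * t + (1 / (2 * t)) * g ((1/2) *\<^sub>R y + x)"
        proof (cases "norm y \<ge> 1")
          case True
          then show ?thesis using t0 by (simp add: bump_eq_0 g_def)
        next
          case False
          have "norm ((1/2) *\<^sub>R y + x) < 1" using False x norm_triangle_ineq[of "(1/2) *\<^sub>R y" x] by simp
          then have g: "g ((1/2) *\<^sub>R y + x) = (norm (P (x + (1/2) *\<^sub>R y)))\<^sup>2" by (simp add: g_def add.commute)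
          define w where "w = norm (P (x + (1/2) *\<^sub>R y))"
          have "norm (bump 3 y *\<^sub>R P (x + (1/2) *\<^sub>R y)) \<le> w"
            using bump_le_1[of 3 y] by (simp add: w_def mult_left_le_one_le)
          also have "w \<le> (1/2) * t + (1 / (2 * t)) * w\<^sup>2"
          proof -
            have "0 \<le> (t - w)\<^sup>2" by simp
            then have "2 * t * w \<le> t * t + w\<^sup>2" by (simp add: power2_eq_square algebra_simps)
            then show ?thesis using t0 by (simp add: field_simps power2_eq_square)
          qed
          finally show ?thesis by (simp add: g w_def)
        qed
      qed
      also have "\<dots> = (1/2) * t * V + (1 / (2 * t)) * integral ubox (\<lambda>y. g ((1/2) *\<^sub>R y + x))"
      proof -
        have "integral ubox (\<lambda>y. (1/2) * t + (1 / (2 * t)) * g ((1/2) *\<^sub>R y + x)) =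
           integral ubox (\<lambda>y::'a. (1/2) * t) + integral ubox (\<lambda>y. (1 / (2 * t)) * g ((1/2) *\<^sub>R y + x))"
          by (intro integral_add integrable_on_mult_right gib ubox_integrable continuous_intros)
        moreover have "integral ubox (\<lambda>y::'a. (1/2) * t) = (1/2) * t * V" by (simp add: V_def ubox_def)
        ultimately show ?thesis by simp
      qed
      also have "\<dots> \<le> (1/2) * t * V + (1 / (2 * t)) * (2 ^ DIM('a) * (t * t))"
        using gle Jt t0 by (intro add_left_mono mult_left_mono order_trans[OF gle] mult_left_mono) auto
      also have "\<dots> = bump_mass TYPE('a) * (C * t)"
        using t0 bm by (simp add: C_def field_simps)
      finally show ?thesis using bm by simp
    qed
    note bound = this
    have "norm (P x) / C \<le> sqrt J"
    proof (rule dense_ge)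
      fix t assume "sqrt J < t"
      then show "norm (P x) / C \<le> t" using bound[of t] C by (simp add: field_simps)
    qed
    then show ?thesis using C by (simp add: J_def field_simps)
  qed
  then show ?thesis using that[of C] C by blast
qed

lemma norm_le_sup_sphere:
  assumes "C1 P" "norm u = 1" shows "norm (P u) \<le> sup_sphere P"
  unfolding sup_sphere_def
proof (rule cSup_upper)
  have "compact ((\<lambda>w. norm (P w)) ` sphere 0 1)"
    by (intro compact_continuous_image continuous_on_norm C1_continuous[OF assms(1)] continuous_on_id) simp
  then show "bdd_above ((\<lambda>w. norm (P w)) ` sphere 0 1)"
    by (intro bounded_imp_bdd_above compact_imp_bounded)
qed (use assms in auto)

lemma sup_sphere_le:
  assumes "\<And>u. norm u = 1 \<Longrightarrow> norm (P u) \<le> M" shows "sup_sphere P \<le> M"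
  unfolding sup_sphere_def by (rule cSup_least) (use assms in auto)

lemma sup_sphere_nonneg:
  fixes P :: "(real, 'n::{finite,linorder}) vec \<Rightarrow> 'n cliff"
  assumes "C1 P" shows "0 \<le> sup_sphere P"
proof -
  have "norm (axis undefined 1 :: (real, 'n) vec) = 1" by (simp add: norm_axis_1)
  from norm_le_sup_sphere[OF assms this] show ?thesis using norm_ge_zero order_trans by blast
qed

lemma L2_sphere_nonneg: "0 \<le> L2_sphere g"
proof -
  have "0 \<le> integral (ball 0 1) (\<lambda>x::(real, 'a) vec. (norm (g (x /\<^sub>R norm x)))\<^sup>2)"
    by (cases "(\<lambda>x::(real, 'a) vec. (norm (g (x /\<^sub>R norm x)))\<^sup>2) integrable_on ball 0 1")
       (auto intro: integral_nonneg simp: not_integrable_integral)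
  then show ?thesis unfolding L2_sphere_def by simp
qed

lemma radial_projection_integrable:
  assumes P: "cm.homog k P"
  shows "\<And>x. norm (P (x /\<^sub>R norm x)) \<le> sup_sphere P"
    and "(\<lambda>x. (norm (P (x /\<^sub>R norm x)))\<^sup>2) integrable_on ball 0 1"
proof -
  have C1: "C1 P" using P by (simp add: cm.homog_def)
  have "norm (P (x /\<^sub>R norm x)) \<le> norm (x /\<^sub>R norm x) ^ k * sup_sphere P" for x
    by (rule cm.homog_norm_le[OF P]) (rule norm_le_sup_sphere[OF C1])
  \<comment> \<open>The projection sends 0 to 0, so the projected point has norm 0 or 1 and the
    origin needs no exception.\<close>
  moreover have "norm (x /\<^sub>R norm x) ^ k * sup_sphere P \<le> 1 * sup_sphere P" for x :: "(real, 'a) vec"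
    by (intro mult_right_mono power_le_one sup_sphere_nonneg[OF C1]; cases "x = 0") auto
  ultimately show b: "\<And>x. norm (P (x /\<^sub>R norm x)) \<le> sup_sphere P" by (metis mult_1 order_trans)
  show "(\<lambda>x. (norm (P (x /\<^sub>R norm x)))\<^sup>2) integrable_on ball 0 1"
  proof (rule ball_integrable)
    have [measurable]: "P \<in> borel_measurable borel"
      using C1_continuous[OF C1 continuous_on_id] by (intro borel_measurable_continuous_onI) simp
    show "(\<lambda>x. (norm (P (x /\<^sub>R norm x)))\<^sup>2) \<in> borel_measurable borel" by measurable
    show "\<bar>(norm (P (x /\<^sub>R norm x)))\<^sup>2\<bar> \<le> (sup_sphere P)\<^sup>2" for x using b[of x] by (simp add: power_mono)
  qed
qed

lemma L2_sphere_le_sup: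
  assumes P: "cm.homog k (P :: (real, 'n::{finite,linorder}) vec \<Rightarrow> _)" shows "L2_sphere P \<le> sup_sphere P"
proof -
  define V where "V = Henstock_Kurzweil_Integration.content (ball (0 :: (real, 'n) vec) 1)"
  have V: "V > 0" unfolding V_def by (rule content_ball_pos) simp
  have S: "0 \<le> sup_sphere P" using sup_sphere_nonneg P by (auto simp: cm.homog_def)
  have one: "((\<lambda>x. (sup_sphere P)\<^sup>2) has_integral (sup_sphere P)\<^sup>2 * V) (ball (0 :: (real, 'n) vec) 1)"
  proof -
    have "((\<lambda>x. 1 :: real) has_integral V) (ball (0 :: (real, 'n) vec) 1)"
      using has_integral_measure_lborel[of "ball (0 :: (real, 'n) vec) 1"] emeasure_bounded_finite[OF bounded_ball, of "0 :: (real, 'n) vec" 1]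
      by (simp add: V_def)
    from has_integral_mult_right[OF this, of "(sup_sphere P)\<^sup>2"] show ?thesis by simp
  qed
  have "integral (ball 0 1) (\<lambda>x. (norm (P (x /\<^sub>R norm x)))\<^sup>2) \<le> (sup_sphere P)\<^sup>2 * V"
    by (rule has_integral_le[OF integrable_integral[OF radial_projection_integrable(2)[OF P]] one])
       (intro power_mono radial_projection_integrable(1)[OF P] norm_ge_zero)
  then have "integral (ball 0 1) (\<lambda>x. (norm (P (x /\<^sub>R norm x)))\<^sup>2) / V \<le> (sup_sphere P)\<^sup>2"
    using V by (simp add: divide_le_eq)
  then show ?thesis unfolding L2_sphere_def V_def[symmetric] using S by (intro real_le_lsqrt)
qed

text \<open>The interior estimate is applied at u/2, and homogeneity returns to u at the price 2^k.
  Inside the ball |P(y)| <= |P(y/|y|)|, which compares the solid integral with the spherical one.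
  The loss 2^k is geometric, hence harmless for \<open>decay\<close>.\<close>

lemma sup_le_L2_sphere:
  obtains C where "0 < C" 
    "\<And>k (P :: (real, 'n::{finite,linorder}) vec \<Rightarrow> 'n cliff) u. cm.sph_mono k P \<Longrightarrow> norm u = 1 \<Longrightarrow> norm (P u) \<le> C * 2 ^ k * L2_sphere P"
proof -
  obtain C where C: "0 < C" "\<And>(P :: (real, 'n) vec \<Rightarrow> 'n cliff) x. cm.V.nullsol P \<Longrightarrow> norm x \<le> 1/2 \<Longrightarrow>
      norm (P x) \<le> C * sqrt (integral (ball 0 1) (\<lambda>y. (norm (P y))\<^sup>2))"
    using cm.V.nullsol_norm_le_L2 by blast
  define V where "V = Henstock_Kurzweil_Integration.content (ball (0 :: (real, 'n) vec) 1)"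
  have V: "V > 0" unfolding V_def by (rule content_ball_pos) simp
  have "norm (P u) \<le> C * sqrt V * 2 ^ k * L2_sphere P" if P: "cm.sph_mono k P" and u: "norm u = 1" for k and P :: "(real, 'n) vec \<Rightarrow> 'n cliff" and u
  proof -
    have h: "cm.homog k P" and nullsol: "cm.V.nullsol P" using P by (auto simp: cm.sph_mono_def cm.V_nullsol_iff cm.homog_def)
    have C1: "C1 P" using h by (simp add: cm.homog_def)
    have intP: "(\<lambda>y. (norm (P y))\<^sup>2) integrable_on ball 0 1"
    proof (rule ball_integrable)
      show "(\<lambda>y. (norm (P y))\<^sup>2) \<in> borel_measurable borel"
        by (intro borel_measurable_continuous_onI continuous_intros C1_continuous[OF C1])
      show "\<bar>(norm (P y))\<^sup>2\<bar> \<le> (sup_sphere P)\<^sup>2" if y: "y \<in> ball 0 1" for y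
      proof -
        have "norm (P y) \<le> norm y ^ k * sup_sphere P"
          by (rule cm.homog_norm_le[OF h]) (rule norm_le_sup_sphere[OF C1])
        also have "\<dots> \<le> 1 * sup_sphere P"
          using y by (intro mult_right_mono power_le_one sup_sphere_nonneg[OF C1]) auto
        finally show ?thesis by (simp add: power_mono)
      qed
    qed
    have "integral (ball 0 1) (\<lambda>y. (norm (P y))\<^sup>2) \<le> integral (ball 0 1) (\<lambda>x. (norm (P (x /\<^sub>R norm x)))\<^sup>2)"
    proof (rule integral_le[OF intP radial_projection_integrable(2)[OF h]])
      fix y :: "(real, 'n) vec" assume y: "y \<in> ball 0 1"
      have "norm (P y) \<le> norm (P (y /\<^sub>R norm y))"
      proof (cases "y = 0")
        case False
        have "P y = P (norm y *\<^sub>R (y /\<^sub>R norm y))" using False by simp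
        also have "\<dots> = norm y ^ k *\<^sub>R P (y /\<^sub>R norm y)" using h unfolding cm.homog_def by blast
        finally have "norm (P y) = norm y ^ k * norm (P (y /\<^sub>R norm y))" by (metis abs_norm_cancel norm_scaleR power_abs)
        then show ?thesis using y by (simp add: mult_left_le_one_le power_le_one)
      qed simp
      then show "(norm (P y))\<^sup>2 \<le> (norm (P (y /\<^sub>R norm y)))\<^sup>2" by (simp add: power_mono)
    qed
    then have J: "sqrt (integral (ball 0 1) (\<lambda>y. (norm (P y))\<^sup>2)) \<le> sqrt V * L2_sphere P"
      unfolding L2_sphere_def V_def[symmetric] real_sqrt_mult[symmetric] using V by simp
    have "P u = P (2 *\<^sub>R ((1/2) *\<^sub>R u))" by simp
    also have "\<dots> = 2 ^ k *\<^sub>R P ((1/2) *\<^sub>R u)" using h unfolding cm.homog_def by blast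
    finally have "norm (P u) = 2 ^ k * norm (P ((1/2) *\<^sub>R u))" by simp
    also have "\<dots> \<le> 2 ^ k * (C * sqrt (integral (ball 0 1) (\<lambda>y. (norm (P y))\<^sup>2)))"
      using u by (intro mult_left_mono C(2)[OF nullsol]) auto
    also have "\<dots> \<le> 2 ^ k * (C * (sqrt V * L2_sphere P))"
      using C(1) J by (intro mult_left_mono) auto
    finally show ?thesis by (simp add: mult_ac)
  qed
  then show ?thesis using that[of "C * sqrt V"] C(1) V by simp
qed

lemma decay_iff:
  fixes P :: "nat \<Rightarrow> nat \<Rightarrow> (real, 'n::{finite,linorder}) vec \<Rightarrow> 'n cliff"
  assumes P: "\<And>k j. cm.sph_mono k (P k j)" and nrm: "nrm = L2_sphere \<or> nrm = sup_sphere"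
  shows "cm.decay P \<longleftrightarrow> Limsup (filtercomap (\<lambda>(j :: nat, k :: nat). j + k) at_top)
          (\<lambda>(j, k). ereal (root (j + k) (nrm (P k j)))) = 0"
proof -
  have h: "cm.homog k (P k j)" "C1 (P k j)" for k j using P[of k j] by (auto simp: cm.sph_mono_def cm.homog_def)
  have nn: "0 \<le> nrm (P k j)" for j k using nrm L2_sphere_nonneg sup_sphere_nonneg[OF h(2)] by auto
  have le: "nrm (P k j) \<le> sup_sphere (P k j)" for j k using nrm L2_sphere_le_sup[OF h(1)] by auto
  obtain C0 where C0: "0 < C0" "\<And>k (P :: (real, 'n) vec \<Rightarrow> 'n cliff) u. cm.sph_mono k P \<Longrightarrow> norm u = 1 \<Longrightarrow> norm (P u) \<le> C0 * 2 ^ k * L2_sphere P"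
    using sup_le_L2_sphere by blast
  define C where "C = max C0 1"
  have ge: "norm (P k j u) \<le> C * 2 ^ k * nrm (P k j)" if u: "norm u = 1" for k j u
    using nrm
  proof
    assume n: "nrm = L2_sphere"
    have "C0 * 2 ^ k * L2_sphere (P k j) \<le> C * 2 ^ k * L2_sphere (P k j)"
      by (intro mult_right_mono L2_sphere_nonneg) (auto simp: C_def)
    then show ?thesis unfolding n by (rule order_trans[OF C0(2)[OF P[of k j] u]])
  next
    assume n: "nrm = sup_sphere"
    have "norm (P k j u) \<le> 1 * 1 * sup_sphere (P k j)" using norm_le_sup_sphere[OF h(2) u] by simp
    also have "\<dots> \<le> C * 2 ^ k * sup_sphere (P k j)"
      by (intro mult_mono sup_sphere_nonneg[OF h(2)]) (auto simp: C_def)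
    finally show ?thesis by (simp add: n)
  qed
  have "cm.decay P \<longleftrightarrow> (\<forall>e>0. \<exists>N. \<forall>j k. N \<le> j + k \<longrightarrow> nrm (P k j) \<le> e ^ (j + k))"
  proof
    assume d: "cm.decay P"
    show "\<forall>e>0. \<exists>N. \<forall>j k. N \<le> j + k \<longrightarrow> nrm (P k j) \<le> e ^ (j + k)"
    proof (intro allI impI)
      fix e :: real assume "e > 0"
      then obtain N where N: "\<And>j k x. N \<le> j + k \<Longrightarrow> norm x = 1 \<Longrightarrow> norm (P k j x) \<le> e ^ (j + k)"
        using d unfolding cm.decay_def by blast
      have "nrm (P k j) \<le> e ^ (j + k)" if "N \<le> j + k" for j k
        by (rule order_trans[OF le sup_sphere_le]) (rule N[OF that])
      then show "\<exists>N. \<forall>j k. N \<le> j + k \<longrightarrow> nrm (P k j) \<le> e ^ (j + k)" by blast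
    qed
  next
    assume R: "\<forall>e>0. \<exists>N. \<forall>j k. N \<le> j + k \<longrightarrow> nrm (P k j) \<le> e ^ (j + k)"
    show "cm.decay P"
      unfolding cm.decay_def
    proof (intro allI impI)
      fix e :: real assume e: "e > 0"
      \<comment> \<open>The comparison constant C and the loss 2^k are each at most 2^(j + k) for
        large j + k, and the 4 pays for both.\<close>
      then have "e / 4 > 0" by simp
      then obtain N where N: "\<And>j k. N \<le> j + k \<Longrightarrow> nrm (P k j) \<le> (e / 4) ^ (j + k)"
        using R by blast
      obtain M where "C < 2 ^ M" using real_arch_pow[of 2 C] by auto
      have "norm (P k j x) \<le> e ^ (j + k)" if jk: "max N M \<le> j + k" and x: "norm x = 1" for j k x
      proof -
        define m where "m = j + k"
        have "2 ^ M \<le> (2::real) ^ m" using jk by (intro power_increasing) (auto simp: m_def)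
        then have Cm: "C \<le> 2 ^ m" using \<open>C < 2 ^ M\<close> by linarith
        have "norm (P k j x) \<le> C * 2 ^ k * nrm (P k j)" by (rule ge[OF x])
        also have "\<dots> \<le> 2 ^ m * 2 ^ m * (e / 4) ^ m"
        proof (intro mult_mono)
          show "(2::real) ^ k \<le> 2 ^ m" by (intro power_increasing) (auto simp: m_def)
          show "nrm (P k j) \<le> (e / 4) ^ m" unfolding m_def by (rule N) (use jk in simp)
        qed (use Cm nn e in auto)
        also have "\<dots> = (2 * 2 * (e / 4)) ^ m" by (simp only: power_mult_distrib)
        also have "\<dots> = e ^ (j + k)" by (simp add: m_def)
        finally show ?thesis .
      qed
      then show "\<exists>N. \<forall>j k x. N \<le> j + k \<longrightarrow> norm x = 1 \<longrightarrow> norm (P k j x) \<le> e ^ (j + k)" by blast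
    qed
  qed
  also have "\<dots> \<longleftrightarrow> Limsup (filtercomap (\<lambda>(j :: nat, k :: nat). j + k) at_top)
          (\<lambda>(j, k). ereal (root (j + k) (nrm (P k j)))) = 0"
    by (rule Limsup_root_iff[of "\<lambda>j k. nrm (P k j)", symmetric]) (rule nn)
  finally show ?thesis .
qed

section \<open>Assembly for the real Clifford algebra\<close>

lemma expansion_iff:
  assumes "nrm = L2_sphere \<or> nrm = sup_sphere"
  shows "expansion nrm f P \<longleftrightarrow> (\<forall>k j. hom_poly k (P k j)) \<and> (\<forall>k j. cm.sph_mono k (P k j)) \<and> cm.decay P \<and>
     (\<forall>x. ((\<lambda>(j, k). cm.Xact k j x (P k j (snd x))) has_sum f x) UNIV)"
  unfolding expansion_def Xpoly_Xact spherical_monogenic_iff using decay_iff[OF _ assms, of P] by auto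

theorem theorem3p4:
  fixes f :: "real \<times> (real ^ 'n::{finite,linorder}) \<Rightarrow> 'n cliff"
    and nrm :: "(real ^ 'n::{finite,linorder} \<Rightarrow> 'n cliff) \<Rightarrow> real"
  assumes "card (UNIV :: 'n set) \<ge> 2"
    and "nrm = L2_sphere \<or> nrm = sup_sphere"
  shows "(monogenic f \<longleftrightarrow> (\<exists>P. expansion nrm f P))
         \<and> (\<forall>P Q. expansion nrm f P \<longrightarrow> expansion nrm f Q \<longrightarrow> P = Q)"
proof (intro conjI iffI allI impI)
  have n: "2 \<le> DIM((real, 'n) vec)" using assms(1) by simp
  note ex = expansion_iff[OF assms(2)]
  show "\<exists>P. expansion nrm f P" if "monogenic f"
  proof
    have f: "cm.X.nullsol f" using that by (simp add: monogenic_iff)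
    show "expansion nrm f (cm.fischer f)"
      unfolding ex
      using hom_poly_fischer[OF f] cm.homog_fischer[OF f] cm.dirac_op_fischer[OF f] cm.fischer_decay[OF f] cm.expansion_exists[OF n f]
      by (simp add: cm.sph_mono_def)
  qed
  show "monogenic f" if P: "\<exists>P. expansion nrm f P"
  proof -
    obtain P where P: "\<And>k j. cm.sph_mono k (P k j)" "cm.decay P"
       "\<And>x. ((\<lambda>(j, k). cm.Xact k j x (P k j (snd x))) has_sum f x) UNIV"
      using P unfolding ex by blast
    \<comment> \<open>The coefficients alone produce a monogenic sum \<open>h\<close>; regularity of
      \<open>f\<close> then comes from uniqueness of the pointwise sums.\<close>
    obtain h where h: "cm.X.nullsol h" "\<And>x. ((\<lambda>(j, k). cm.Xact k j x (P k j (snd x))) has_sum h x) UNIV"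
      using cm.expansion_converges[OF n P(1,2)] by blast
    have "f x = h x" for x using has_sum_unique[OF P(3) h(2)] .
    then show ?thesis using h(1) unfolding monogenic_iff by presburger
  qed
  show "P = Q" if "expansion nrm f P" "expansion nrm f Q" for P Q
    using that unfolding ex by (intro cm.expansion_unique[OF n, of P Q f]) blast+
qed

end
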